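(* Let $n\ge2$ and let $E,F\subset\mathbb{R}^n$ be compact sets with $\dim_{qH}E=\dim_{qH}F=0$. Assume that $\theta\mapsto\overline{\dim}_\theta E$ and $\theta\mapsto\overline{\dim}_\theta F$ are right differentiable at $\theta=0$ (with $+\infty$ allowed as a value of the derivative), but that $$\left.\frac{d}{d\theta}\,\overline{\dim}_\theta E\right|_{\theta=0}<\left.\frac{d}{d\theta}\,\overline{\dim}_\theta F\right|_{\theta=0}=+\infty.$$ Then no quasiconformal map of $\mathbb{R}^n$ sends $E$ to $F$; that is, there is no quasiconformal homeomorphism $f:\mathbb{R}^n\to\mathbb{R}^n$ with $f(E)=F$.
   Context: For a bounded set $A\subset\mathbb{R}^n$ and $0<\theta<1$, the upper $\theta$-intermediate dimension $\overline{\dim}_\theta A$ is the infimum of those $s>0$ such that for each $\epsilon>0$ there exists $\delta_0>0$ so that for each $0<\delta\le\delta_0$ there is a countable covering $(A_i)$ of $A$ by subsets of $\mathbb{R}^n$ with $\delta^{1/\theta}\le\operatorname{diam}(A_i)\le\delta$ for all $i$ and $\sum_i(\operatorname{diam}A_i)^s<\epsilon$. The (upper) quasi-Hausdorff dimension is $\dim_{qH}A:=\lim_{\theta\searrow0}\overline{\dim}_\theta A$ (the limit exists by monotonicity in $\theta$). At $\theta=0$ one sets $\overline{\dim}_0A:=\dim_HA$ (Hausdorff dimension), which equals $0$ when $\dim_{qH}A=0$ since $\dim_HA\le\dim_{qH}A$. Thus, when $\dim_{qH}A=0$, the right derivative at $\theta=0$ is $\lim_{\theta\searrow0}\overline{\dim}_\theta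 A/\theta\in[0,+\infty]$, assumed to exist. A homeomorphism $f:\Omega\to\Omega'$ between domains in $\mathbb{R}^n$, $n\ge2$, is $K$-quasiconformal ($K\ge1$) if $f\in W^{1,n}_{loc}(\Omega:\mathbb{R}^n)$ and $\|Df(x)\|^n\le K\det Df(x)$ for a.e. $x\in\Omega$ (operator norm); it is quasiconformal if it is $K$-quasiconformal for some $K\ge1$. *)

theory Defs
  imports "HOL-Analysis.Analysis"
begin

section \<open>Hausdorff dimension\<close>

text \<open>
  Countable families of sets are indexed by subsets of \<^typ>\<open>nat\<close>, so finite families are included.
  Since \<^const>\<open>diameter\<close> has an unspecified value on unbounded sets, the members of a cover
  are required to be bounded.
\<close>

definition hausdorff_premeasure :: "real \<Rightarrow> real \<Rightarrow> 'a::metric_space set \<Rightarrow> ennreal" where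
  "hausdorff_premeasure s \<delta> A =
     Inf {(\<Sum>\<^sub>\<infinity>i\<in>I. ennreal (diameter (U i) powr s)) | (I :: nat set) U.
            A \<subseteq> (\<Union>i\<in>I. U i) \<and> (\<forall>i\<in>I. bounded (U i) \<and> diameter (U i) \<le> \<delta>)}"

definition hausdorff_measure :: "real \<Rightarrow> 'a::metric_space set \<Rightarrow> ennreal" where
  "hausdorff_measure s A = (SUP \<delta>\<in>{0<..}. hausdorff_premeasure s \<delta> A)"

definition hausdorff_dim :: "'a::metric_space set \<Rightarrow> ereal" where
  "hausdorff_dim A = Inf {ereal s | s. s > 0 \<and> hausdorff_measure s A = 0}"

section \<open>Intermediate dimensions\<close>

definition intermediate_admissible :: "real \<Rightarrow> 'a::metric_space set \<Rightarrow> real \<Rightarrow> bool" where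
  "intermediate_admissible \<theta> A s \<longleftrightarrow>
     (\<forall>\<epsilon>>0. \<exists>\<delta>0>0. \<forall>\<delta>. 0 < \<delta> \<and> \<delta> \<le> \<delta>0 \<longrightarrow>
        (\<exists>(I :: nat set) U. A \<subseteq> (\<Union>i\<in>I. U i) \<and>
           (\<forall>i\<in>I. bounded (U i) \<and> \<delta> powr (1 / \<theta>) \<le> diameter (U i) \<and> diameter (U i) \<le> \<delta>) \<and>
           (\<Sum>\<^sub>\<infinity>i\<in>I. ennreal (diameter (U i) powr s)) < ennreal \<epsilon>))"

text \<open>Meaningful for \<open>0 \<le> \<theta> < 1\<close>; at \<open>\<theta> = 0\<close> it is the Hausdorff dimension.\<close>

definition upper_intermediate_dim :: "real \<Rightarrow> 'a::metric_space set \<Rightarrow> ereal" where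
  "upper_intermediate_dim \<theta> A =
     (if \<theta> = 0 then hausdorff_dim A
      else Inf {ereal s | s. s > 0 \<and> intermediate_admissible \<theta> A s})"

text \<open>The limit exists because the upper intermediate dimension is nondecreasing in \<open>\<theta> > 0\<close>.\<close>

definition quasi_hausdorff_dim :: "'a::metric_space set \<Rightarrow> ereal" where
  "quasi_hausdorff_dim A = Lim (at_right 0) (\<lambda>\<theta>. upper_intermediate_dim \<theta> A)"

text \<open>One-sided derivative, with infinite values allowed.\<close>

definition has_right_derivative_ereal :: "(real \<Rightarrow> ereal) \<Rightarrow> ereal \<Rightarrow> real \<Rightarrow> bool" where
  "has_right_derivative_ereal f D x \<longleftrightarrow>
     ((\<lambda>y. (f y - f x) / ereal (y - x)) \<longlongrightarrow> D) (at_right x)"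

section \<open>Local Sobolev spaces\<close>

text \<open>
  On a finite-dimensional space this is class \<open>C\<^sup>k\<close>, as joint continuity of the derivative
  amounts to continuity of all directional derivatives.
\<close>

primrec class_C :: "nat \<Rightarrow> ('a::euclidean_space \<Rightarrow> 'b::euclidean_space) \<Rightarrow> bool" where
  "class_C 0 f \<longleftrightarrow> continuous_on UNIV f"
| "class_C (Suc k) f \<longleftrightarrow>
     f differentiable_on UNIV \<and> (\<forall>v. class_C k (\<lambda>x. frechet_derivative f (at x) v))"

definition test_function :: "'a::euclidean_space set \<Rightarrow> ('a \<Rightarrow> real) \<Rightarrow> bool" where
  "test_function \<Omega> \<phi> \<longleftrightarrow>
     (\<forall>k. class_C k \<phi>) \<and> compact (closure {x. \<phi> x \<noteq> 0}) \<and> closure {x. \<phi> x \<noteq> 0} \<subseteq> \<Omega>"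

definition Lp_loc ::
    "real \<Rightarrow> 'a::euclidean_space set \<Rightarrow> ('a \<Rightarrow> 'b::euclidean_space) \<Rightarrow> bool" where
  "Lp_loc p \<Omega> u \<longleftrightarrow>
     u \<in> borel_measurable (lebesgue_on \<Omega>) \<and>
     (\<forall>C. compact C \<and> C \<subseteq> \<Omega> \<longrightarrow> integrable (lebesgue_on C) (\<lambda>x. norm (u x) powr p))"

definition weak_partial ::
    "(real^'n) set \<Rightarrow> 'n \<Rightarrow> (real^'n \<Rightarrow> real) \<Rightarrow> (real^'n \<Rightarrow> real) \<Rightarrow> bool" where
  "weak_partial \<Omega> j u g \<longleftrightarrow>
     Lp_loc 1 \<Omega> u \<and> Lp_loc 1 \<Omega> g \<and>
     (\<forall>\<phi>. test_function \<Omega> \<phi> \<longrightarrow>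
        integral\<^sup>L (lebesgue_on \<Omega>) (\<lambda>x. u x * frechet_derivative \<phi> (at x) (axis j 1)) =
        - integral\<^sup>L (lebesgue_on \<Omega>) (\<lambda>x. g x * \<phi> x))"

text \<open>\<open>f\<close> belongs to \<open>W\<^sup>1\<^sup>,\<^sup>p\<close> locally on \<open>\<Omega>\<close>, and \<open>Df\<close> represents its weak Jacobian matrix.\<close>

definition W1p_loc_with_derivative ::
    "real \<Rightarrow> (real^'n) set \<Rightarrow> (real^'n \<Rightarrow> real^'m) \<Rightarrow> (real^'n \<Rightarrow> real^'n^'m) \<Rightarrow> bool" where
  "W1p_loc_with_derivative p \<Omega> f Df \<longleftrightarrow>
     Lp_loc p \<Omega> f \<and> Lp_loc p \<Omega> Df \<and>
     (\<forall>i j. weak_partial \<Omega> j (\<lambda>x. f x $ i) (\<lambda>x. Df x $ i $ j))"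

section \<open>Quasiconformal maps\<close>

definition domain :: "'a::topological_space set \<Rightarrow> bool" where
  "domain \<Omega> \<longleftrightarrow> open \<Omega> \<and> connected \<Omega> \<and> \<Omega> \<noteq> {}"

text \<open>
  The weak derivative is determined up to null sets, so the choice of the representative \<open>Df\<close>
  does not matter.
\<close>

definition K_quasiconformal ::
    "real \<Rightarrow> (real^'n) set \<Rightarrow> (real^'n) set \<Rightarrow> (real^'n \<Rightarrow> real^'n) \<Rightarrow> bool" where
  "K_quasiconformal K \<Omega> \<Omega>' f \<longleftrightarrow>
     K \<ge> 1 \<and> domain \<Omega> \<and> domain \<Omega>' \<and>
     (\<exists>g. homeomorphism \<Omega> \<Omega>' f g) \<and>
     (\<exists>Df. W1p_loc_with_derivative (real CARD('n)) \<Omega> f Df \<and>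
           (AE x in lebesgue_on \<Omega>. onorm ((*v) (Df x)) ^ CARD('n) \<le> K * det (Df x)))"

definition quasiconformal ::
    "(real^'n) set \<Rightarrow> (real^'n) set \<Rightarrow> (real^'n \<Rightarrow> real^'n) \<Rightarrow> bool" where
  "quasiconformal \<Omega> \<Omega>' f \<longleftrightarrow> (\<exists>K\<ge>1. K_quasiconformal K \<Omega> \<Omega>' f)"

end

theory Submission
  imports Defs
begin

text \<open>
  The right derivative at \<open>0\<close> can only grow by a bounded factor under a Hoelder map: if \<open>f\<close> is
  \<open>\<alpha>\<close>-Hoelder on \<open>E\<close>, the image of a cover admissible for \<open>\<theta>\<close>, with small images enlarged to the
  least allowed diameter, is again admissible for the same \<open>\<theta>\<close>, so
  \<open>dim\<^sub>\<theta> (f E) \<le> dim\<^sub>\<theta> E / \<alpha>\<close>, while both Hausdorff dimensions vanish.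

  It remains to see that a quasiconformal \<open>f\<close> is locally Hoelder, which needs only the Sobolev
  regularity and the distortion inequality, not injectivity. The Jacobian is a null Lagrangian, so
  \<open>\<integral> \<eta> det Df\<close> is at most a multiple of the energy \<open>\<integral> \<bar>Df\<bar>\<^sup>n\<close> on the annulus where the cutoff
  \<open>\<eta>\<close> varies, by the Poincare inequality there. With \<open>\<bar>Df\<bar>\<^sup>n \<le> K det Df\<close>, hole filling makes the energy
  of cubes decay geometrically in the scale, and Morrey's telescoping argument gives Hoelder continuity.
\<close>

section \<open>Determinants of compactly supported maps\<close>

text \<open>Only the positivity of the Hoelder exponent matters: a finite slope stays finite after
  division by any \<alpha> > 0, so no sharp exponent is sought and all constants are crude. The
  power of the gradient in the energy equals the dimension, which makes every estimate scale
  invariant: the factor \<open>r ^ n\<close> of the Poincare inequality cancels the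
  \<open>1 / r ^ n\<close> produced by the cutoff, and one decay factor serves all centres and
  scales. The obstacle is that the derivative is only weak. Identities for determinants are proved
  for C1 maps and transferred by mollification; convergence of the derivatives in the n-th power
  mean is just enough for the determinant, which has degree n. The null Lagrangian property is
  obtained from volumes, so that no second derivatives and no cofactor identities occur. The annulus
  is not convex, while the elementary Poincare inequality by translations is proved on boxes. The
  annulus is therefore cut into overlapping boxes whose centres are compared in a chain; the chain
  between opposite faces goes through a face of another axis, and here the dimension must be at
  least 2.\<close>

lemma coeff_prod_linear:
  fixes a b :: "'i \<Rightarrow> real"
  assumes "finite S"
  shows "coeff (\<Prod>i\<in>S. [:a i, b i:]) (card S) = (\<Prod>i\<in>S. b i)"
    and "k > card S \<Longrightarrow> coeff (\<Prod>i\<in>S. [:a i, b i:]) k = 0"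
proof -
  have "coeff (\<Prod>i\<in>S. [:a i, b i:]) (card S) = (\<Prod>i\<in>S. b i) \<and> (\<forall>k>card S. coeff (\<Prod>i\<in>S. [:a i, b i:]) k = 0)"
    using assms
  proof (induction S)
    case (insert x S)
    have *: "coeff (\<Prod>i\<in>insert x S. [:a i, b i:]) (Suc k)
        = a x * coeff (\<Prod>i\<in>S. [:a i, b i:]) (Suc k) + b x * coeff (\<Prod>i\<in>S. [:a i, b i:]) k" for k
      using insert by simp
    show ?case
    proof (intro conjI allI impI)
      show "coeff (\<Prod>i\<in>insert x S. [:a i, b i:]) (card (insert x S)) = (\<Prod>i\<in>insert x S. b i)"
        using insert * by simp
      fix k assume "k > card (insert x S)"
      then obtain l where "k = Suc l" "l > card S" using insert by (cases k) auto
      then show "coeff (\<Prod>i\<in>insert x S. [:a i, b i:]) k = 0"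
        using insert * by simp
    qed
  qed (auto simp: coeff_eq_0)
  then show "coeff (\<Prod>i\<in>S. [:a i, b i:]) (card S) = (\<Prod>i\<in>S. b i)"
    and "k > card S \<Longrightarrow> coeff (\<Prod>i\<in>S. [:a i, b i:]) k = 0" by auto
qed

lemma continuous_on_coeff_prod_linear:
  fixes a b :: "'i \<Rightarrow> 'x::topological_space \<Rightarrow> real"
  assumes "finite S" "\<And>i. continuous_on X (a i)" "\<And>i. continuous_on X (b i)"
  shows "continuous_on X (\<lambda>x. coeff (\<Prod>i\<in>S. [:a i x, b i x:]) k)"
  using assms(1)
proof (induction S arbitrary: k)
  case (insert j S)
  then show ?case
    by (cases k) (auto intro!: continuous_intros assms simp: coeff_pCons)
qed auto

text \<open>In the Leibniz formula each permutation contributes a product of linear polynomials in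
  \<open>t\<close>, whose top coefficient is the corresponding product of entries of
  \<open>A x\<close>. The coefficients are kept as continuous functions of \<open>x\<close>, so that
  they can be integrated one by one.\<close>

lemma det_one_plus_eq_poly:
  fixes A :: "'x::topological_space \<Rightarrow> real^'n^'n"
  assumes "continuous_on X A"
  obtains c where "\<And>k. continuous_on X (c k)"
    "\<And>x t. det (mat 1 + t *\<^sub>R A x) = (\<Sum>k\<le>CARD('n). c k x * t ^ k)"
    "\<And>x. c (CARD('n)) x = det (A x)"
proof -
  define P where "P x p = (\<Prod>i\<in>UNIV. [:if i = p i then 1 else 0, A x $ i $ p i:])" for x and p :: "'n \<Rightarrow> 'n"
  define c where "c k x = (\<Sum>p | p permutes UNIV. of_int (sign p) * coeff (P x p) k)" for k x
  show ?thesis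
  proof
    show "continuous_on X (c k)" for k
      unfolding c_def P_def
      by (intro continuous_intros continuous_on_coeff_prod_linear finite assms)
    show "c (CARD('n)) x = det (A x)" for x
      unfolding c_def P_def det_def by (simp add: coeff_prod_linear)
    show "det (mat 1 + t *\<^sub>R A x) = (\<Sum>k\<le>CARD('n). c k x * t ^ k)" for x t
    proof -
      have d: "degree (P x p) \<le> CARD('n)" for p
        unfolding P_def by (rule degree_le) (simp add: coeff_prod_linear)
      have "det (mat 1 + t *\<^sub>R A x) = (\<Sum>p | p permutes UNIV. of_int (sign p) * poly (P x p) t)"
        unfolding det_def P_def poly_prod by (auto simp: mat_def intro!: sum.cong prod.cong)
      also have "\<dots> = (\<Sum>p | p permutes UNIV. of_int (sign p) * (\<Sum>k\<le>CARD('n). coeff (P x p) k * t ^ k))"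
      proof (intro sum.cong refl arg_cong2[where f="(*)"])
        fix p
        show "poly (P x p) t = (\<Sum>k\<le>CARD('n). coeff (P x p) k * t ^ k)"
          unfolding poly_altdef using d[of p]
          by (intro sum.mono_neutral_left) (auto simp: coeff_eq_0)
      qed
      also have "\<dots> = (\<Sum>k\<le>CARD('n). c k x * t ^ k)"
        unfolding c_def sum_distrib_left sum_distrib_right
        by (subst sum.swap) (simp add: mult_ac)
      finally show ?thesis .
    qed
  qed
qed

lemma norm_matrix_vector_mult_le:
  fixes A :: "real^'n^'m"
  shows "norm (A *v v) \<le> norm A * norm v"
proof -
  have "norm (A *v v) = L2_set (\<lambda>i. norm ((A *v v) $ i)) UNIV"
    by (simp add: norm_vec_def)
  also have "\<dots> \<le> L2_set (\<lambda>i. norm (A $ i) * norm v) UNIV"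
    by (intro L2_set_mono) (auto simp: matrix_vector_mul_component Cauchy_Schwarz_ineq2)
  also have "\<dots> = norm A * norm v"
    by (simp add: norm_vec_def L2_set_left_distrib)
  finally show ?thesis .
qed

lemma lipschitz_if_bounded_derivative:
  fixes h :: "real^'n \<Rightarrow> real^'n"
  assumes "\<And>x. (h has_derivative (\<lambda>v. H x *v v)) (at x)" "\<And>x. norm (H x) \<le> M"
  shows "norm (h x - h y) \<le> M * norm (x - y)"
proof (rule differentiable_bound[where S = UNIV and f' = "\<lambda>x v. H x *v v"])
  show "onorm ((*v) (H x)) \<le> M" for x
    by (rule onorm_le) (meson assms(2) mult_right_mono norm_ge_zero norm_matrix_vector_mult_le order_trans)
qed (use assms in auto)

text \<open>Since \<open>t * M < 1\<close>, the map \<open>t *\<^sub>R h\<close> is a contraction: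
  this gives injectivity at once and, by Banach's fixed point theorem for
  \<open>x \<mapsto> y - t *\<^sub>R h x\<close>, surjectivity. Points outside the ball are fixed,
  so a bijection of the whole space has to map the ball onto itself.\<close>

lemma perturbed_identity_image_cball:
  fixes h :: "'a::euclidean_space \<Rightarrow> 'a"
  assumes lip: "\<And>x y. norm (h x - h y) \<le> M * norm (x - y)"
    and supp: "\<And>x. norm x > R \<Longrightarrow> h x = 0" and t: "0 \<le> t" "t * M < 1"
  shows "inj_on (\<lambda>x. x + t *\<^sub>R h x) UNIV" "(\<lambda>x. x + t *\<^sub>R h x) ` cball 0 R = cball 0 R"
proof -
  have lip': "norm (t *\<^sub>R h x - t *\<^sub>R h y) \<le> (t * M) * norm (x - y)" for x y
  proof -
    have "norm (t *\<^sub>R h x - t *\<^sub>R h y) = t * norm (h x - h y)"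
      using t by (simp flip: scaleR_diff_right)
    then show ?thesis using mult_left_mono[OF lip[of x y] t(1)] by (simp add: mult_ac)
  qed
  show inj: "inj_on (\<lambda>x. x + t *\<^sub>R h x) UNIV"
  proof (rule injI)
    fix x y assume "x + t *\<^sub>R h x = y + t *\<^sub>R h y"
    then have "x - y = t *\<^sub>R h y - t *\<^sub>R h x" by (simp add: algebra_simps)
    then have "norm (x - y) \<le> (t * M) * norm (x - y)" using lip'[of y x] by (simp add: norm_minus_commute)
    then have "(1 - t * M) * norm (x - y) \<le> 0" by (simp add: algebra_simps)
    then show "x = y" using t by (simp add: mult_le_0_iff)
  qed
  have fixed: "x + t *\<^sub>R h x = x" if "x \<notin> cball 0 R" for x
    using supp[of x] that by simp
  have onto: "\<exists>x. x + t *\<^sub>R h x = y" for y :: 'a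
  proof -
    have "\<exists>!x\<in>UNIV. y - t *\<^sub>R h x = x"
    proof (rule Banach_fix)
      show "0 \<le> max 0 (t * M)" "max 0 (t * M) < 1" using t by auto
      fix x z
      have "norm (t *\<^sub>R h z - t *\<^sub>R h x) \<le> (t * M) * norm (z - x)" by (rule lip')
      also have "\<dots> \<le> max 0 (t * M) * norm (z - x)" by (intro mult_right_mono) auto
      finally show "dist (y - t *\<^sub>R h x) (y - t *\<^sub>R h z) \<le> max 0 (t * M) * dist x z"
        by (simp add: dist_norm norm_minus_commute)
    qed (auto simp: complete_UNIV)
    then show ?thesis by (metis diff_add_cancel)
  qed
  show "(\<lambda>x. x + t *\<^sub>R h x) ` cball 0 R = cball 0 R"
  proof (intro equalityI subsetI)
    fix y assume "y \<in> (\<lambda>x. x + t *\<^sub>R h x) ` cball 0 R"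
    then obtain x where x: "x \<in> cball 0 R" "y = x + t *\<^sub>R h x" by auto
    show "y \<in> cball 0 R"
    proof (rule ccontr)
      assume "y \<notin> cball 0 R"
      then have "y = x" using injD[OF inj, of y x] fixed[of y] x by simp
      with x \<open>y \<notin> cball 0 R\<close> show False by simp
    qed
  next
    fix y :: 'a assume y: "y \<in> cball 0 R"
    obtain x where x: "x + t *\<^sub>R h x = y" using onto by blast
    have "x \<in> cball 0 R" using fixed[of x] x y by (cases "x \<in> cball 0 R") auto
    then show "y \<in> (\<lambda>x. x + t *\<^sub>R h x) ` cball 0 R" using x by auto
  qed
qed

text \<open>The ball is mapped injectively onto itself, so the change of variables formula evaluates
  the integral of the Jacobian as the volume of the ball. Nonnegativity of the determinant removes
  the absolute value, without which the integrand would not be polynomial in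
  \<open>t\<close>.\<close>

lemma has_integral_det_perturbed_identity:
  fixes h :: "real^'n::{finite,wellorder} \<Rightarrow> real^'n::_"
  assumes der: "\<And>x. (h has_derivative (\<lambda>v. H x *v v)) (at x)"
    and lip: "\<And>x y. norm (h x - h y) \<le> M * norm (x - y)"
    and supp: "\<And>x. norm x > R \<Longrightarrow> h x = 0" and t: "0 \<le> t" "t * M < 1"
    and pos: "\<And>x. det (mat 1 + t *\<^sub>R H x) \<ge> 0"
  shows "((\<lambda>x. det (mat 1 + t *\<^sub>R H x)) has_integral measure lebesgue (cball (0::real^'n::_) R)) (cball 0 R)"
proof -
  let ?g = "\<lambda>x. x + t *\<^sub>R h x" and ?g' = "\<lambda>x v. (mat 1 + t *\<^sub>R H x) *v v"
  have "?g ` cball 0 R \<in> lmeasurable \<and> measure lebesgue (?g ` cball 0 R) = measure lebesgue (cball (0::real^'n::_) R)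
     \<longleftrightarrow> ((\<lambda>x. \<bar>det (matrix (?g' x))\<bar>) has_integral measure lebesgue (cball (0::real^'n::_) R)) (cball 0 R)"
  proof (rule has_measure_differentiable_image)
    show "inj_on ?g (cball 0 R)"
      using perturbed_identity_image_cball(1)[OF lip supp t] inj_on_subset by blast
    show "(?g has_derivative ?g' x) (at x within cball 0 R)" for x
    proof -
      have "?g' x = (\<lambda>v. v + t *\<^sub>R (H x *v v))"
        by (auto simp: matrix_vector_mult_add_rdistrib scaleR_matrix_vector_assoc)
      then show ?thesis
        by (auto intro!: derivative_eq_intros has_derivative_at_withinI[OF der])
    qed
  qed auto
  moreover have "?g ` cball 0 R = cball 0 R"
    by (rule perturbed_identity_image_cball(2)[where M = M]) (use assms in auto)
  ultimately show ?thesis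
    using lmeasurable_cball[of "0::real^'n::_" R] by (simp only: matrix_of_matrix_vector_mul abs_of_nonneg[OF pos]) simp
qed

text \<open>
  For small \<open>t\<close> the map \<open>x + t h(x)\<close> permutes a large ball, so the integral of \<open>det (I + t Dh)\<close>, a
  polynomial in \<open>t\<close>, is constant near \<open>0\<close> and its top coefficient vanishes.
\<close>

lemma integral_det_compact_support_wellorder:
  fixes h :: "real^'n::{finite,wellorder} \<Rightarrow> real^'n::_"
  assumes der: "\<And>x. (h has_derivative (\<lambda>v. H x *v v)) (at x)"
    and cont: "continuous_on UNIV H" and R: "\<And>x. norm x > R \<Longrightarrow> h x = 0 \<and> H x = 0"
  shows "integral (cball 0 R) (\<lambda>x. det (H x)) = 0"
proof -
  have "bounded (H ` cball 0 R)"
    by (intro compact_imp_bounded compact_continuous_image continuous_on_subset[OF cont]) auto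
  then obtain M0 where "\<And>x. x \<in> cball 0 R \<Longrightarrow> norm (H x) \<le> M0"
    unfolding bounded_iff by (metis image_eqI)
  \<comment> \<open>The maximum with 1 makes \<open>M\<close> positive, so that it also bounds
    \<open>H x = 0\<close> outside the ball and can be divided by below.\<close>
  define M where "M = max M0 1"
  have M: "norm (H x) \<le> M" for x
    unfolding M_def using R[of x] \<open>\<And>x. x \<in> cball 0 R \<Longrightarrow> norm (H x) \<le> M0\<close>[of x]
    by (cases "norm x > R") auto
  have "M > 0" unfolding M_def by auto
  have lip: "norm (h x - h y) \<le> M * norm (x - y)" for x y
    by (rule lipschitz_if_bounded_derivative[OF der M])
  have "continuous_on UNIV (\<lambda>A::real^'n::_^'n::_. det A)"
    unfolding det_def by (intro continuous_intros)
  then have "isCont (\<lambda>A::real^'n::_^'n::_. det A) (mat 1)"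
    by (simp add: continuous_on_eq_continuous_at)
  then have "\<forall>\<^sub>F A in at (mat 1::real^'n::_^'n::_). det A > 0"
    unfolding isCont_def by (rule order_tendstoD) simp
  then obtain d where d: "d > 0" "\<And>A::real^'n::_^'n::_. A \<noteq> mat 1 \<Longrightarrow> dist A (mat 1) < d \<Longrightarrow> det A > 0"
    unfolding eventually_at by auto
  obtain c where c: "\<And>k. continuous_on UNIV (c k)"
    "\<And>x t. det (mat 1 + t *\<^sub>R H x) = (\<Sum>k\<le>CARD('n). c k x * t ^ k)"
    "\<And>x. c (CARD('n)) x = det (H x)"
    using det_one_plus_eq_poly[OF cont] by blast
  define I where "I k = integral (cball 0 R) (c k)" for k
  have I: "(c k has_integral I k) (cball 0 R)" for k
  proof -
    have "set_integrable lborel (cball 0 R) (c k)"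
      unfolding set_integrable_def
      by (intro borel_integrable_compact continuous_on_subset[OF c(1)]) auto
    then show ?thesis
      unfolding I_def by (intro integrable_integral set_borel_integral_eq_integral)
  qed
  define V where "V = measure lebesgue (cball (0::real^'n::_) R)"
  define p where "p = (\<Sum>k\<le>CARD('n). monom (I k) k) - [:V:]"
  have "poly p t = 0" if t: "t \<in> {0<..<min (d / M) (1 / M)}" for t
  proof -
    have t': "0 < t" "t * M < d" "t * M < 1" using t \<open>M > 0\<close> by (auto simp: field_simps)
    have "det (mat 1 + t *\<^sub>R H x) > 0" for x
    proof -
      have "dist (mat 1 + t *\<^sub>R H x) (mat 1) = t * norm (H x)" using t' by (simp add: dist_norm)
      also have "\<dots> \<le> t * M" using t' M by (intro mult_left_mono) auto
      finally have "dist (mat 1 + t *\<^sub>R H x) (mat 1) < d" using t' by simp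
      then show ?thesis using d(2)[of "mat 1 + t *\<^sub>R H x"] by (cases "mat 1 + t *\<^sub>R H x = mat 1") auto
    qed
    then have "((\<lambda>x. det (mat 1 + t *\<^sub>R H x)) has_integral V) (cball 0 R)"
      unfolding V_def using R t' by (intro has_integral_det_perturbed_identity[OF der lip]) (auto intro: less_imp_le)
    moreover have "((\<lambda>x. det (mat 1 + t *\<^sub>R H x)) has_integral (\<Sum>k\<le>CARD('n). I k * t ^ k)) (cball 0 R)"
      unfolding c(2) by (intro has_integral_sum has_integral_mult_left I) auto
    ultimately have "V = (\<Sum>k\<le>CARD('n). I k * t ^ k)" by (rule has_integral_unique)
    then show ?thesis unfolding p_def by (simp add: poly_sum poly_monom)
  qed
  then have "{0<..<min (d / M) (1 / M)} \<subseteq> {t. poly p t = 0}" by blast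
  moreover have "infinite {0<..<min (d / M) (1 / M)}" using d \<open>M > 0\<close> by (simp add: infinite_Ioo)
  ultimately have "p = 0" using poly_roots_finite infinite_super by blast
  then have "coeff p (CARD('n)) = 0" by simp
  \<comment> \<open>The constant polynomial of the volume does not reach the top coefficient because
    the dimension is positive.\<close>
  moreover have "coeff p (CARD('n)) = I (CARD('n))"
    unfolding p_def by (cases "CARD('n)") (auto simp: coeff_sum coeff_pCons)
  ultimately show ?thesis unfolding I_def c(3) by simp
qed


text \<open>
  The change of variables formula of the library is restricted to index types of class
  \<^class>\<open>wellorder\<close>, so an arbitrary finite index type is replaced by an ordered copy.
\<close>

typedef ('a::finite) ordered_copy = "{..<CARD('a)}" by (auto intro: exI[of _ 0])

lemma bij_ordered_copy: "\<exists>b :: 'a::finite ordered_copy \<Rightarrow> 'a. bij b"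
proof -
  obtain g where "bij_betw g {..<CARD('a)} (UNIV :: 'a set)"
    using ex_bij_betw_nat_finite[of "UNIV::'a set"] by (auto simp: atLeast0LessThan)
  moreover have "bij_betw (Rep_ordered_copy :: 'a ordered_copy \<Rightarrow> nat) UNIV {..<CARD('a)}"
    using type_definition.Rep_range[OF type_definition_ordered_copy[where 'a = 'a]] Rep_ordered_copy_inject
    by (auto simp: bij_betw_def inj_on_def)
  ultimately show ?thesis using bij_betw_trans by blast
qed

instance ordered_copy :: (finite) finite
proof
  obtain b :: "'a ordered_copy \<Rightarrow> 'a" where "bij b" using bij_ordered_copy by blast
  then show "finite (UNIV :: 'a ordered_copy set)" using bij_betw_finite finite by blast
qed

instantiation ordered_copy :: (finite) wellorder
begin
definition "a < b \<longleftrightarrow> Rep_ordered_copy a < Rep_ordered_copy b"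
definition "a \<le> b \<longleftrightarrow> Rep_ordered_copy a \<le> Rep_ordered_copy b"
instance
proof
  fix P :: "'a ordered_copy \<Rightarrow> bool" and a
  assume "\<And>x. (\<And>y. y < x \<Longrightarrow> P y) \<Longrightarrow> P x"
  then show "P a"
    unfolding less_ordered_copy_def by (rule measure_induct_rule[of Rep_ordered_copy])
qed (auto simp: less_ordered_copy_def less_eq_ordered_copy_def Rep_ordered_copy_inject)
end

text \<open>Renaming rows and columns by the same bijection conjugates every permutation in the
  Leibniz sum; conjugation preserves the sign and only reorders the factors of each product.\<close>

lemma det_reindex:
  fixes A :: "real^'n^'n" and b :: "'m::finite \<Rightarrow> 'n"
  assumes b: "bij b"
  shows "det (\<chi> i j. A $ b i $ b j) = det A"
proof -
  have "det A = (\<Sum>p | p permutes UNIV. of_int (sign (map_permutation UNIV b p)) *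
      (\<Prod>i\<in>UNIV. A $ i $ map_permutation UNIV b p i))"
    unfolding det_def
  proof (rule sum.reindex_bij_betw[symmetric])
    show "bij_betw (map_permutation UNIV b) {p. p permutes UNIV} {p. p permutes UNIV}"
    proof (rule bij_betwI[where g = "map_permutation UNIV (inv b)"])
      have "bij (inv b)" using b by (rule bij_imp_bij_inv)
      show "map_permutation UNIV b \<in> {p. p permutes UNIV} \<rightarrow> {p. p permutes UNIV}"
        "map_permutation UNIV (inv b) \<in> {p. p permutes UNIV} \<rightarrow> {p. p permutes UNIV}"
        using map_permutation_permutes b \<open>bij (inv b)\<close> by blast+
      show "map_permutation UNIV (inv b) (map_permutation UNIV b p) = p" if "p \<in> {p. p permutes UNIV}" for p
        using that b by (intro map_permutation_compose_inv) (auto simp: bij_is_inj)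
      show "map_permutation UNIV b (map_permutation UNIV (inv b) p) = p" if "p \<in> {p. p permutes UNIV}" for p
        using that \<open>bij (inv b)\<close> b by (intro map_permutation_compose_inv) (auto simp: bij_is_surj surj_f_inv_f)
    qed
  qed
  also have "\<dots> = (\<Sum>p | p permutes UNIV. of_int (sign p) * (\<Prod>i\<in>UNIV. A $ b i $ b (p i)))"
  proof (intro sum.cong refl arg_cong2[where f="(*)"])
    fix p :: "'m \<Rightarrow> 'm" assume p: "p \<in> {p. p permutes UNIV}"
    show "real_of_int (sign (map_permutation UNIV b p)) = real_of_int (sign p)"
      using p b by (subst sign_map_permutation) (auto simp: bij_is_inj)
    have "(\<Prod>i\<in>UNIV. A $ i $ map_permutation UNIV b p i) = (\<Prod>i\<in>UNIV. A $ b i $ map_permutation UNIV b p (b i))"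
      using b by (intro prod.reindex_bij_betw[symmetric])
    then show "(\<Prod>i\<in>UNIV. A $ i $ map_permutation UNIV b p i) = (\<Prod>i\<in>UNIV. A $ b i $ b (p i))"
      using b by (simp add: map_permutation_apply bij_is_inj)
  qed
  finally show ?thesis unfolding det_def by simp
qed

lemma prod_Basis_vec:
  fixes f :: "real^'n \<Rightarrow> 'b::comm_monoid_mult"
  shows "(\<Prod>i\<in>Basis. f i) = (\<Prod>i\<in>UNIV. f (axis i 1))"
proof -
  have B: "Basis = (\<lambda>i. axis i (1::real)) ` (UNIV :: 'n set)"
    by (auto simp: Basis_vec_def)
  show ?thesis
    unfolding B by (simp add: prod.reindex inj_on_def axis_eq_axis)
qed

text \<open>Lebesgue measure is determined by its values on boxes, and a renaming of coordinates
  pulls a box back to a box with the same side lengths in another order.\<close>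

lemma lborel_distr_reindex:
  fixes b :: "'m::finite \<Rightarrow> 'n::finite"
  assumes b: "bij b"
  shows "distr lborel borel (\<lambda>y::real^'m. \<chi> i. y $ inv b i) = (lborel :: (real^'n) measure)"
proof (rule lborel_eqI[symmetric])
  fix l u :: "real^'n" assume le: "\<And>i. i \<in> Basis \<Longrightarrow> l \<bullet> i \<le> u \<bullet> i"
  have m: "(\<lambda>y::real^'m. \<chi> i. y $ inv b i) \<in> borel_measurable borel"
    by (intro borel_measurable_continuous_onI continuous_intros)
  have le': "l $ i \<le> u $ i" for i
    using le[of "axis i 1"] by (simp add: inner_axis)
  have "(\<lambda>y::real^'m. \<chi> i. y $ inv b i) -` box l u = box (\<chi> j. l $ b j) (\<chi> j. u $ b j)"
    using b by (auto simp: mem_box_cart bij_is_inj bij_is_surj) (metis bij_inv_eq_iff)+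
  then have "emeasure (distr lborel borel (\<lambda>y::real^'m. \<chi> i. y $ inv b i)) (box l u)
      = emeasure lborel (box (\<chi> j. l $ b j) (\<chi> j. u $ b j))"
    using m by (subst emeasure_distr) auto
  also have "\<dots> = (\<Prod>i\<in>UNIV. ennreal (u $ b i - l $ b i))"
  proof -
    have "\<forall>k\<in>Basis. (\<chi> j. l $ b j) \<bullet> k \<le> (\<chi> j. u $ b j) \<bullet> k"
      using le' by (auto simp: Basis_vec_def inner_axis)
    then show ?thesis
      using le' by (simp add: emeasure_lborel_box_eq prod_Basis_vec inner_axis prod_ennreal)
  qed
  also have "\<dots> = (\<Prod>i\<in>UNIV. ennreal (u $ i - l $ i))"
    using b by (rule prod.reindex_bij_betw)
  also have "\<dots> = (\<Prod>i\<in>Basis. (u - l) \<bullet> i)"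
    using le' by (simp add: prod_Basis_vec inner_axis prod_ennreal)
  finally show "emeasure (distr lborel borel (\<lambda>y::real^'m. \<chi> i. y $ inv b i)) (box l u) = (\<Prod>i\<in>Basis. (u - l) \<bullet> i)" .
qed simp

lemma integral_lborel_reindex:
  fixes b :: "'m::finite \<Rightarrow> 'n::finite" and F :: "real^'n \<Rightarrow> real"
  assumes "bij b" and "F \<in> borel_measurable borel"
  shows "integral\<^sup>L lborel (\<lambda>y::real^'m. F (\<chi> i. y $ inv b i)) = integral\<^sup>L lborel F"
proof -
  have "(\<lambda>y::real^'m. \<chi> i. y $ inv b i) \<in> borel_measurable borel"
    by (intro borel_measurable_continuous_onI continuous_intros)
  then show ?thesis
    using assms(2) by (subst lborel_distr_reindex[OF assms(1), symmetric], subst integral_distr) auto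
qed

theorem integral_det_compact_support:
  fixes h :: "real^'n \<Rightarrow> real^'n"
  assumes der: "\<And>x. (h has_derivative (\<lambda>v. H x *v v)) (at x)"
    and cont: "continuous_on UNIV H" and R: "\<And>x. norm x > R \<Longrightarrow> h x = 0 \<and> H x = 0"
  shows "integral\<^sup>L lborel (\<lambda>x. det (H x)) = 0"
proof -
  obtain b :: "'n ordered_copy \<Rightarrow> 'n" where b: "bij b" using bij_ordered_copy by blast
  \<comment> \<open>The mutually inverse renamings \<open>\<psi>\<close> and \<open>\<phi>\<close>
    transport \<open>h\<close> to the ordered index type; its Jacobian matrix there is
    \<open>H\<close> with rows and columns renamed simultaneously, so the determinant is
    unchanged.\<close>
  define \<psi> where "\<psi> y = (\<chi> i. y $ inv b i)" for y :: "real^'n ordered_copy"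
  define \<phi> where "\<phi> x = (\<chi> j. x $ b j)" for x :: "real^'n"
  define h' where "h' y = \<phi> (h (\<psi> y))" for y
  define H' where "H' y = (\<chi> i j. H (\<psi> y) $ b i $ b j)" for y
  have cont_\<psi>: "continuous_on UNIV \<psi>"
    unfolding \<psi>_def by (intro continuous_intros)
  have cont_det: "continuous_on UNIV (\<lambda>x. det (H x))"
    unfolding det_def by (intro continuous_intros cont)
  have bl: "bounded_linear \<psi>" "bounded_linear \<phi>"
    unfolding \<psi>_def \<phi>_def by (auto intro!: linear_conv_bounded_linear[THEN iffD1] linearI simp: vec_eq_iff)
  have norm_\<psi>: "norm (\<psi> y) = norm y" for y
    unfolding norm_vec_def \<psi>_def L2_set_def
    using sum.reindex_bij_betw[OF bij_imp_bij_inv[OF b], of "\<lambda>j. (norm (y $ j))\<^sup>2"] by simp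
  have cH': "continuous_on UNIV H'"
    unfolding H'_def by (intro continuous_intros continuous_on_compose2[OF cont cont_\<psi>]) auto
  have supp: "h' y = 0 \<and> H' y = 0" if "norm y > R" for y
    using R[of "\<psi> y"] that by (simp add: norm_\<psi> h'_def H'_def \<phi>_def vec_eq_iff)
  have "integral (cball 0 R) (\<lambda>x. det (H' x)) = 0"
  proof (rule integral_det_compact_support_wellorder[where h = h'])
    fix y
    have "H' y *v v = \<phi> (H (\<psi> y) *v \<psi> v)" for v
      unfolding H'_def \<phi>_def matrix_vector_mult_def \<psi>_def
      using sum.reindex_bij_betw[OF b, of "\<lambda>j. H (\<chi> i. y $ inv b i) $ b k $ j * v $ inv b j" for k] b
      by (simp add: vec_eq_iff bij_is_inj)
    then have eq: "(*v) (H' y) = (\<lambda>v. \<phi> (H (\<psi> y) *v \<psi> v))" by auto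
    have "((\<lambda>y. h (\<psi> y)) has_derivative (\<lambda>v. H (\<psi> y) *v \<psi> v)) (at y)"
      by (rule has_derivative_compose[OF bounded_linear_imp_has_derivative[OF bl(1)] der])
    from has_derivative_compose[OF this bounded_linear_imp_has_derivative[OF bl(2)]]
    show "(h' has_derivative (*v) (H' y)) (at y)"
      unfolding eq h'_def .
  qed (use cH' supp in auto)
  moreover have "set_integrable lborel (cball 0 R) (\<lambda>y. det (H' y))"
    unfolding set_integrable_def det_def
    by (intro borel_integrable_compact continuous_intros continuous_on_subset[OF cH']) auto
  ultimately have "(LINT y:cball 0 R|lborel. det (H' y)) = 0"
    using set_borel_integral_eq_integral(2) by metis
  moreover have "(LINT y:cball 0 R|lborel. det (H' y)) = integral\<^sup>L lborel (\<lambda>y. det (H' y))"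
    unfolding set_lebesgue_integral_def
  proof (intro Bochner_Integration.integral_cong refl)
    have "det (0::real^'n ordered_copy^'n ordered_copy) = 0" by (rule det_zero_row(1)[of undefined]) (simp add: row_def vec_eq_iff)
    then show "indicat_real (cball 0 R) y *\<^sub>R det (H' y) = det (H' y)" for y
      using supp[of y] by (cases "norm y > R") (auto simp: indicator_def)
  qed
  moreover have "det (H' y) = det (H (\<psi> y))" for y
    unfolding H'_def using b by (rule det_reindex)
  moreover have "integral\<^sup>L lborel (\<lambda>y. det (H (\<psi> y))) = integral\<^sup>L lborel (\<lambda>x. det (H x))"
    unfolding \<psi>_def using b cont_det
    by (intro integral_lborel_reindex borel_measurable_continuous_onI)
  ultimately show ?thesis by simp
qed

section \<open>Null Lagrangians and the Caccioppoli inequality for smooth maps\<close>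

lemma has_derivative_vec_iff:
  fixes f :: "'a::real_normed_vector \<Rightarrow> real^'n"
  shows "(f has_derivative f') (at x within S) \<longleftrightarrow> (\<forall>i. ((\<lambda>x. f x $ i) has_derivative (\<lambda>v. f' v $ i)) (at x within S))"
  by (subst has_derivative_componentwise_within) (auto simp: Basis_vec_def inner_axis)

text \<open>Balls of the maximum norm, with \<open>r\<close> half the side length. They are boxes of
  explicit volume, and the shells between them split into finitely many boxes, on which convexity
  arguments apply.\<close>

definition cube :: "real^'n \<Rightarrow> real \<Rightarrow> (real^'n) set" where
  "cube a r = {x. \<forall>i. \<bar>x $ i - a $ i\<bar> \<le> r}"

lemma cube_eq_cbox: "cube a r = cbox (\<chi> i. a $ i - r) (\<chi> i. a $ i + r)"
  by (auto simp: cube_def mem_box_cart abs_le_iff algebra_simps)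

lemma compact_cube [simp]: "compact (cube a r)"
  by (simp add: cube_eq_cbox)

lemma cube_mono: "r \<le> s \<Longrightarrow> cube a r \<subseteq> cube a s"
  by (auto simp: cube_def intro: order_trans)

definition annulus :: "real^'n \<Rightarrow> real \<Rightarrow> (real^'n) set" where
  "annulus a r = {x \<in> cube a (2 * r). \<exists>i. r \<le> \<bar>x $ i - a $ i\<bar>}"

lemma compact_annulus [simp]: "compact (annulus a r)"
proof -
  have "annulus a r = cube a (2 * r) \<inter> (\<Union>i. {x. r \<le> \<bar>x $ i - a $ i\<bar>})"
    by (auto simp: annulus_def)
  moreover have "closed (\<Union>i\<in>UNIV. {x. r \<le> \<bar>x $ i - a $ i\<bar>})"
    by (intro closed_UN finite ballI closed_Collect_le continuous_intros)
  ultimately show ?thesis by (simp add: compact_Int_closed)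
qed

section \<open>A continuously differentiable cutoff for cubes\<close>

definition sqr_pos :: "real \<Rightarrow> real" where "sqr_pos t = (max 0 t)\<^sup>2"

lemma sqr_pos_nonneg [simp]: "0 \<le> sqr_pos t"
  by (simp add: sqr_pos_def)

lemma sqr_pos_eq_0 [simp]: "t \<le> 0 \<Longrightarrow> sqr_pos t = 0"
  by (simp add: sqr_pos_def)

lemma has_real_derivative_sqr_pos [derivative_intros]:
  "(sqr_pos has_real_derivative 2 * max 0 t) (at t)"
proof (cases "t = 0")
  case True
  have "((\<lambda>h. (sqr_pos (0 + h) - sqr_pos 0) / h) \<longlongrightarrow> 0) (at 0)"
  proof (rule Lim_null_comparison[where g = "\<lambda>h. \<bar>h\<bar>"])
    show "\<forall>\<^sub>F h in at 0. norm ((sqr_pos (0 + h) - sqr_pos 0) / h) \<le> \<bar>h\<bar>"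
      by (intro always_eventually) (auto simp: sqr_pos_def power2_eq_square max_def)
  qed (auto intro!: tendsto_eq_intros)
  then show ?thesis using True by (simp add: DERIV_def)
next
  case False
  show ?thesis
  proof (cases "t < 0")
    case True
    have "((\<lambda>t. 0) has_real_derivative 2 * max 0 t) (at t)" using True by simp
    moreover have "\<forall>\<^sub>F s in nhds t. s \<in> {..<0}" using True by (intro eventually_nhds_in_open) auto
    then have "\<forall>\<^sub>F s in nhds t. sqr_pos s = 0" by eventually_elim simp
    ultimately show ?thesis by (subst DERIV_cong_ev[OF refl _ refl])
  next
    case f: False
    have "((\<lambda>t. t\<^sup>2) has_real_derivative 2 * max 0 t) (at t)"
      using f by (auto intro!: derivative_eq_intros)
    moreover have "\<forall>\<^sub>F s in nhds t. s \<in> {0<..}" using f False by (intro eventually_nhds_in_open) auto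
    then have "\<forall>\<^sub>F s in nhds t. sqr_pos s = s\<^sup>2" by eventually_elim (simp add: sqr_pos_def)
    ultimately show ?thesis by (subst DERIV_cong_ev[OF refl _ refl])
  qed
qed

lemma continuous_on_sqr_pos [continuous_intros]:
  "continuous_on S f \<Longrightarrow> continuous_on S (\<lambda>x. sqr_pos (f x))"
  unfolding sqr_pos_def by (intro continuous_intros)

text \<open>The total squared excess of the coordinates over the interval from -1 to 1. It vanishes
  on \<open>cube 0 1\<close> and is at least 1 outside \<open>cube 0 2\<close>, so a function of it
  cuts off between these cubes. The squared positive part is C1, which is all the regularity a
  cutoff needs here.\<close>

definition overshoot :: "real^'n \<Rightarrow> real" where
  "overshoot x = (\<Sum>i\<in>UNIV. sqr_pos (x $ i - 1) + sqr_pos (- x $ i - 1))"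

definition plateau :: "real^'n \<Rightarrow> real" where
  "plateau x = sqr_pos (1 - overshoot x)"

definition plateau_grad :: "real^'n \<Rightarrow> real^'n" where
  "plateau_grad x = (\<chi> i. - 2 * max 0 (1 - overshoot x) * (2 * max 0 (x $ i - 1) - 2 * max 0 (- x $ i - 1)))"

lemma has_derivative_plateau: "(plateau has_derivative (\<lambda>v. plateau_grad x \<bullet> v)) (at x)"
proof -
  have s: "((\<lambda>x. sqr_pos (f x)) has_derivative (\<lambda>v. 2 * max 0 (f x) * f' v)) (at x)"
    if "(f has_derivative f') (at x)" for f and f' :: "real^'a \<Rightarrow> real"
    using has_derivative_compose[OF that has_real_derivative_sqr_pos[unfolded has_field_derivative_def]] by simp
  have o: "(overshoot has_derivative (\<lambda>v. \<Sum>i\<in>UNIV. 2 * max 0 (x $ i - 1) * v $ i + 2 * max 0 (- x $ i - 1) * (- v $ i))) (at x)"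
    unfolding overshoot_def
    by (intro has_derivative_sum has_derivative_add s)
       (auto intro!: derivative_eq_intros bounded_linear_imp_has_derivative bounded_linear_vec_nth)
  have "(plateau has_derivative (\<lambda>v. 2 * max 0 (1 - overshoot x) * (0 - (\<Sum>i\<in>UNIV. 2 * max 0 (x $ i - 1) * v $ i + 2 * max 0 (- x $ i - 1) * (- v $ i))))) (at x)"
    unfolding plateau_def by (intro s has_derivative_diff o has_derivative_const)
  then show ?thesis
    by (rule has_derivative_eq_rhs)
      (auto simp: plateau_grad_def inner_vec_def sum_distrib_left algebra_simps sum_subtractf simp flip: sum_negf)
qed

lemma continuous_on_plateau_grad: "continuous_on UNIV (plateau_grad :: real^'n \<Rightarrow> real^'n)"
  unfolding plateau_grad_def overshoot_def by (intro continuous_intros)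

lemma overshoot_nonneg: "0 \<le> overshoot x"
  unfolding overshoot_def by (intro sum_nonneg add_nonneg_nonneg) auto

lemma overshoot_ge: "sqr_pos (x $ i - 1) + sqr_pos (- x $ i - 1) \<le> overshoot x"
  unfolding overshoot_def by (rule member_le_sum) auto

lemma plateau_inside:
  assumes "x \<in> cube 0 1"
  shows "plateau x = 1" "plateau_grad x = 0"
proof -
  have *: "\<bar>x $ i\<bar> \<le> 1" for i using assms by (simp add: cube_def)
  have a: "x $ i - 1 \<le> 0" "- x $ i - 1 \<le> 0" for i using *[of i] by auto
  then have "overshoot x = 0" unfolding overshoot_def by simp
  then show "plateau x = 1" by (simp add: plateau_def sqr_pos_def)
  show "plateau_grad x = 0" using a by (simp add: plateau_grad_def vec_eq_iff max_absorb1)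
qed

lemma overshoot_outside:
  assumes "x \<notin> cube 0 2"
  shows "overshoot x \<ge> 1"
proof -
  obtain i where "\<bar>x $ i\<bar> > 2" using assms by (auto simp: cube_def not_le)
  then have "x $ i - 1 \<ge> 1 \<or> - x $ i - 1 \<ge> 1" by linarith
  then have "sqr_pos (x $ i - 1) \<ge> 1 \<or> sqr_pos (- x $ i - 1) \<ge> 1"
    by (auto simp: sqr_pos_def max_def)
  then show ?thesis
    using overshoot_ge[of x i] sqr_pos_nonneg[of "x $ i - 1"] sqr_pos_nonneg[of "- x $ i - 1"] by linarith
qed

lemma plateau_outside:
  assumes "x \<notin> cube 0 2"
  shows "plateau x = 0" "plateau_grad x = 0"
  using overshoot_outside[OF assms] by (auto simp: plateau_def plateau_grad_def vec_eq_iff)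

lemma plateau_bounds: "0 \<le> plateau x" "plateau x \<le> 1"
  using overshoot_nonneg[of x] by (auto simp: plateau_def sqr_pos_def max_def power_le_one)

text \<open>Where \<open>overshoot\<close> is at least 1 the gradient vanishes; elsewhere every
  excess is below 1 and each component is at most 2 * 4. Summing the components gives the dimension
  as a factor.\<close>

lemma norm_plateau_grad_le: "norm (plateau_grad (x :: real^'n)) \<le> 8 * CARD('n)"
proof -
  have "\<bar>plateau_grad x $ i\<bar> \<le> 8" for i
  proof (cases "overshoot x < 1")
    case True
    have less1: "max 0 t \<le> 1" if "sqr_pos t < 1" for t
      using that by (auto simp: sqr_pos_def max_def power_less_one_iff split: if_splits)
    have "sqr_pos (x $ i - 1) < 1" "sqr_pos (- x $ i - 1) < 1"
      using overshoot_ge[of x i] True sqr_pos_nonneg[of "x $ i - 1"] sqr_pos_nonneg[of "- x $ i - 1"] by linarith+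
    then have "\<bar>2 * max 0 (x $ i - 1) - 2 * max 0 (- x $ i - 1)\<bar> \<le> 4"
      using less1 by (smt (verit))
    moreover have "\<bar>- 2 * max 0 (1 - overshoot x)\<bar> \<le> 2" using overshoot_nonneg[of x] True by simp
    ultimately have "\<bar>- 2 * max 0 (1 - overshoot x)\<bar> * \<bar>2 * max 0 (x $ i - 1) - 2 * max 0 (- x $ i - 1)\<bar> \<le> 2 * 4"
      by (intro mult_mono) auto
    then show ?thesis by (simp add: plateau_grad_def abs_mult)
  qed (auto simp: plateau_grad_def)
  then have "(\<Sum>i\<in>UNIV. \<bar>plateau_grad x $ i\<bar>) \<le> (\<Sum>i\<in>(UNIV::'n set). 8)"
    by (intro sum_mono)
  then show ?thesis using norm_le_l1_cart[of "plateau_grad x"] by simp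
qed

text \<open>The fixed profile \<open>plateau\<close> is translated and rescaled, so the gradient
  bound scales exactly like \<open>1 / r\<close> with a constant independent of centre and size.
  This uniformity is what allows one decay factor for all cubes.\<close>

lemma cutoff_cube:
  fixes a :: "real^'n"
  assumes "r > 0"
  obtains \<eta> v where "\<And>x. (\<eta> has_derivative (\<lambda>h. v x \<bullet> h)) (at x)" "continuous_on UNIV v"
    "\<And>x. 0 \<le> \<eta> x" "\<And>x. \<eta> x \<le> 1" "\<And>x. x \<in> cube a r \<Longrightarrow> \<eta> x = 1 \<and> v x = 0"
    "\<And>x. x \<notin> cube a (2 * r) \<Longrightarrow> \<eta> x = 0 \<and> v x = 0" "\<And>x. norm (v x) \<le> 8 * CARD('n) / r"
proof
  define s where "s x = (1 / r) *\<^sub>R (x - a)" for x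
  have in_cube: "s x \<in> cube 0 t \<longleftrightarrow> x \<in> cube a (t * r)" for x t
    using assms by (simp add: s_def cube_def abs_mult field_simps)
  show "((\<lambda>x. plateau (s x)) has_derivative (\<lambda>h. ((1 / r) *\<^sub>R plateau_grad (s x)) \<bullet> h)) (at x)" for x
  proof -
    have "(s has_derivative (\<lambda>h. (1 / r) *\<^sub>R h)) (at x)"
      unfolding s_def by (auto intro!: derivative_eq_intros)
    from has_derivative_compose[OF this has_derivative_plateau] show ?thesis by simp
  qed
  show "continuous_on UNIV (\<lambda>x. (1 / r) *\<^sub>R plateau_grad (s x))"
    unfolding s_def by (intro continuous_intros continuous_on_compose2[OF continuous_on_plateau_grad]) auto
  show "plateau (s x) = 1 \<and> (1 / r) *\<^sub>R plateau_grad (s x) = 0" if "x \<in> cube a r" for x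
    using that in_cube[of x 1] plateau_inside[of "s x"] by simp
  show "plateau (s x) = 0 \<and> (1 / r) *\<^sub>R plateau_grad (s x) = 0" if "x \<notin> cube a (2 * r)" for x
    using that in_cube[of x 2] plateau_outside[of "s x"] by simp
  show "norm ((1 / r) *\<^sub>R plateau_grad (s x)) \<le> 8 * CARD('n) / r" for x
    using norm_plateau_grad_le[of "s x"] assms by (simp add: field_simps)
qed (use plateau_bounds in auto)

text \<open>
  The identity is the vanishing of \<open>\<integral> det Dh\<close> for the compactly supported map \<open>h\<close> obtained from \<open>g\<close>
  by multiplying \<open>g $ i0 - c\<close> by \<open>\<eta>\<close> and the other components by a cutoff equal to \<open>1\<close> on the support of \<open>\<eta>\<close>.
\<close>

lemma null_lagrangian_identity:
  fixes g :: "real^'n \<Rightarrow> real^'n" and i0 :: 'n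
  assumes g: "\<And>x. (g has_derivative (\<lambda>v. Dg x *v v)) (at x)" "continuous_on UNIV Dg"
    and \<eta>: "\<And>x. (\<eta> has_derivative (\<lambda>h. v x \<bullet> h)) (at x)" "continuous_on UNIV v"
    and \<eta>0: "\<And>x. x \<notin> C \<Longrightarrow> \<eta> x = 0 \<and> v x = 0"
    and \<xi>: "\<And>x. (\<xi> has_derivative (\<lambda>h. w x \<bullet> h)) (at x)" "continuous_on UNIV w"
    and \<xi>1: "\<And>x. x \<in> C \<Longrightarrow> \<xi> x = 1 \<and> w x = 0"
    and \<xi>0: "\<And>x. x \<notin> B \<Longrightarrow> \<xi> x = 0 \<and> w x = 0"
    and B: "compact B" "C \<subseteq> B"
  shows "integral\<^sup>L lborel (\<lambda>x. \<eta> x * det (Dg x)) =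
     - integral\<^sup>L lborel (\<lambda>x. (g x $ i0 - c) * det (\<chi> i. if i = i0 then v x else Dg x $ i))"
proof -
  define h where "h x = (\<chi> i. if i = i0 then \<eta> x * (g x $ i - c) else \<xi> x * g x $ i)" for x
  define H where "H x = (\<chi> i. if i = i0 then \<eta> x *s Dg x $ i + (g x $ i - c) *s v x
      else \<xi> x *s Dg x $ i + g x $ i *s w x)" for x
  have cont: "continuous_on UNIV \<eta>" "continuous_on UNIV \<xi>" "continuous_on UNIV g"
    using has_derivative_continuous[OF \<eta>(1)] has_derivative_continuous[OF \<xi>(1)] has_derivative_continuous[OF g(1)]
    by (auto simp: continuous_on_eq_continuous_at)
  obtain R where R: "B \<subseteq> cball 0 R" using bounded_subset_ballD[OF compact_imp_bounded[OF B(1)], of 0] ball_subset_cball by (metis order_trans)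
  \<comment> \<open>Row \<open>i0\<close> of \<open>H x\<close> is a sum, and the determinant is
    linear in it. On \<open>C\<close> the second cutoff is constantly 1 and leaves the other rows
    equal to those of \<open>Dg x\<close>; off \<open>C\<close> row \<open>i0\<close> is zero in
    both terms, so what \<open>\<xi>\<close> does to the other rows is irrelevant.\<close>
  have detH: "det (H x) = \<eta> x * det (Dg x) + (g x $ i0 - c) * det (\<chi> i. if i = i0 then v x else Dg x $ i)" for x
  proof -
    have *: "det (H x) = \<eta> x * det (\<chi> i. if i = i0 then Dg x $ i else \<xi> x *s Dg x $ i + g x $ i *s w x)
       + (g x $ i0 - c) * det (\<chi> i. if i = i0 then v x else \<xi> x *s Dg x $ i + g x $ i *s w x)"
    proof -
      have "H x = (\<chi> i. if i = i0 then \<eta> x *s Dg x $ i + (g x $ i0 - c) *s v x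
        else \<xi> x *s Dg x $ i + g x $ i *s w x)"
        unfolding H_def by (auto simp: vec_eq_iff)
      then show ?thesis by (simp only: det_row_add det_row_mul)
    qed
    show ?thesis
    proof (cases "x \<in> C")
      case True
      have "(\<chi> i. if i = i0 then Dg x $ i else Dg x $ i) = Dg x" by (simp add: vec_eq_iff)
      then show ?thesis using * \<xi>1[OF True] by (simp cong: if_cong)
    next
      case False
      have "det (\<chi> i. if i = i0 then 0 else b i) = 0" for b :: "'n \<Rightarrow> real^'n"
        by (rule det_zero_row(1)[of i0]) (simp add: row_def vec_eq_iff)
      then show ?thesis using * \<eta>0[OF False] by (simp cong: if_cong)
    qed
  qed
  have "integral\<^sup>L lborel (\<lambda>x. det (H x)) = 0"
  proof (rule integral_det_compact_support[where h = h and R = R])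
    show "continuous_on UNIV H"
      unfolding H_def scalar_mult_eq_scaleR
    proof (intro continuous_on_vec_lambda)
      fix i show "continuous_on UNIV (\<lambda>x. if i = i0 then \<eta> x *\<^sub>R Dg x $ i + (g x $ i - c) *\<^sub>R v x
           else \<xi> x *\<^sub>R Dg x $ i + g x $ i *\<^sub>R w x)"
        by (cases "i = i0") (auto intro!: continuous_intros cont g(2) \<eta>(2) \<xi>(2))
    qed
    fix x
    show "h x = 0 \<and> H x = 0" if "R < norm x"
    proof -
      have "x \<notin> B" "x \<notin> C" using that R B(2) by (auto simp: subset_iff)
      then show ?thesis using \<eta>0 \<xi>0 by (simp add: h_def H_def vec_eq_iff)
    qed
    have gi: "((\<lambda>x. g x $ i) has_derivative (\<lambda>h. Dg x $ i \<bullet> h)) (at x)" for i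
      using g(1)[of x] unfolding has_derivative_vec_iff by (simp add: matrix_vector_mul_component)
    show "(h has_derivative (*v) (H x)) (at x)"
      unfolding has_derivative_vec_iff
    proof
      fix i
      show "((\<lambda>x. h x $ i) has_derivative (\<lambda>v. (H x *v v) $ i)) (at x)"
      proof (cases "i = i0")
        case True
        have "((\<lambda>x. \<eta> x * (g x $ i - c)) has_derivative (\<lambda>h. \<eta> x * (Dg x $ i \<bullet> h - 0) + (v x \<bullet> h) * (g x $ i - c))) (at x)"
          by (intro has_derivative_mult \<eta> has_derivative_diff gi has_derivative_const)
        then show ?thesis using True
          by (simp add: h_def H_def matrix_vector_mul_component scalar_mult_eq_scaleR inner_add_left mult_ac)
      next
        case False
        have "((\<lambda>x. \<xi> x * (g x $ i)) has_derivative (\<lambda>h. \<xi> x * (Dg x $ i \<bullet> h) + (w x \<bullet> h) * (g x $ i))) (at x)"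
          by (intro has_derivative_mult \<xi> gi)
        then show ?thesis using False
          by (simp add: h_def H_def matrix_vector_mul_component scalar_mult_eq_scaleR inner_add_left mult_ac)
      qed
    qed
  qed
  \<comment> \<open>Integrability of both summands of \<open>detH\<close> is what permits splitting
    the vanishing integral.\<close>
  moreover have "integrable lborel (\<lambda>x. \<eta> x * det (Dg x))"
  proof -
    have "integrable lborel (\<lambda>x. indicat_real B x *\<^sub>R (\<eta> x * det (Dg x)))"
      unfolding det_def
      by (intro borel_integrable_compact B continuous_intros continuous_on_subset[OF cont(1)] continuous_on_subset[OF g(2)]) auto
    moreover have "(\<lambda>x. indicat_real B x *\<^sub>R (\<eta> x * det (Dg x))) = (\<lambda>x. \<eta> x * det (Dg x))"
      using \<eta>0 B(2) by (auto simp: indicator_def fun_eq_iff)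
    ultimately show ?thesis by (simp only:)
  qed
  moreover have "integrable lborel (\<lambda>x. (g x $ i0 - c) * det (\<chi> i. if i = i0 then v x else Dg x $ i))"
  proof -
    have "continuous_on B (\<lambda>x. (if i = i0 then v x else Dg x $ i) $ j)" for i j
      by (cases "i = i0") (auto intro!: continuous_intros continuous_on_subset[OF \<eta>(2)] continuous_on_subset[OF g(2)])
    then have "continuous_on B (\<lambda>x. det (\<chi> i. if i = i0 then v x else Dg x $ i))"
      unfolding det_def vec_lambda_beta
      by (intro continuous_on_sum continuous_on_mult continuous_on_prod continuous_on_const)
    then have "integrable lborel (\<lambda>x. indicat_real B x *\<^sub>R ((g x $ i0 - c) * det (\<chi> i. if i = i0 then v x else Dg x $ i)))"
      by (intro borel_integrable_compact B continuous_intros continuous_on_subset[OF cont(3)]) auto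
    moreover have "det (\<chi> i. if i = i0 then 0 else b i) = 0" for b :: "'n \<Rightarrow> real^'n"
      by (rule det_zero_row(1)[of i0]) (simp add: row_def vec_eq_iff)
    then have "(\<lambda>x. indicat_real B x *\<^sub>R ((g x $ i0 - c) * det (\<chi> i. if i = i0 then v x else Dg x $ i)))
        = (\<lambda>x. (g x $ i0 - c) * det (\<chi> i. if i = i0 then v x else Dg x $ i))"
    proof (intro ext)
      fix x
      assume z: "\<And>b :: 'n \<Rightarrow> real^'n. det (\<chi> i. if i = i0 then 0 else b i) = 0"
      show "indicat_real B x *\<^sub>R ((g x $ i0 - c) * det (\<chi> i. if i = i0 then v x else Dg x $ i))
        = (g x $ i0 - c) * det (\<chi> i. if i = i0 then v x else Dg x $ i)"
      proof (cases "x \<in> B")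
        case False
        then have "v x = 0" using \<eta>0[of x] B(2) by auto
        then show ?thesis using z by (simp cong: if_cong)
      qed auto
    qed
    ultimately show ?thesis by (simp only:)
  qed
  ultimately show ?thesis unfolding detH by simp
qed

text \<open>A non-integrable function has Bochner integral 0, so the bound by a dominating integral
  holds without measurability of \<open>f\<close>.\<close>

lemma integral_norm_bound_integral_or_zero:
  fixes f :: "'a \<Rightarrow> 'b::{banach, second_countable_topology}"
  assumes "integrable M F" "\<And>x. norm (f x) \<le> F x"
  shows "norm (integral\<^sup>L M f) \<le> integral\<^sup>L M F"
proof (cases "integrable M f")
  case True
  then have "norm (integral\<^sup>L M f) \<le> integral\<^sup>L M (\<lambda>x. norm (f x))" by simp
  also have "\<dots> \<le> integral\<^sup>L M F" using True assms by (intro integral_mono) auto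
  finally show ?thesis .
next
  case False
  have "0 \<le> F x" for x using assms(2)[of x] norm_ge_zero order_trans by blast
  then show ?thesis using False by (simp add: not_integrable_integral_eq)
qed

lemma abs_entry_le_norm: "\<bar>A $ i $ j\<bar> \<le> norm (A :: real^'n^'m)"
  by (meson component_le_norm_cart Finite_Cartesian_Product.norm_nth_le order_trans)

text \<open>Each of the n! Leibniz terms contains exactly one entry of \<open>v\<close> and
  \<open>n - 1\<close> entries of \<open>A\<close>. Keeping the exponent \<open>n - 1\<close> is
  essential, as it pairs with one undifferentiated factor to total degree n.\<close>

lemma abs_det_row_replaced_le:
  fixes A :: "real^'n^'n"
  shows "\<bar>det (\<chi> i. if i = i0 then v else A $ i)\<bar> \<le> fact (CARD('n)) * (norm v * norm A ^ (CARD('n) - 1))"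
proof -
  let ?B = "\<chi> i. if i = i0 then v else A $ i"
  have "\<bar>\<Prod>i\<in>UNIV. ?B $ i $ p i\<bar> \<le> norm v * norm A ^ (CARD('n) - 1)" for p
  proof -
    have "\<bar>\<Prod>i\<in>UNIV. ?B $ i $ p i\<bar> = \<bar>v $ p i0\<bar> * (\<Prod>i\<in>UNIV - {i0}. \<bar>A $ i $ p i\<bar>)"
      unfolding abs_prod by (subst prod.remove[of _ i0]) auto
    also have "\<dots> \<le> norm v * (\<Prod>i\<in>UNIV - {i0}. norm A)"
      by (intro mult_mono prod_mono component_le_norm_cart) (auto intro!: prod_nonneg abs_entry_le_norm)
    also have "\<dots> = norm v * norm A ^ (CARD('n) - 1)"
      by (simp add: card_Diff_singleton)
    finally show ?thesis .
  qed
  then have "\<bar>of_int (sign p) * (\<Prod>i\<in>UNIV. ?B $ i $ p i)\<bar> \<le> norm v * norm A ^ (CARD('n) - 1)" for p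
    by (simp add: abs_mult sign_def)
  then have "\<bar>det ?B\<bar> \<le> (\<Sum>p | p permutes (UNIV :: 'n set). norm v * norm A ^ (CARD('n) - 1))"
    unfolding det_def by (intro order_trans[OF sum_abs] sum_mono) auto
  then show ?thesis
    by (simp add: card_permutations[OF refl finite])
qed

text \<open>A crude form of Young's inequality: the product is at most the n-th power of the larger
  of the two numbers.\<close>

lemma mult_power_pred_le:
  fixes s t :: real
  assumes "0 \<le> s" "0 \<le> t" "n \<ge> 1"
  shows "s * t ^ (n - 1) \<le> s ^ n + t ^ n"
proof (cases "s \<le> t")
  case True
  then have "s * t ^ (n - 1) \<le> t * t ^ (n - 1)" using assms by (intro mult_right_mono) auto
  then show ?thesis using assms by (cases n) (auto simp: add_increasing)
next
  case False
  then have "s * t ^ (n - 1) \<le> s * s ^ (n - 1)" using assms by (intro mult_left_mono power_mono) auto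
  then show ?thesis using assms by (cases n) (auto simp: add_increasing2)
qed

text \<open>The null Lagrangian identity replaces a row of the derivative by the gradient of the
  cutoff, which lives on the annulus and is at most \<open>L / r\<close>. Young's inequality then
  separates \<open>\<bar>g x $ i0 - c\<bar> / r\<close> from the remaining \<open>n - 1\<close>
  derivative factors. The constant \<open>c\<close> stays free for the later use of a Poincare
  inequality.\<close>

lemma caccioppoli_C1:
  fixes g :: "real^'n \<Rightarrow> real^'n" and i0 :: 'n
  assumes g: "\<And>x. (g has_derivative (\<lambda>v. Dg x *v v)) (at x)" "continuous_on UNIV Dg"
    and \<eta>: "\<And>x. (\<eta> has_derivative (\<lambda>h. v x \<bullet> h)) (at x)" "continuous_on UNIV v"
    and \<eta>1: "\<And>x. x \<in> cube a r \<Longrightarrow> v x = 0"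
    and \<eta>0: "\<And>x. x \<notin> cube a (2 * r) \<Longrightarrow> \<eta> x = 0 \<and> v x = 0"
    and L: "\<And>x. norm (v x) \<le> L / r" and r: "r > 0"
  shows "integral\<^sup>L lborel (\<lambda>x. \<eta> x * det (Dg x)) \<le>
    fact (CARD('n)) * L * (LINT x:annulus a r|lborel. (\<bar>g x $ i0 - c\<bar> / r) ^ CARD('n) + norm (Dg x) ^ CARD('n))"
proof -
  \<comment> \<open>A second cutoff, equal to 1 on the support of the first; it vanishes outside the
    cube of twice that size.\<close>
  obtain \<xi> w where \<xi>: "\<And>x. (\<xi> has_derivative (\<lambda>h. w x \<bullet> h)) (at x)" "continuous_on UNIV w"
    "\<And>x. x \<in> cube a (2 * r) \<Longrightarrow> \<xi> x = 1 \<and> w x = 0"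
    "\<And>x. x \<notin> cube a (2 * (2 * r)) \<Longrightarrow> \<xi> x = 0 \<and> w x = 0"
    using cutoff_cube[of "2 * r" a] r by (metis mult_pos_pos zero_less_numeral)
  let ?f = "\<lambda>x. (g x $ i0 - c) * det (\<chi> i. if i = i0 then v x else Dg x $ i)"
  let ?F = "\<lambda>x. fact (CARD('n)) * L * (indicat_real (annulus a r) x *\<^sub>R ((\<bar>g x $ i0 - c\<bar> / r) ^ CARD('n) + norm (Dg x) ^ CARD('n)))"
  have cont: "continuous_on UNIV g"
    using has_derivative_continuous[OF g(1)] by (auto simp: continuous_on_eq_continuous_at)
  have "0 \<le> L / r" using L[of 0] norm_ge_zero order_trans by blast
  then have "L \<ge> 0" using r by (simp add: zero_le_divide_iff)
  have "integral\<^sup>L lborel (\<lambda>x. \<eta> x * det (Dg x)) = - integral\<^sup>L lborel ?f"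
    using r cube_mono[of "2 * r" "2 * (2 * r)" a]
    by (intro null_lagrangian_identity[where C = "cube a (2 * r)" and B = "cube a (2 * (2 * r))" and \<xi> = \<xi> and w = w] g \<eta> \<eta>0 \<xi>) auto
  also have "\<dots> \<le> norm (integral\<^sup>L lborel ?f)" by simp
  also have "\<dots> \<le> integral\<^sup>L lborel ?F"
  proof (rule integral_norm_bound_integral_or_zero)
    show "integrable lborel ?F"
      by (intro integrable_mult_right borel_integrable_compact continuous_intros
          continuous_on_subset[OF g(2)] continuous_on_subset[OF cont]) (use r in auto)
    fix x
    show "norm (?f x) \<le> ?F x"
    proof (cases "x \<in> annulus a r")
      case True
      have "norm (?f x) \<le> \<bar>g x $ i0 - c\<bar> * (fact (CARD('n)) * (norm (v x) * norm (Dg x) ^ (CARD('n) - 1)))"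
        unfolding real_norm_def abs_mult by (intro mult_left_mono abs_det_row_replaced_le) auto
      also have "\<dots> \<le> \<bar>g x $ i0 - c\<bar> * (fact (CARD('n)) * (L / r * norm (Dg x) ^ (CARD('n) - 1)))"
        by (intro mult_left_mono mult_right_mono L) auto
      also have "\<dots> = fact (CARD('n)) * L * ((\<bar>g x $ i0 - c\<bar> / r) * norm (Dg x) ^ (CARD('n) - 1))"
        by (simp add: field_simps)
      also have "\<dots> \<le> ?F x"
      proof -
        have "(\<bar>g x $ i0 - c\<bar> / r) * norm (Dg x) ^ (CARD('n) - 1) \<le> (\<bar>g x $ i0 - c\<bar> / r) ^ CARD('n) + norm (Dg x) ^ CARD('n)"
          using r by (intro mult_power_pred_le) auto
        from mult_left_mono[OF this, of "fact (CARD('n)) * L"] show ?thesis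
          using True \<open>L \<ge> 0\<close> by simp
      qed
      finally show ?thesis .
    next
      case False
      \<comment> \<open>A point outside the annulus lies in the small cube, where \<eta> has zero
        gradient, or outside the large one, where \<eta> vanishes.\<close>
      have "v x = 0"
        using \<eta>0[of x] \<eta>1[of x] False by (cases "x \<in> cube a r") (auto simp: annulus_def cube_def not_le intro: less_imp_le)
      then have "?f x = 0" using abs_det_row_replaced_le[of i0 "v x" "Dg x"] by simp
      then show ?thesis using False by simp
    qed
  qed
  also have "\<dots> = fact (CARD('n)) * L * (LINT x:annulus a r|lborel. (\<bar>g x $ i0 - c\<bar> / r) ^ CARD('n) + norm (Dg x) ^ CARD('n))"
    unfolding set_lebesgue_integral_def by simp
  finally show ?thesis .
qed

section \<open>Smooth bump functions\<close>

text \<open>With s = 1 / t, differentiating \<open>P(s) * exp (- s)\<close> in t yields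
  \<open>s\<^sup>2 * (P(s) - P'(s)) * exp (- s)\<close>; the recursion records this
  polynomial.\<close>

primrec flat_poly :: "nat \<Rightarrow> real poly" where
  "flat_poly 0 = 1"
| "flat_poly (Suc m) = monom 1 2 * (flat_poly m - pderiv (flat_poly m))"

text \<open>The derivatives of the flat function \<open>exp (- 1 / t)\<close>, extended by zero.\<close>

definition flat :: "nat \<Rightarrow> real \<Rightarrow> real" where
  "flat m t = (if t > 0 then poly (flat_poly m) (1 / t) * exp (- (1 / t)) else 0)"

lemma tendsto_poly_times_exp_minus:
  fixes p :: "real poly"
  shows "((\<lambda>s. poly p s * exp (- s)) \<longlongrightarrow> 0) at_top"
proof -
  have "((\<lambda>s. \<Sum>i\<le>degree p. coeff p i * (s ^ i / exp s)) \<longlongrightarrow> (\<Sum>i\<le>degree p. coeff p i * 0)) at_top"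
    by (intro tendsto_intros tendsto_power_div_exp_0)
  then show ?thesis
    by (simp add: poly_altdef sum_divide_distrib exp_minus divide_inverse sum_distrib_right mult.assoc)
qed

lemma has_real_derivative_flat: "(flat m has_real_derivative flat (Suc m) t) (at t)"
proof -
  consider "t < 0" | "t = 0" | "t > 0" by linarith
  then show ?thesis
  proof cases
    case 1
    then have "\<forall>\<^sub>F s in nhds t. s \<in> {..<0}" by (intro eventually_nhds_in_open) auto
    then have "\<forall>\<^sub>F s in nhds t. flat m s = 0" by eventually_elim (simp add: flat_def)
    moreover have "((\<lambda>t. 0) has_real_derivative flat (Suc m) t) (at t)" using 1 by (simp add: flat_def)
    ultimately show ?thesis by (subst DERIV_cong_ev[OF refl _ refl])
  next
    case 2
    have r: "((\<lambda>h. flat m h / h) \<longlongrightarrow> 0) (at_right 0)"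
    proof -
      \<comment> \<open>The difference quotient at 0 is s times
        \<open>poly (flat_poly m) s * exp (- s)\<close> with s = 1 / h tending to infinity;
        \<open>pCons 0\<close> supplies the factor s.\<close>
      have "((\<lambda>h. poly (pCons 0 (flat_poly m)) (inverse h) * exp (- (inverse h))) \<longlongrightarrow> 0) (at_right 0)"
        using tendsto_poly_times_exp_minus filterlim_inverse_at_top_right by (rule filterlim_compose)
      moreover have "\<forall>\<^sub>F h in at_right 0. poly (pCons 0 (flat_poly m)) (inverse h) * exp (- (inverse h)) = flat m h / h"
        unfolding eventually_at_right_field by (auto intro!: exI[of _ 1] simp: flat_def field_simps)
      ultimately show ?thesis by (rule Lim_transform_eventually)
    qed
    have l: "((\<lambda>h. flat m h / h) \<longlongrightarrow> 0) (at_left 0)"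
    proof (rule Lim_transform_eventually[OF tendsto_const])
      show "\<forall>\<^sub>F h in at_left 0. 0 = flat m h / h"
        unfolding eventually_at_left_field by (auto intro!: exI[of _ "-1"] simp: flat_def)
    qed
    have "((\<lambda>h. flat m h / h) \<longlongrightarrow> 0) (at 0)" using l r by (simp add: filterlim_split_at)
    then show ?thesis using 2 by (simp add: DERIV_def flat_def)
  next
    case 3
    have "\<forall>\<^sub>F s in nhds t. s \<in> {0<..}" using 3 by (intro eventually_nhds_in_open) auto
    then have "\<forall>\<^sub>F s in nhds t. flat m s = poly (flat_poly m) (inverse s) * exp (- (inverse s))"
      by eventually_elim (simp add: flat_def divide_inverse)
    moreover have "((\<lambda>s. poly (flat_poly m) (inverse s) * exp (- (inverse s))) has_real_derivative flat (Suc m) t) (at t)"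
    proof -
      have i: "(inverse has_real_derivative - (inverse t)\<^sup>2) (at t)"
        using DERIV_inverse[of t UNIV] 3 by (simp add: power2_eq_square numeral_2_eq_2)
      have "((\<lambda>s. poly (flat_poly m) (inverse s) * exp (- (inverse s))) has_real_derivative
          poly (pderiv (flat_poly m)) (inverse t) * (- (inverse t)\<^sup>2) * exp (- (inverse t)) +
          exp (- (inverse t)) * - (- (inverse t)\<^sup>2) * poly (flat_poly m) (inverse t)) (at t)"
        by (intro DERIV_mult DERIV_fun_exp DERIV_minus i DERIV_chain2[OF poly_DERIV])
      then show ?thesis using 3 by (simp add: flat_def divide_inverse poly_monom algebra_simps)
    qed
    ultimately show ?thesis by (subst DERIV_cong_ev[OF refl _ refl])
  qed
qed

lemma continuous_on_flat: "continuous_on S (flat m)"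
  by (rule DERIV_continuous_on[OF has_field_derivative_at_within[OF has_real_derivative_flat]])

lemma flat_0_pos: "t > 0 \<Longrightarrow> flat 0 t > 0"
  and flat_nonpos: "t \<le> 0 \<Longrightarrow> flat m t = 0"
  and flat_0_nonneg: "flat 0 t \<ge> 0"
  by (auto simp: flat_def)

section \<open>Closure properties of the differentiability classes\<close>

lemma class_C_SucI:
  assumes "\<And>x. (f has_derivative f' x) (at x)" "\<And>v. class_C k (\<lambda>x. f' x v)"
  shows "class_C (Suc k) f"
proof -
  have "frechet_derivative f (at x) = f' x" for x
    using frechet_derivative_at[OF assms(1)] by simp
  then show ?thesis
    using assms unfolding class_C.simps differentiable_on_def differentiable_def
    by (auto intro: has_derivative_at_withinI)
qed

lemma class_C_SucD:
  assumes "class_C (Suc k) f"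
  shows "(f has_derivative frechet_derivative f (at x)) (at x)"
    and "class_C k (\<lambda>x. frechet_derivative f (at x) v)"
  using assms by (auto simp: differentiable_on_def frechet_derivative_works)

lemma class_C_lower: "class_C (Suc k) f \<Longrightarrow> class_C k f"
proof (induction k arbitrary: f)
  case 0
  then have "isCont f x" for x using class_C_SucD(1) has_derivative_continuous by blast
  then show ?case by (simp add: continuous_on_eq_continuous_at)
next
  case (Suc k)
  show ?case
    by (rule class_C_SucI[OF class_C_SucD(1)[OF Suc.prems]]) (rule Suc.IH[OF class_C_SucD(2)[OF Suc.prems]])
qed

lemma class_C_const: "class_C k (\<lambda>x. c)"
proof (induction k arbitrary: c)
  case (Suc k)
  show ?case by (rule class_C_SucI[OF has_derivative_const]) (rule Suc)
qed auto

lemma class_C_add: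
  "class_C k f \<Longrightarrow> class_C k g \<Longrightarrow> class_C k (\<lambda>x. f x + g x)"
proof (induction k arbitrary: f g)
  case (Suc k)
  show ?case
    by (rule class_C_SucI[OF has_derivative_add[OF class_C_SucD(1)[OF Suc.prems(1)] class_C_SucD(1)[OF Suc.prems(2)]]])
      (rule Suc.IH[OF class_C_SucD(2)[OF Suc.prems(1)] class_C_SucD(2)[OF Suc.prems(2)]])
qed (auto intro: continuous_intros)

lemma class_C_mult:
  fixes f g :: "'a::euclidean_space \<Rightarrow> real"
  shows "class_C k f \<Longrightarrow> class_C k g \<Longrightarrow> class_C k (\<lambda>x. f x * g x)"
proof (induction k arbitrary: f g)
  case (Suc k)
  show ?case
  proof (rule class_C_SucI[OF has_derivative_mult[OF class_C_SucD(1)[OF Suc.prems(1)] class_C_SucD(1)[OF Suc.prems(2)]]])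
    fix v
    show "class_C k (\<lambda>x. f x * frechet_derivative g (at x) v + frechet_derivative f (at x) v * g x)"
      by (intro class_C_add Suc.IH class_C_SucD(2)[OF Suc.prems(1)] class_C_SucD(2)[OF Suc.prems(2)]
          class_C_lower[OF Suc.prems(1)] class_C_lower[OF Suc.prems(2)])
  qed
qed (auto intro: continuous_intros)

text \<open>Differentiating raises the index of \<open>flat\<close> by one, so the induction has to
  run over all \<open>m\<close> at once.\<close>

lemma class_C_flat:
  "class_C k u \<Longrightarrow> class_C k (\<lambda>x. flat m (u x))"
proof (induction k arbitrary: m)
  case (Suc k)
  show ?case
  proof (rule class_C_SucI)
    fix x
    show "((\<lambda>x. flat m (u x)) has_derivative (\<lambda>v. flat (Suc m) (u x) * frechet_derivative u (at x) v)) (at x)"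
      by (rule has_derivative_compose[OF class_C_SucD(1)[OF Suc.prems]
            has_real_derivative_flat[unfolded has_field_derivative_def]])
  next
    fix v
    show "class_C k (\<lambda>x. flat (Suc m) (u x) * frechet_derivative u (at x) v)"
      by (intro class_C_mult Suc.IH class_C_lower[OF Suc.prems] class_C_SucD(2)[OF Suc.prems])
  qed
next
  case 0
  then show ?case by (auto intro: continuous_on_compose2[OF continuous_on_flat[of UNIV]])
qed

lemma class_C_inner_affine: "class_C k (\<lambda>y. (x - y) \<bullet> v)"
proof (cases k)
  case (Suc l)
  have "((\<lambda>y. (x - y) \<bullet> v) has_derivative (\<lambda>w. - (w \<bullet> v))) (at y)" for y
    by (auto intro!: derivative_eq_intros)
  then show ?thesis unfolding Suc by (rule class_C_SucI) (rule class_C_const)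
qed (auto intro!: continuous_intros)

text \<open>The inner product is used in place of the norm so that smoothness at the origin is
  immediate; the function is positive exactly on the open ball of radius \<open>r > 0\<close>.
  Normalisation is left to the places where it is averaged against.\<close>

definition bump :: "real \<Rightarrow> 'a::euclidean_space \<Rightarrow> real" where
  "bump r z = flat 0 (r\<^sup>2 - z \<bullet> z)"

definition bump_slope :: "real \<Rightarrow> 'a::euclidean_space \<Rightarrow> real" where
  "bump_slope r z = - 2 * flat 1 (r\<^sup>2 - z \<bullet> z)"

lemma has_derivative_bump:
  "((\<lambda>z. bump r z) has_derivative (\<lambda>v. bump_slope r z * (z \<bullet> v))) (at z)"
proof -
  have "((\<lambda>z. r\<^sup>2 - z \<bullet> z) has_derivative (\<lambda>v. - 2 * (z \<bullet> v))) (at z)"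
    by (auto intro!: derivative_eq_intros simp: inner_commute)
  from has_derivative_compose[OF this has_real_derivative_flat[unfolded has_field_derivative_def]]
  show ?thesis by (simp add: bump_def[abs_def] bump_slope_def algebra_simps)
qed

lemma has_derivative_bump_reflected:
  "((\<lambda>y. bump r (x - y)) has_derivative (\<lambda>v. - (bump_slope r (x - y) * ((x - y) \<bullet> v)))) (at y)"
proof -
  have "((\<lambda>y. x - y) has_derivative uminus) (at y)"
    by (auto intro!: derivative_eq_intros)
  from has_derivative_compose[OF this has_derivative_bump] show ?thesis by simp
qed

lemma continuous_on_bump: "continuous_on S (bump r)" "continuous_on S (bump_slope r)"
  unfolding bump_def[abs_def] bump_slope_def[abs_def]
  by (intro continuous_intros continuous_on_compose2[OF continuous_on_flat[of UNIV]]; simp)+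

lemma bump_nonneg: "0 \<le> bump r z"
  by (simp add: bump_def flat_0_nonneg)

lemma bump_eq_0:
  assumes "r > 0" "norm z \<ge> r"
  shows "bump r z = 0" "bump_slope r z = 0"
proof -
  have "r\<^sup>2 \<le> z \<bullet> z" using assms power_mono[of r "norm z" 2] by (simp add: power2_norm_eq_inner)
  then show "bump r z = 0" "bump_slope r z = 0" by (auto simp: bump_def bump_slope_def flat_nonpos)
qed

lemma bump_pos: "norm z < r \<Longrightarrow> bump r z > 0"
  using power_strict_mono[of "norm z" r 2]
  by (auto simp: bump_def power2_norm_eq_inner intro!: flat_0_pos)

lemma test_function_bump:
  assumes "r > 0"
  shows "test_function UNIV (\<lambda>y. bump r (x - y))"
proof -
  \<comment> \<open>The argument of \<open>flat\<close> is quadratic in \<open>y\<close>, with a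
    derivative that is affine in \<open>y\<close>; this reduces all orders to the closure
    lemmas.\<close>
  have "class_C k (\<lambda>y. r\<^sup>2 + (x - y) \<bullet> (x - y) * (-1))" for k
  proof (cases k)
    case (Suc l)
    have "((\<lambda>y. r\<^sup>2 + (x - y) \<bullet> (x - y) * (-1)) has_derivative (\<lambda>v. 2 * ((x - y) \<bullet> v))) (at y)" for y
      by (auto intro!: derivative_eq_intros simp: inner_commute)
    then show ?thesis unfolding Suc
      by (rule class_C_SucI) (intro class_C_mult class_C_const class_C_inner_affine)
  qed (auto intro!: continuous_intros)
  then have "class_C k (\<lambda>y. bump r (x - y))" for k
    unfolding bump_def by (intro class_C_flat) (simp add: algebra_simps)
  moreover have sub: "closure {y. bump r (x - y) \<noteq> 0} \<subseteq> cball x r"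
  proof (rule closure_minimal)
    show "{y. bump r (x - y) \<noteq> 0} \<subseteq> cball x r"
    proof
      fix y assume "y \<in> {y. bump r (x - y) \<noteq> 0}"
      then have "\<not> r \<le> norm (x - y)" using bump_eq_0(1)[OF assms] by blast
      then show "y \<in> cball x r" by (simp add: dist_norm)
    qed
  qed auto
  moreover have "compact (closure {y. bump r (x - y) \<noteq> 0})"
    unfolding compact_eq_bounded_closed
    by (rule conjI[OF bounded_subset[OF bounded_cball sub] closed_closure])
  ultimately show ?thesis unfolding test_function_def by auto
qed

section \<open>Continuity of translations in Lp\<close>

lemma nn_integral_lborel_shift:
  fixes f :: "'a::euclidean_space \<Rightarrow> ennreal"
  assumes "f \<in> borel_measurable borel"
  shows "(\<integral>\<^sup>+x. f (c + x) \<partial>lborel) = (\<integral>\<^sup>+x. f x \<partial>lborel)"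
  using assms by (subst (2) lborel_distr_plus[of c, symmetric], subst nn_integral_distr) auto

lemma nn_integral_lborel_reflect:
  fixes f :: "'a::euclidean_space \<Rightarrow> ennreal"
  assumes "f \<in> borel_measurable borel"
  shows "(\<integral>\<^sup>+x. f (c - x) \<partial>lborel) = (\<integral>\<^sup>+x. f x \<partial>lborel)"
proof -
  have "lborel = distr lborel borel (\<lambda>x::'a. c - x)"
    using lborel_affine[of "- 1 :: real" c] by (simp add: density_1)
  then have "(\<integral>\<^sup>+x. f x \<partial>lborel) = (\<integral>\<^sup>+x. f x \<partial>distr lborel borel (\<lambda>x::'a. c - x))" by simp
  also have "\<dots> = (\<integral>\<^sup>+x. f (c - x) \<partial>lborel)"
    using assms by (subst nn_integral_distr) auto
  finally show ?thesis by simp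
qed

lemma power_add_le:
  fixes s t :: real
  assumes "0 \<le> s" "0 \<le> t"
  shows "(s + t) ^ p \<le> 2 ^ p * (s ^ p + t ^ p)"
proof -
  have "(s + t) ^ p \<le> (2 * max s t) ^ p" using assms by (intro power_mono) auto
  also have "\<dots> = 2 ^ p * max s t ^ p" by (simp add: power_mult_distrib)
  also have "\<dots> \<le> 2 ^ p * (s ^ p + t ^ p)"
    using assms by (intro mult_left_mono) (auto simp: max_def)
  finally show ?thesis .
qed

lemma norm_add_power_le:
  fixes a b :: "'a::real_normed_vector"
  shows "norm (a + b) ^ p \<le> 2 ^ p * (norm a ^ p + norm b ^ p)"
  using power_mono[OF norm_triangle_ineq, of a b p] power_add_le[of "norm a" "norm b" p] by simp

lemma nn_integral_norm_add_power_le: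
  fixes a b :: "'c \<Rightarrow> 'b::euclidean_space"
  assumes [measurable]: "a \<in> borel_measurable M" "b \<in> borel_measurable M"
    and "(\<integral>\<^sup>+x. ennreal (norm (a x) ^ p) \<partial>M) \<le> A" "(\<integral>\<^sup>+x. ennreal (norm (b x) ^ p) \<partial>M) \<le> B"
  shows "(\<integral>\<^sup>+x. ennreal (norm (a x + b x) ^ p) \<partial>M) \<le> 2 ^ p * (A + B)"
proof -
  have "(\<integral>\<^sup>+x. ennreal (norm (a x + b x) ^ p) \<partial>M)
      \<le> (\<integral>\<^sup>+x. 2 ^ p * (ennreal (norm (a x) ^ p) + ennreal (norm (b x) ^ p)) \<partial>M)"
  proof (intro nn_integral_mono)
    fix x
    have "ennreal (norm (a x + b x) ^ p) \<le> ennreal (2 ^ p * (norm (a x) ^ p + norm (b x) ^ p))"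
      by (intro ennreal_leI norm_add_power_le)
    also have "\<dots> = 2 ^ p * (ennreal (norm (a x) ^ p) + ennreal (norm (b x) ^ p))"
      by (simp add: ennreal_mult ennreal_plus flip: ennreal_power)
    finally show "ennreal (norm (a x + b x) ^ p) \<le> \<dots>" .
  qed
  also have "\<dots> = 2 ^ p * ((\<integral>\<^sup>+x. ennreal (norm (a x) ^ p) \<partial>M) + (\<integral>\<^sup>+x. ennreal (norm (b x) ^ p) \<partial>M))"
    by (simp add: nn_integral_cmult nn_integral_add)
  also have "\<dots> \<le> 2 ^ p * (A + B)" using assms by (intro mult_left_mono add_mono) auto
  finally show ?thesis .
qed

lemma ennreal_two_power_double:
  assumes "d \<ge> 0"
  shows "2 ^ p * (ennreal d + ennreal d) = ennreal (2 ^ p * (d + d))"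
proof -
  have "ennreal d + ennreal d = ennreal (d + d)" using assms by (intro ennreal_plus[symmetric])
  moreover have "2 ^ p = ennreal (2 ^ p)" by (simp flip: ennreal_power)
  ultimately show ?thesis using assms by (simp only: ennreal_mult) (simp add: ennreal_mult)
qed

text \<open>Density of compactly supported continuous functions in the p-th power mean. Stating it
  with the p-th power of the distance as a nonnegative integral avoids roots and any integrability
  side condition.\<close>

definition Lp_approximable :: "nat \<Rightarrow> ('a::euclidean_space \<Rightarrow> 'b::euclidean_space) \<Rightarrow> bool" where
  "Lp_approximable p g \<longleftrightarrow> g \<in> borel_measurable borel \<and>
     (\<forall>e>0. \<exists>h. continuous_on UNIV h \<and> (\<exists>R. \<forall>x. norm x > R \<longrightarrow> h x = 0) \<and>
        (\<integral>\<^sup>+x. ennreal (norm (g x - h x) ^ p) \<partial>lborel) \<le> ennreal e)"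

lemma Lp_approximable_limit:
  fixes g :: "'a::euclidean_space \<Rightarrow> 'b::euclidean_space"
  assumes g[measurable]: "g \<in> borel_measurable borel"
    and lim: "\<And>e. e > 0 \<Longrightarrow> \<exists>s. Lp_approximable p s \<and> (\<integral>\<^sup>+x. ennreal (norm (g x - s x) ^ p) \<partial>lborel) \<le> ennreal e"
  shows "Lp_approximable p g"
  unfolding Lp_approximable_def
proof (intro conjI allI impI g)
  fix e :: real assume "e > 0"
  \<comment> \<open>The p-th power of a sum costs a factor \<open>2 ^ p\<close> and there are two
    errors, so each may be at most \<open>e\<close> divided by \<open>2 ^ p * 2\<close>.\<close>
  define d where "d = e / (2 ^ p * 2)"
  have "d > 0" using \<open>e > 0\<close> by (simp add: d_def)
  obtain s where s: "Lp_approximable p s" "(\<integral>\<^sup>+x. ennreal (norm (g x - s x) ^ p) \<partial>lborel) \<le> ennreal d"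
    using lim[OF \<open>d > 0\<close>] by blast
  then obtain h where h: "continuous_on UNIV h" "\<exists>R. \<forall>x. norm x > R \<longrightarrow> h x = 0"
    "(\<integral>\<^sup>+x. ennreal (norm (s x - h x) ^ p) \<partial>lborel) \<le> ennreal d"
    using \<open>d > 0\<close> unfolding Lp_approximable_def by blast
  have [measurable]: "s \<in> borel_measurable borel" "h \<in> borel_measurable borel"
    using s h by (auto simp: Lp_approximable_def intro: borel_measurable_continuous_onI)
  have "(\<integral>\<^sup>+x. ennreal (norm ((g x - s x) + (s x - h x)) ^ p) \<partial>lborel) \<le> 2 ^ p * (ennreal d + ennreal d)"
    by (intro nn_integral_norm_add_power_le s h) auto
  also have "\<dots> = ennreal (2 ^ p * (d + d))"
    using \<open>d > 0\<close> by (intro ennreal_two_power_double) auto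
  also have "2 ^ p * (d + d) = e" by (simp add: d_def)
  finally show "\<exists>h. continuous_on UNIV h \<and> (\<exists>R. \<forall>x. norm x > R \<longrightarrow> h x = 0) \<and>
        (\<integral>\<^sup>+x. ennreal (norm (g x - h x) ^ p) \<partial>lborel) \<le> ennreal e"
    using h by auto
qed

lemma Lp_approximable_add:
  fixes g1 g2 :: "'a::euclidean_space \<Rightarrow> 'b::euclidean_space"
  assumes "Lp_approximable p g1" "Lp_approximable p g2"
  shows "Lp_approximable p (\<lambda>x. g1 x + g2 x)"
  unfolding Lp_approximable_def
proof (intro conjI allI impI)
  have [measurable]: "g1 \<in> borel_measurable borel" "g2 \<in> borel_measurable borel"
    using assms by (auto simp: Lp_approximable_def)
  show "(\<lambda>x. g1 x + g2 x) \<in> borel_measurable borel" by measurable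
  fix e :: real assume "e > 0"
  define d where "d = e / (2 ^ p * 2)"
  have "d > 0" using \<open>e > 0\<close> by (simp add: d_def)
  obtain h1 R1 where h1: "continuous_on UNIV h1" "\<And>x. norm x > R1 \<Longrightarrow> h1 x = 0"
    "(\<integral>\<^sup>+x. ennreal (norm (g1 x - h1 x) ^ p) \<partial>lborel) \<le> ennreal d"
    using \<open>d > 0\<close> assms unfolding Lp_approximable_def by blast
  obtain h2 R2 where h2: "continuous_on UNIV h2" "\<And>x. norm x > R2 \<Longrightarrow> h2 x = 0"
    "(\<integral>\<^sup>+x. ennreal (norm (g2 x - h2 x) ^ p) \<partial>lborel) \<le> ennreal d"
    using \<open>d > 0\<close> assms unfolding Lp_approximable_def by blast
  have [measurable]: "h1 \<in> borel_measurable borel" "h2 \<in> borel_measurable borel"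
    using h1 h2 by (auto intro: borel_measurable_continuous_onI)
  have "(\<integral>\<^sup>+x. ennreal (norm ((g1 x - h1 x) + (g2 x - h2 x)) ^ p) \<partial>lborel) \<le> 2 ^ p * (ennreal d + ennreal d)"
    by (intro nn_integral_norm_add_power_le h1 h2) auto
  also have "\<dots> = ennreal (2 ^ p * (d + d))"
    using \<open>d > 0\<close> by (intro ennreal_two_power_double) auto
  also have "2 ^ p * (d + d) = e" by (simp add: d_def)
  finally have "(\<integral>\<^sup>+x. ennreal (norm ((g1 x + g2 x) - (h1 x + h2 x)) ^ p) \<partial>lborel) \<le> ennreal e"
    by (simp add: algebra_simps)
  then show "\<exists>h. continuous_on UNIV h \<and> (\<exists>R. \<forall>x. norm x > R \<longrightarrow> h x = 0) \<and>
        (\<integral>\<^sup>+x. ennreal (norm (g1 x + g2 x - h x) ^ p) \<partial>lborel) \<le> ennreal e"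
    using h1 h2 by (intro exI[of _ "\<lambda>x. h1 x + h2 x"] conjI exI[of _ "max R1 R2"]) (auto intro!: continuous_intros)
qed

lemma Lp_approximable_zero:
  "p \<ge> 1 \<Longrightarrow> Lp_approximable p (\<lambda>x::'a::euclidean_space. 0::'b::euclidean_space)"
  unfolding Lp_approximable_def by (auto intro!: exI[of _ "\<lambda>x. 0"] simp: power_0_left)

lemma Lp_approximable_sum:
  assumes "p \<ge> 1" "finite I" "\<And>i. i \<in> I \<Longrightarrow> Lp_approximable p (g i)"
  shows "Lp_approximable p (\<lambda>x. \<Sum>i\<in>I. g i x)"
  using assms(2,3) by (induction I) (auto intro: Lp_approximable_add Lp_approximable_zero assms(1))

text \<open>By regularity of Lebesgue measure the set lies between a compact and an open set of
  nearly equal measure; a Urysohn function for this pair differs from the indicator only on their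
  difference.\<close>

lemma Lp_approximable_indicator:
  fixes c :: "'b::euclidean_space" and A :: "'a::euclidean_space set"
  assumes A: "A \<in> sets borel" "bounded A" and p: "p \<ge> 1"
  shows "Lp_approximable p (\<lambda>x. indicat_real A x *\<^sub>R c)"
  unfolding Lp_approximable_def
proof (intro conjI allI impI)
  show "(\<lambda>x. indicat_real A x *\<^sub>R c) \<in> borel_measurable borel" using A by measurable
  fix e :: real assume "e > 0"
  \<comment> \<open>Two gaps of measure \<open>d\<close> each, weighted by
    \<open>norm c ^ p\<close>; the summand 1 covers \<open>c = 0\<close>.\<close>
  define d where "d = e / (2 * (norm c ^ p + 1))"
  have cp: "norm c ^ p + 1 > 0" by (simp add: add_nonneg_pos)
  have "d > 0" using \<open>e > 0\<close> cp by (simp add: d_def)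
  have "A \<in> sets lebesgue" using A by simp
  obtain U where U: "open U" "A \<subseteq> U" "emeasure lebesgue (U - A) < ennreal d"
    using sets_lebesgue_outer_open[OF \<open>A \<in> sets lebesgue\<close> \<open>d > 0\<close>] by metis
  obtain K where K: "closed K" "K \<subseteq> A" "emeasure lebesgue (A - K) < ennreal d"
    using sets_lebesgue_inner_closed[OF \<open>A \<in> sets lebesgue\<close> \<open>d > 0\<close>] by metis
  have "compact K" using K A bounded_subset compact_eq_bounded_closed by blast
  have em: "emeasure lborel (U - K) \<le> ennreal (d + d)"
  proof -
    have "U - K = (U - A) \<union> (A - K)" using U K by auto
    then have "emeasure lborel (U - K) \<le> emeasure lborel (U - A) + emeasure lborel (A - K)"
      using A U K by (metis emeasure_subadditive sets.Diff borel_open borel_closed sets_lborel)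
    also have "\<dots> = emeasure lebesgue (U - A) + emeasure lebesgue (A - K)"
      using A U K by (simp add: borel_open borel_closed)
    also have "\<dots> \<le> ennreal d + ennreal d" using U K by (intro add_mono) auto
    also have "ennreal d + ennreal d = ennreal (d + d)" using \<open>d > 0\<close> by (intro ennreal_plus[symmetric]) auto
    finally show ?thesis .
  qed
  obtain w where w: "continuous_on UNIV w" "\<And>x. 0 \<le> w x \<and> w x \<le> (1::real)" "\<And>x. x \<in> K \<Longrightarrow> w x = 1"
    "\<And>x. x \<notin> U \<Longrightarrow> w x = 0" "\<exists>R. \<forall>x. norm x > R \<longrightarrow> w x = 0"
  proof (cases "K = {}")
    \<comment> \<open>The distance to the empty set is 0 by convention, so the formula of the other
      case would give the constant 1; the zero function is taken here.\<close>
    case True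
    then show ?thesis by (intro that[of "\<lambda>x. 0"]) auto
  next
    case False
    obtain t where t: "t > 0" "\<And>x y. x \<in> K \<Longrightarrow> y \<in> - U \<Longrightarrow> t \<le> dist x y"
    proof -
      have "K \<inter> - U = {}" using U K by auto
      then show thesis
        using separate_compact_closed[OF \<open>compact K\<close> closed_Compl[OF U(1)]] that by blast
    qed
    \<comment> \<open>A function decreasing linearly from 1 on \<open>K\<close> to 0 at distance
      \<open>t\<close>, hence before \<open>U\<close> is left. Compactness of \<open>K\<close> also
      bounds its support.\<close>
    define w where "w x = max 0 (1 - infdist x K / t)" for x
    obtain R where R: "\<And>x. x \<in> K \<Longrightarrow> norm x \<le> R" using \<open>compact K\<close> compact_imp_bounded bounded_iff by metis
    have far: "w x = 0" if "\<And>y. y \<in> K \<Longrightarrow> t \<le> dist x y" for x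
    proof -
      have "t \<le> infdist x K" using False that by (auto simp: infdist_notempty intro: cINF_greatest)
      then show ?thesis using t by (simp add: w_def)
    qed
    show ?thesis
    proof (rule that[of w])
      show "continuous_on UNIV w" unfolding w_def by (intro continuous_intros) (use t in auto)
      show "0 \<le> w x \<and> w x \<le> 1" for x using t infdist_nonneg[of x K] by (auto simp: w_def)
      show "w x = 1" if "x \<in> K" for x using that by (simp add: w_def)
      show "w x = 0" if "x \<notin> U" for x using that t by (intro far) (auto simp: dist_commute)
      have "w x = 0" if "norm x > R + t" for x
      proof (rule far)
        fix y assume "y \<in> K"
        then show "t \<le> dist x y" using R[of y] that norm_triangle_ineq2[of x y] by (simp add: dist_norm)
      qed
      then show "\<exists>R. \<forall>x. norm x > R \<longrightarrow> w x = 0" by blast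
    qed
  qed
  have "(\<integral>\<^sup>+x. ennreal (norm (indicat_real A x *\<^sub>R c - w x *\<^sub>R c) ^ p) \<partial>lborel)
      \<le> (\<integral>\<^sup>+x. ennreal (norm c ^ p) * indicator (U - K) x \<partial>lborel)"
  proof (intro nn_integral_mono)
    fix x
    show "ennreal (norm (indicat_real A x *\<^sub>R c - w x *\<^sub>R c) ^ p) \<le> ennreal (norm c ^ p) * indicator (U - K) x"
    proof (cases "x \<in> U - K")
      case True
      have "norm (indicat_real A x *\<^sub>R c - w x *\<^sub>R c) = \<bar>indicat_real A x - w x\<bar> * norm c"
        by (simp flip: scaleR_diff_left)
      also have "\<dots> \<le> 1 * norm c" using w(2)[of x] by (intro mult_right_mono) (auto simp: indicator_def)
      finally show ?thesis using True by (auto intro!: ennreal_leI power_mono)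
    next
      case False
      then have "indicat_real A x = w x" using w(3,4)[of x] U K by (auto simp: indicator_def)
      then show ?thesis using p by (simp add: power_0_left)
    qed
  qed
  also have "\<dots> = ennreal (norm c ^ p) * emeasure lborel (U - K)"
    using U K by (subst nn_integral_cmult_indicator) (auto intro: borel_open borel_closed)
  also have "\<dots> \<le> ennreal (norm c ^ p) * ennreal (d + d)" by (intro mult_left_mono em) auto
  also have "\<dots> = ennreal (norm c ^ p * (d + d))" using \<open>d > 0\<close> by (simp add: ennreal_mult)
  also have "\<dots> \<le> ennreal e"
  proof (rule ennreal_leI)
    have "norm c ^ p * (d + d) \<le> (norm c ^ p + 1) * (d + d)" using \<open>d > 0\<close> by (intro mult_right_mono) auto
    also have "N * (e / (2 * N) + e / (2 * N)) = e" if "N > 0" for N :: real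
      using that by (simp add: field_simps)
    then have "(norm c ^ p + 1) * (d + d) = e" unfolding d_def using cp by blast
    finally show "norm c ^ p * (d + d) \<le> e" .
  qed
  finally show "\<exists>h. continuous_on UNIV h \<and> (\<exists>R. \<forall>x. norm x > R \<longrightarrow> h x = 0) \<and>
        (\<integral>\<^sup>+x. ennreal (norm (indicat_real A x *\<^sub>R c - h x) ^ p) \<partial>lborel) \<le> ennreal e"
    using w by (intro exI[of _ "\<lambda>x. w x *\<^sub>R c"]) (auto intro!: continuous_intros)
qed

text \<open>Simple functions with norm at most \<open>2 * norm (g x)\<close> converge to
  \<open>g\<close>, and the error is dominated by \<open>3 ^ p * norm (g x) ^ p\<close>. The same
  bound forces their nonzero level sets into the ball that supports \<open>g\<close>, so each is a
  finite sum of indicators of bounded sets.\<close>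

theorem Lp_approximable_bounded_support:
  fixes g :: "'a::euclidean_space \<Rightarrow> 'b::euclidean_space"
  assumes g[measurable]: "g \<in> borel_measurable borel" and fin: "(\<integral>\<^sup>+x. ennreal (norm (g x) ^ p) \<partial>lborel) < \<infinity>"
    and supp: "\<And>x. norm x > R \<Longrightarrow> g x = 0" and p: "p \<ge> 1"
  shows "Lp_approximable p g"
proof (rule Lp_approximable_limit[OF g])
  fix e :: real assume "e > 0"
  obtain s where s: "\<And>i. simple_function borel (s i)" "\<And>x. (\<lambda>i. s i x) \<longlonglongrightarrow> g x"
    "\<And>i x. norm (s i x) \<le> 2 * norm (g x)"
    using borel_measurable_implies_sequence_metric[OF g, of 0] by (auto simp: dist_norm)
  have [measurable]: "s i \<in> borel_measurable borel" for i using s(1) by (rule borel_measurable_simple_function)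
  have "(\<lambda>i. \<integral>\<^sup>+x. ennreal (norm (g x - s i x) ^ p) \<partial>lborel) \<longlonglongrightarrow> (\<integral>\<^sup>+x. ennreal 0 \<partial>(lborel::'a measure))"
  proof (rule nn_integral_dominated_convergence[where w = "\<lambda>x. ennreal (3 ^ p) * ennreal (norm (g x) ^ p)"])
    show "(\<integral>\<^sup>+x. ennreal (3 ^ p) * ennreal (norm (g x) ^ p) \<partial>lborel) < \<infinity>"
      using fin by (simp add: nn_integral_cmult ennreal_mult_less_top)
    show "AE x in lborel. ennreal (norm (g x - s i x) ^ p) \<le> ennreal (3 ^ p) * ennreal (norm (g x) ^ p)" for i
    proof (intro AE_I2)
      fix x
      have "norm (g x - s i x) \<le> 3 * norm (g x)"
        using norm_triangle_ineq4[of "g x" "s i x"] s(3)[of i x] by simp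
      from power_mono[OF this, of p] show "ennreal (norm (g x - s i x) ^ p) \<le> ennreal (3 ^ p) * ennreal (norm (g x) ^ p)"
        by (auto simp: power_mult_distrib simp flip: ennreal_mult intro!: ennreal_leI)
    qed
    show "AE x in lborel. (\<lambda>i. ennreal (norm (g x - s i x) ^ p)) \<longlonglongrightarrow> ennreal 0"
    proof (intro AE_I2 tendsto_ennrealI)
      fix x
      have "(\<lambda>i. norm (g x - s i x) ^ p) \<longlonglongrightarrow> norm (g x - g x) ^ p" by (intro tendsto_intros s)
      then show "(\<lambda>i. norm (g x - s i x) ^ p) \<longlonglongrightarrow> 0" using p by (simp add: power_0_left)
    qed
  qed auto
  then have "(\<lambda>i. \<integral>\<^sup>+x. ennreal (norm (g x - s i x) ^ p) \<partial>lborel) \<longlonglongrightarrow> 0" by simp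
  then have "\<forall>\<^sub>F i in sequentially. (\<integral>\<^sup>+x. ennreal (norm (g x - s i x) ^ p) \<partial>lborel) < ennreal e"
    using \<open>e > 0\<close> by (intro order_tendstoD) auto
  then obtain i where i: "(\<integral>\<^sup>+x. ennreal (norm (g x - s i x) ^ p) \<partial>lborel) < ennreal e"
    by (auto simp: eventually_sequentially)
  have "Lp_approximable p (\<lambda>x. \<Sum>y\<in>range (s i). indicat_real (s i -` {y}) x *\<^sub>R y)"
  proof (intro Lp_approximable_sum p)
    show "finite (range (s i))" using s(1)[of i] by (simp add: simple_function_def)
    fix y
    show "Lp_approximable p (\<lambda>x. indicat_real (s i -` {y}) x *\<^sub>R y)"
    proof (cases "y = 0")
      case True
      then show ?thesis using Lp_approximable_zero[OF p] by simp
    next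
      case False
      have "s i -` {y} \<subseteq> cball 0 R"
      proof
        fix x assume "x \<in> s i -` {y}"
        then have "g x \<noteq> 0" using s(3)[of i x] False by auto
        then show "x \<in> cball 0 R" using supp[of x] by (cases "norm x > R") auto
      qed
      then have "bounded (s i -` {y})" using bounded_cball bounded_subset by blast
      moreover have "s i -` {y} \<in> sets borel"
        using measurable_sets[of "s i" borel borel "{y}"] by simp
      ultimately show ?thesis using p by (intro Lp_approximable_indicator)
    qed
  qed
  also have "(\<lambda>x. \<Sum>y\<in>range (s i). indicat_real (s i -` {y}) x *\<^sub>R y) = s i"
  proof
    fix x
    have "finite (range (s i))" using s(1)[of i] by (simp add: simple_function_def)
    then have "(\<Sum>y\<in>range (s i). indicat_real (s i -` {y}) x *\<^sub>R y) = (\<Sum>y\<in>{s i x}. indicat_real (s i -` {y}) x *\<^sub>R y)"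
      by (intro sum.mono_neutral_right) auto
    then show "(\<Sum>y\<in>range (s i). indicat_real (s i -` {y}) x *\<^sub>R y) = s i x" by simp
  qed
  finally show "\<exists>s. Lp_approximable p s \<and> (\<integral>\<^sup>+x. ennreal (norm (g x - s x) ^ p) \<partial>lborel) \<le> ennreal e"
    using i less_imp_le by blast
qed

lemma translation_continuous_compact_support:
  fixes h :: "'a::euclidean_space \<Rightarrow> 'b::euclidean_space"
  assumes h: "continuous_on UNIV h" "\<And>x. norm x > R \<Longrightarrow> h x = 0" and p: "p \<ge> 1" and e: "e > 0"
  obtains d where "d > 0" "\<And>z. norm z < d \<Longrightarrow> (\<integral>\<^sup>+x. ennreal (norm (h (x - z) - h x) ^ p) \<partial>lborel) \<le> ennreal e"
proof -
  define V where "V = measure lborel (cball (0::'a) (R + 1))"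
  \<comment> \<open>The bound 1 gives \<open>t ^ p \<le> t\<close>; the other makes \<open>t\<close>
    times the volume \<open>V\<close> of the slightly larger ball at most \<open>e\<close>.\<close>
  define t where "t = min 1 (e / (V + 1))"
  have "V \<ge> 0" by (simp add: V_def)
  have "t > 0" "t \<le> 1" using e \<open>V \<ge> 0\<close> by (auto simp: t_def intro!: divide_pos_pos add_nonneg_pos)
  have "uniformly_continuous_on (cball 0 (R + 2)) h"
    by (intro compact_uniformly_continuous continuous_on_subset[OF h(1)]) auto
  then obtain d where d: "d > 0" "\<And>x y. x \<in> cball 0 (R + 2) \<Longrightarrow> y \<in> cball 0 (R + 2) \<Longrightarrow> dist y x < d \<Longrightarrow> dist (h y) (h x) < t"
    using \<open>t > 0\<close> unfolding uniformly_continuous_on_def by metis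
  show ?thesis
  proof (rule that[of "min d 1"])
    fix z :: 'a assume z: "norm z < min d 1"
    have "(\<integral>\<^sup>+x. ennreal (norm (h (x - z) - h x) ^ p) \<partial>lborel) \<le> (\<integral>\<^sup>+x. ennreal t * indicator (cball 0 (R + 1)) x \<partial>(lborel :: 'a measure))"
    proof (intro nn_integral_mono)
      fix x :: 'a
      show "ennreal (norm (h (x - z) - h x) ^ p) \<le> ennreal t * indicator (cball 0 (R + 1)) x"
      proof (cases "x \<in> cball 0 (R + 1)")
        case True
        then have "x - z \<in> cball 0 (R + 2)" "x \<in> cball 0 (R + 2)"
          using z norm_triangle_ineq4[of x z] by auto
        then have "norm (h (x - z) - h x) < t" using d(2)[of x "x - z"] z by (simp add: dist_norm)
        then have "norm (h (x - z) - h x) ^ p \<le> t ^ p" by (intro power_mono) auto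
        also have "\<dots> \<le> t ^ 1" using \<open>t > 0\<close> \<open>t \<le> 1\<close> p by (intro power_decreasing) auto
        finally show ?thesis using True by (auto intro!: ennreal_leI)
      next
        case False
        then have "norm x > R" "norm (x - z) > R" using z norm_triangle_ineq2[of x z] by auto
        then show ?thesis using h(2) p by (simp add: power_0_left)
      qed
    qed
    also have "\<dots> = ennreal t * ennreal V"
    proof -
      have "emeasure lborel (cball (0::'a) (R + 1)) = ennreal V"
        unfolding V_def by (rule emeasure_eq_ennreal_measure) (use emeasure_lborel_cball_finite in \<open>auto simp: less_top\<close>)
      then show ?thesis by (subst nn_integral_cmult_indicator) auto
    qed
    also have "\<dots> = ennreal (t * V)" using \<open>t > 0\<close> \<open>V \<ge> 0\<close> by (simp add: ennreal_mult)
    also have "\<dots> \<le> ennreal e"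
    proof (rule ennreal_leI)
      have "t * V \<le> e / (V + 1) * V" using \<open>V \<ge> 0\<close> by (intro mult_right_mono) (auto simp: t_def)
      also have "\<dots> \<le> e" using \<open>V \<ge> 0\<close> e by (simp add: field_simps)
      finally show "t * V \<le> e" .
    qed
    finally show "(\<integral>\<^sup>+x. ennreal (norm (h (x - z) - h x) ^ p) \<partial>lborel) \<le> ennreal e" .
  qed (use d in auto)
qed

text \<open>The difference is split through a continuous approximant \<open>h\<close>: translation
  invariance makes the error at \<open>x - z\<close> the same as at \<open>x\<close>, and for
  \<open>h\<close> uniform continuity applies.\<close>

theorem translation_continuous_Lp:
  fixes g :: "'a::euclidean_space \<Rightarrow> 'b::euclidean_space"
  assumes g: "g \<in> borel_measurable borel" "(\<integral>\<^sup>+x. ennreal (norm (g x) ^ p) \<partial>lborel) < \<infinity>"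
    and supp: "\<And>x. norm x > R \<Longrightarrow> g x = 0" and p: "p \<ge> 1" and e: "e > 0"
  obtains d where "d > 0" "\<And>z. norm z < d \<Longrightarrow> (\<integral>\<^sup>+x. ennreal (norm (g (x - z) - g x) ^ p) \<partial>lborel) \<le> ennreal e"
proof -
  \<comment> \<open>Three errors of size \<open>t\<close> are added in two nested steps, costing
    \<open>2 ^ p * (2 ^ p * (t + t) + t)\<close> in total.\<close>
  define t where "t = e / (2 ^ p * (2 ^ p * 2 + 1))"
  have c: "(2::real) ^ p * (2 ^ p * 2 + 1) > 0" by (intro mult_pos_pos add_pos_pos) auto
  then have "t > 0" using e by (simp add: t_def)
  obtain h R' where h: "continuous_on UNIV h" "\<And>x. norm x > R' \<Longrightarrow> h x = 0"
    "(\<integral>\<^sup>+x. ennreal (norm (g x - h x) ^ p) \<partial>lborel) \<le> ennreal t"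
    using Lp_approximable_bounded_support[OF g supp p] \<open>t > 0\<close> unfolding Lp_approximable_def by blast
  obtain d where d: "d > 0" "\<And>z. norm z < d \<Longrightarrow> (\<integral>\<^sup>+x. ennreal (norm (h (x - z) - h x) ^ p) \<partial>lborel) \<le> ennreal t"
    using translation_continuous_compact_support[OF h(1,2) p \<open>t > 0\<close>] by metis
  note [measurable] = g(1)
  have [measurable]: "h \<in> borel_measurable borel" using h by (auto intro: borel_measurable_continuous_onI)
  show ?thesis
  proof (rule that[OF d(1)])
    fix z :: 'a assume z: "norm z < d"
    have "(\<integral>\<^sup>+x. ennreal (norm (g (x - z) - h (x - z)) ^ p) \<partial>lborel) = (\<integral>\<^sup>+x. ennreal (norm (g x - h x) ^ p) \<partial>lborel)"
      using nn_integral_lborel_shift[of "\<lambda>x. ennreal (norm (g x - h x) ^ p)" "- z"] by simp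
    then have 1: "(\<integral>\<^sup>+x. ennreal (norm (g (x - z) - h (x - z)) ^ p) \<partial>lborel) \<le> ennreal t" using h(3) by simp
    have 2: "(\<integral>\<^sup>+x. ennreal (norm (h x - g x) ^ p) \<partial>lborel) \<le> ennreal t" using h(3) by (simp add: norm_minus_commute)
    have "(\<integral>\<^sup>+x. ennreal (norm (((g (x - z) - h (x - z)) + (h x - g x)) + (h (x - z) - h x)) ^ p) \<partial>lborel)
        \<le> 2 ^ p * (2 ^ p * (ennreal t + ennreal t) + ennreal t)"
      by (intro nn_integral_norm_add_power_le d 1 2 z) measurable
    also have "(\<lambda>x. ((g (x - z) - h (x - z)) + (h x - g x)) + (h (x - z) - h x)) = (\<lambda>x. g (x - z) - g x)" by auto
    also have "2 ^ p * (2 ^ p * (ennreal t + ennreal t) + ennreal t) = ennreal e"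
    proof -
      have "2 ^ p * (2 ^ p * (ennreal t + ennreal t) + ennreal t) = ennreal (2 ^ p) * (ennreal (2 ^ p * (t + t)) + ennreal t)"
        using \<open>t > 0\<close> by (subst ennreal_two_power_double) (auto simp flip: ennreal_power)
      also have "\<dots> = ennreal (2 ^ p * (2 ^ p * (t + t) + t))"
      proof -
        have "ennreal (2 ^ p * (t + t)) + ennreal t = ennreal (2 ^ p * (t + t) + t)"
          using \<open>t > 0\<close> by (intro ennreal_plus[symmetric]) auto
        then show ?thesis using \<open>t > 0\<close> by (simp only:) (rule ennreal_mult[symmetric]; simp)
      qed
      also have "2 ^ p * (2 ^ p * (t + t) + t) = t * (2 ^ p * (2 ^ p * 2 + 1))" by (simp add: algebra_simps)
      also have "\<dots> = e" using c by (metis t_def less_irrefl nonzero_eq_divide_eq)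
      finally show ?thesis .
    qed
    finally show "(\<integral>\<^sup>+x. ennreal (norm (g (x - z) - g x) ^ p) \<partial>lborel) \<le> ennreal e" .
  qed
qed

text \<open>Convexity of the power function: its graph lies above the tangent at \<open>s\<close>.
  In the induction step the estimate is multiplied by \<open>t\<close>, and a nonnegative square is
  lost.\<close>

lemma power_tangent_le:
  fixes s t :: real
  assumes "0 \<le> s" "0 \<le> t"
  shows "s ^ Suc k + real (Suc k) * s ^ k * (t - s) \<le> t ^ Suc k"
proof (induction k)
  case (Suc k)
  have "0 \<le> real (Suc k) * s ^ k * (t - s)\<^sup>2" using assms by simp
  then have "s ^ Suc (Suc k) + real (Suc (Suc k)) * s ^ Suc k * (t - s)
      \<le> t * (s ^ Suc k + real (Suc k) * s ^ k * (t - s))"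
    by (simp add: algebra_simps power2_eq_square)
  also have "\<dots> \<le> t * t ^ Suc k" using Suc assms by (intro mult_left_mono) auto
  finally show ?case by simp
qed auto

text \<open>Jensen's inequality for the probability density \<open>w\<close>: the tangent inequality
  at the mean \<open>s\<close> of \<open>a\<close> is integrated against \<open>w\<close>, and its
  linear term integrates to zero.\<close>

lemma nn_integral_power_le:
  fixes w a :: "'a \<Rightarrow> real"
  assumes [measurable]: "w \<in> borel_measurable M" "a \<in> borel_measurable M"
    and nonneg: "\<And>x. 0 \<le> w x" "\<And>x. 0 \<le> a x" and w: "(\<integral>\<^sup>+x. ennreal (w x) \<partial>M) = 1"
  shows "(\<integral>\<^sup>+x. ennreal (w x * a x) \<partial>M) ^ Suc k \<le> (\<integral>\<^sup>+x. ennreal (w x * a x ^ Suc k) \<partial>M)"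
proof (cases "(\<integral>\<^sup>+x. ennreal (w x * a x ^ Suc k) \<partial>M) = \<infinity>")
  case False
  \<comment> \<open>The mean must be finite before a tangent can be taken there; this follows from
    \<open>a x \<le> 1 + a x ^ Suc k\<close>.\<close>
  have "(\<integral>\<^sup>+x. ennreal (w x * a x) \<partial>M) \<le> (\<integral>\<^sup>+x. ennreal (w x) + ennreal (w x * a x ^ Suc k) \<partial>M)"
  proof (intro nn_integral_mono)
    fix x
    have "a x \<le> 1 + a x ^ Suc k"
    proof (cases "a x \<le> 1")
      case False
      then have "a x ^ 1 \<le> a x ^ Suc k" by (intro power_increasing) auto
      then show ?thesis by simp
    qed (use nonneg(2)[of x] in \<open>simp add: add_increasing2\<close>)
    then have "w x * a x \<le> w x * (1 + a x ^ Suc k)" using nonneg by (intro mult_left_mono)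
    then have "ennreal (w x * a x) \<le> ennreal (w x + w x * a x ^ Suc k)"
      by (intro ennreal_leI) (simp add: algebra_simps)
    then show "ennreal (w x * a x) \<le> ennreal (w x) + ennreal (w x * a x ^ Suc k)"
      using nonneg[of x] by (simp add: ennreal_plus)
  qed
  also have "\<dots> = 1 + (\<integral>\<^sup>+x. ennreal (w x * a x ^ Suc k) \<partial>M)" using w by (simp add: nn_integral_add)
  also have "\<dots> < \<infinity>" using False by (simp add: less_top)
  finally obtain s where s: "s \<ge> 0" "(\<integral>\<^sup>+x. ennreal (w x * a x) \<partial>M) = ennreal s"
    by (cases "\<integral>\<^sup>+x. ennreal (w x * a x) \<partial>M" rule: ennreal_cases) auto
  obtain J where J: "J \<ge> 0" "(\<integral>\<^sup>+x. ennreal (w x * a x ^ Suc k) \<partial>M) = ennreal J"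
    using False by (cases "\<integral>\<^sup>+x. ennreal (w x * a x ^ Suc k) \<partial>M" rule: ennreal_cases) auto
  define q where "q = real (Suc k) * s ^ k"
  have "q \<ge> 0" using s by (simp add: q_def)
  \<comment> \<open>The negative part of the tangent line is moved to the other side, since all
    integrals take values in the nonnegative extended reals.\<close>
  have "(\<integral>\<^sup>+x. ennreal (s ^ Suc k) * ennreal (w x) + ennreal q * ennreal (w x * a x) \<partial>M)
     \<le> (\<integral>\<^sup>+x. ennreal (w x * a x ^ Suc k) + ennreal (q * s) * ennreal (w x) \<partial>M)"
  proof (intro nn_integral_mono)
    fix x
    have "s ^ Suc k + q * (a x - s) \<le> a x ^ Suc k"
      unfolding q_def using s nonneg(2) by (intro power_tangent_le)
    then have "w x * (s ^ Suc k + q * a x) \<le> w x * (a x ^ Suc k + q * s)"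
      using nonneg by (intro mult_left_mono) (auto simp: algebra_simps)
    then have "ennreal (s ^ Suc k * w x + q * (w x * a x)) \<le> ennreal (w x * a x ^ Suc k + q * s * w x)"
      by (intro ennreal_leI) (simp add: algebra_simps)
    then show "ennreal (s ^ Suc k) * ennreal (w x) + ennreal q * ennreal (w x * a x)
        \<le> ennreal (w x * a x ^ Suc k) + ennreal (q * s) * ennreal (w x)"
      using nonneg[of x] s(1) \<open>q \<ge> 0\<close> by (simp add: ennreal_plus ennreal_mult del: power_Suc)
  qed
  then have "ennreal (s ^ Suc k) + ennreal q * ennreal s \<le> ennreal J + ennreal (q * s)"
    using w s J by (simp add: nn_integral_add nn_integral_cmult)
  then have "ennreal (s ^ Suc k + q * s) \<le> ennreal (J + q * s)"
    using s J \<open>q \<ge> 0\<close> by (simp add: ennreal_plus ennreal_mult del: power_Suc)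
  then have "s ^ Suc k \<le> J" using s J \<open>q \<ge> 0\<close> by (simp add: ennreal_le_iff add_nonneg_nonneg del: power_Suc)
  then show ?thesis unfolding s(2) J(2) using s(1) by (simp add: ennreal_power ennreal_leI del: power_Suc)
qed simp

section \<open>Smoothing of Sobolev maps\<close>

lemma integral_lborel_eq_integral_cbox:
  fixes \<phi> :: "'a::euclidean_space \<Rightarrow> 'b::euclidean_space"
  assumes "continuous_on UNIV \<phi>" "\<And>x. x \<notin> cbox a b \<Longrightarrow> \<phi> x = 0"
  shows "integrable lborel \<phi>" "integral\<^sup>L lborel \<phi> = integral (cbox a b) \<phi>"
proof -
  have i: "integrable lborel (\<lambda>x. indicator (cbox a b) x *\<^sub>R \<phi> x)"
    by (intro borel_integrable_compact continuous_on_subset[OF assms(1)]) auto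
  have e: "(\<lambda>x. indicator (cbox a b) x *\<^sub>R \<phi> x) = \<phi>"
    using assms(2) by (auto simp: indicator_def fun_eq_iff)
  show "integrable lborel \<phi>" using i unfolding e .
  show "integral\<^sup>L lborel \<phi> = integral (cbox a b) \<phi>"
    using set_borel_integral_eq_integral(2)[of "cbox a b" \<phi>] i e unfolding set_integrable_def set_lebesgue_integral_def by simp
qed

text \<open>For centres near a given point the kernel vanishes outside one fixed box, so
  differentiation under the integral sign and continuity in the parameter reduce to the case of a
  compact box with continuous integrand.\<close>

lemma bump_convolution:
  fixes u :: "'a::euclidean_space \<Rightarrow> real"
  assumes u: "continuous_on UNIV u" and r: "r > 0"
  shows "integrable lborel (\<lambda>y. bump r (x - y) * u y)"
    and "integrable lborel (\<lambda>y. u y * bump_slope r (x - y) * ((x - y) \<bullet> v))"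
    and "((\<lambda>x. LINT y|lborel. bump r (x - y) * u y) has_derivative
      (\<lambda>v. LINT y|lborel. u y * bump_slope r (x - y) * ((x - y) \<bullet> v))) (at x)"
    and "continuous_on UNIV (\<lambda>x. LINT y|lborel. u y * bump_slope r (x - y) * ((x - y) \<bullet> v))"
proof -
  have cont: "continuous_on S (\<lambda>p. u (snd p))" "continuous_on S (\<lambda>p. bump r (fst p - snd p))"
     "continuous_on S (\<lambda>p. bump_slope r (fst p - snd p))" for S :: "('a \<times> 'a) set"
    by (intro continuous_on_compose2[OF u] continuous_on_compose2[OF continuous_on_bump(1)[of UNIV]]
      continuous_on_compose2[OF continuous_on_bump(2)[of UNIV]] continuous_intros; simp)+
  have cont1: "continuous_on S (\<lambda>y. bump r (x - y))" "continuous_on S (\<lambda>y. bump_slope r (x - y))" for S and x :: 'a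
    by (intro continuous_on_compose2[OF continuous_on_bump(1)[of UNIV]]
      continuous_on_compose2[OF continuous_on_bump(2)[of UNIV]] continuous_intros; simp)+
  \<comment> \<open>One box serves all centres in the unit ball around \<open>x0\<close>: beyond
    distance \<open>1 + r\<close> from \<open>x0\<close> every such kernel is zero.\<close>
  have main: "\<exists>a b. \<forall>x\<in>ball x0 1. \<forall>y. y \<notin> cbox a b \<longrightarrow> bump r (x - y) = 0 \<and> bump_slope r (x - y) = 0" for x0 :: 'a
  proof -
    have "bounded (ball x0 (1 + r))" by simp
    then obtain a where a: "ball x0 (1 + r) \<subseteq> cbox (- a) a" using bounded_subset_cbox_symmetric by blast
    have "bump r (x - y) = 0 \<and> bump_slope r (x - y) = 0" if "x \<in> ball x0 1" "y \<notin> cbox (- a) a" for x y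
    proof -
      have "\<not> dist x0 y < 1 + r" using a that by auto
      then have "norm (x - y) \<ge> r" using that dist_triangle[of x0 y x] by (simp add: dist_norm)
      then show ?thesis using bump_eq_0[OF r] by blast
    qed
    then show ?thesis by blast
  qed
  obtain a b where ab: "\<And>z y. z \<in> ball x 1 \<Longrightarrow> y \<notin> cbox a b \<Longrightarrow> bump r (z - y) = 0 \<and> bump_slope r (z - y) = 0"
    using main[of x] by blast
  have eq1: "integrable lborel (\<lambda>y. bump r (z - y) * u y)"
    "(LINT y|lborel. bump r (z - y) * u y) = integral (cbox a b) (\<lambda>y. bump r (z - y) * u y)" if "z \<in> ball x 1" for z
    using that ab by (auto intro!: integral_lborel_eq_integral_cbox[where a = a and b = b] continuous_intros u cont1)
  have eq2: "integrable lborel (\<lambda>y. u y * bump_slope r (z - y) * ((z - y) \<bullet> v))"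
    "(LINT y|lborel. u y * bump_slope r (z - y) * ((z - y) \<bullet> v)) = integral (cbox a b) (\<lambda>y. u y * bump_slope r (z - y) * ((z - y) \<bullet> v))"
      if "z \<in> ball x 1" for z v
    using that ab by (auto intro!: integral_lborel_eq_integral_cbox[where a = a and b = b] continuous_intros u cont1)
  show "integrable lborel (\<lambda>y. bump r (x - y) * u y)"
    "integrable lborel (\<lambda>y. u y * bump_slope r (x - y) * ((x - y) \<bullet> v))"
    using eq1(1)[of x] eq2(1)[of x] by auto
  \<comment> \<open>The derivative of the integrand in the centre, packaged as a bounded linear map
    so that it can itself be integrated over the box.\<close>
  define fx where "fx z y = (u y * bump_slope r (z - y)) *\<^sub>R blinfun_inner_right (z - y)" for z y :: 'a
  have cont_fx: "continuous_on S (\<lambda>(z, y). fx z y)" for S :: "('a \<times> 'a) set"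
    unfolding fx_def split_beta
    by (intro continuous_intros cont bounded_linear.continuous_on[OF bounded_linear_blinfun_inner_right])
  have "((\<lambda>z. integral (cbox a b) (\<lambda>y. bump r (z - y) * u y)) has_derivative integral (cbox a b) (fx x)) (at x within ball x 1)"
  proof (rule leibniz_rule)
    show "((\<lambda>z. bump r (z - y) * u y) has_derivative blinfun_apply (fx z y)) (at z within ball x 1)" for z y
    proof -
      have "((\<lambda>z. z - y) has_derivative (\<lambda>v. v)) (at z within ball x 1)" by (auto intro!: derivative_eq_intros)
      from has_derivative_compose[OF this has_derivative_bump[of r]]
      have "((\<lambda>z. bump r (z - y)) has_derivative (\<lambda>v. bump_slope r (z - y) * ((z - y) \<bullet> v))) (at z within ball x 1)" .
      from has_derivative_mult_left[OF this, of "u y"] show ?thesis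
        by (simp add: fx_def blinfun.scaleR_left[abs_def] mult_ac)
    qed
    show "(\<lambda>y. bump r (z - y) * u y) integrable_on cbox a b" for z
      by (intro integrable_continuous continuous_intros cont1 continuous_on_subset[OF u]) auto
  qed (auto intro: cont_fx)
  then have der: "((\<lambda>z. integral (cbox a b) (\<lambda>y. bump r (z - y) * u y)) has_derivative integral (cbox a b) (fx x)) (at x)"
    by (simp add: at_within_open[of x "ball x 1"])
  have app: "blinfun_apply (integral (cbox a b) (fx x)) v = (LINT y|lborel. u y * bump_slope r (x - y) * ((x - y) \<bullet> v))" for v
  proof -
    have "fx x integrable_on cbox a b"
      unfolding fx_def
      by (intro integrable_continuous continuous_intros cont1 continuous_on_subset[OF u]
          bounded_linear.continuous_on[OF bounded_linear_blinfun_inner_right]) auto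
    from integral_linear[OF this blinfun.bounded_linear_left, of v]
    have "blinfun_apply (integral (cbox a b) (fx x)) v = integral (cbox a b) (\<lambda>y. blinfun_apply (fx x y) v)"
      by (simp add: o_def)
    then show ?thesis using eq2(2)[of x v] by (simp add: fx_def blinfun.scaleR_left)
  qed
  from der have "((\<lambda>z. integral (cbox a b) (\<lambda>y. bump r (z - y) * u y)) has_derivative
      (\<lambda>v. LINT y|lborel. u y * bump_slope r (x - y) * ((x - y) \<bullet> v))) (at x)"
    unfolding app[abs_def] .
  then show "((\<lambda>x. LINT y|lborel. bump r (x - y) * u y) has_derivative
      (\<lambda>v. LINT y|lborel. u y * bump_slope r (x - y) * ((x - y) \<bullet> v))) (at x)"
    by (rule has_derivative_transform_within_open[where s = "ball x 1"]) (use eq1 in auto)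
  show "continuous_on UNIV (\<lambda>x. LINT y|lborel. u y * bump_slope r (x - y) * ((x - y) \<bullet> v))"
    unfolding continuous_on_eq_continuous_at[OF open_UNIV]
  proof
    fix x0 :: 'a
    obtain a b where ab: "\<And>z y. z \<in> ball x0 1 \<Longrightarrow> y \<notin> cbox a b \<Longrightarrow> bump r (z - y) = 0 \<and> bump_slope r (z - y) = 0"
      using main[of x0] by blast
    have eq: "(LINT y|lborel. u y * bump_slope r (z - y) * ((z - y) \<bullet> v)) = integral (cbox a b) (\<lambda>y. u y * bump_slope r (z - y) * ((z - y) \<bullet> v))"
      if "z \<in> ball x0 1" for z
      using that ab by (auto intro!: integral_lborel_eq_integral_cbox[where a = a and b = b] continuous_intros u cont1)
    have "continuous_on (ball x0 1) (\<lambda>z. integral (cbox a b) (\<lambda>y. u y * bump_slope r (z - y) * ((z - y) \<bullet> v)))"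
      by (intro integral_continuous_on_param) (auto simp: split_beta intro!: continuous_intros cont)
    then have "continuous_on (ball x0 1) (\<lambda>z. LINT y|lborel. u y * bump_slope r (z - y) * ((z - y) \<bullet> v))"
      by (subst continuous_on_cong[OF refl eq]) auto
    then show "isCont (\<lambda>x. LINT y|lborel. u y * bump_slope r (x - y) * ((x - y) \<bullet> v)) x0"
      by (simp add: continuous_on_eq_continuous_at)
  qed
qed

text \<open>The type argument fixes the space on which the bump lives; the radius alone does not
  determine it.\<close>

definition bump_mass :: "'a::euclidean_space itself \<Rightarrow> real \<Rightarrow> real" where
  "bump_mass _ r = (LINT z|lborel. bump r (z :: 'a))"

lemma bump_mass:
  assumes "r > 0"
  shows "bump_mass TYPE('a::euclidean_space) r > 0"
    and "(\<integral>\<^sup>+y. ennreal (bump r (x - y)) \<partial>lborel) = ennreal (bump_mass TYPE('a) r)"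
    and "(LINT y|lborel. bump r (x - y)) = bump_mass TYPE('a) r"
    and "(\<integral>\<^sup>+y. ennreal (bump r (y :: 'a)) \<partial>lborel) = ennreal (bump_mass TYPE('a) r)"
    and "integrable lborel (\<lambda>y :: 'a. bump r (x - y))"
proof -
  have meas: "bump r \<in> borel_measurable (borel :: 'a measure)"
    by (intro borel_measurable_continuous_onI continuous_on_bump)
  have int: "integrable lborel (\<lambda>y :: 'a. bump r (x - y))" for x
    using bump_convolution(1)[where u = "\<lambda>_. 1", OF continuous_on_const assms] by simp
  then show "integrable lborel (\<lambda>y :: 'a. bump r (x - y))" .
  have int0: "integrable lborel (bump r :: 'a \<Rightarrow> real)"
  proof -
    have "bump r (0 - y) = bump r y" for y :: 'a by (simp add: bump_def)
    then show ?thesis using int[of 0] by simp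
  qed
  show nn0: "(\<integral>\<^sup>+y. ennreal (bump r (y :: 'a)) \<partial>lborel) = ennreal (bump_mass TYPE('a) r)"
    unfolding bump_mass_def by (intro nn_integral_eq_integral int0) (auto simp: bump_nonneg)
  then show nn: "(\<integral>\<^sup>+y. ennreal (bump r (x - y)) \<partial>lborel) = ennreal (bump_mass TYPE('a) r)"
    using nn_integral_lborel_reflect[of "\<lambda>z. ennreal (bump r z)" x] meas by simp
  have nonneg: "bump_mass TYPE('a) r \<ge> 0"
    unfolding bump_mass_def by (intro integral_nonneg_AE) (auto simp: bump_nonneg)
  have "ennreal (LINT y|lborel. bump r (x - y)) = ennreal (bump_mass TYPE('a) r)"
    unfolding nn[symmetric] by (intro nn_integral_eq_integral[symmetric] int) (auto simp: bump_nonneg)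
  then show "(LINT y|lborel. bump r (x - y)) = bump_mass TYPE('a) r"
    using nonneg by (subst (asm) ennreal_inj) (auto intro!: integral_nonneg_AE simp: bump_nonneg)
  show "bump_mass TYPE('a) r > 0"
  proof (rule ccontr)
    assume "\<not> ?thesis"
    then have "(LINT z|lborel. bump r (z :: 'a)) = 0" using nonneg by (simp add: bump_mass_def)
    then have "AE z in lborel. bump r (z :: 'a) = 0"
      using integral_nonneg_eq_0_iff_AE[OF int0] by (simp add: bump_nonneg)
    then have "AE z in lborel. (z :: 'a) \<notin> ball 0 r"
    proof eventually_elim
      case (elim z)
      then show ?case using bump_pos[of z r] by auto
    qed
    then have "emeasure lborel (ball (0 :: 'a) r) = 0"
      by (subst (asm) AE_iff_measurable[where N = "ball 0 r"]) auto
    then have "measure lborel (ball (0 :: 'a) r) = 0" by (simp add: measure_def)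
    then show False using content_ball_pos[OF assms, of "0 :: 'a"] by simp
  qed
qed


text \<open>The part of the local Sobolev condition that mollification uses: \<open>G\<close> is
  Borel, so that Tonelli applies to Lebesgue measure directly, and it is tested as weak derivative
  against translated bumps only. The two minus signs, from integration by parts and from
  differentiating \<open>bump r (x - y)\<close> in \<open>y\<close>, have cancelled.\<close>

locale continuous_W1n =
  fixes f :: "real^'n \<Rightarrow> real^'n" and G :: "real^'n \<Rightarrow> real^'n^'n"
  assumes cont_f: "continuous_on UNIV f"
    and meas_G [measurable]: "G \<in> borel_measurable borel"
    and finite_energy: "(\<integral>\<^sup>+x. ennreal (norm (G x) ^ CARD('n)) * indicator (cball 0 R) x \<partial>lborel) < \<infinity>"
    and weak_derivative: "r > 0 \<Longrightarrow> (LINT y|lborel. f y $ i * bump_slope r (x - y) * ((x - y) \<bullet> axis j 1)) =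
        (LINT y|lborel. bump r (x - y) * G y $ i $ j)"
begin

lemmas [measurable] = meas_G borel_closed[OF closed_cball]

text \<open>On the bounded support of the kernel, \<open>norm (G y) \<le> 1 + norm (G y) ^ n\<close>
  with n the dimension turns local finiteness of the energy into local integrability.\<close>

lemma integrable_bump_G:
  assumes "r > 0"
  shows "integrable lborel (\<lambda>y. bump r (x - y) *\<^sub>R G y)"
proof -
  have [measurable]: "bump r \<in> borel_measurable (borel :: (real^'n) measure)"
    by (intro borel_measurable_continuous_onI continuous_on_bump)
  define R where "R = norm x + r"
  obtain B where B: "\<And>y. norm (bump r (x - y)) \<le> B"
  proof -
    have "bounded (bump r ` cball (0 :: real^'n) r)"
      by (intro compact_imp_bounded compact_continuous_image continuous_on_bump) auto
    then obtain B where "\<And>z. z \<in> cball 0 r \<Longrightarrow> norm (bump r (z :: real^'n)) \<le> B"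
      unfolding bounded_iff by (metis image_eqI)
    then have "norm (bump r z) \<le> max B 0" for z :: "real^'n"
      using bump_eq_0(1)[OF assms, of z] by (cases "norm z \<le> r") (auto simp: max.coboundedI1)
    then show ?thesis using that by blast
  qed
  have "B \<ge> 0" using B[of 0] norm_ge_zero order_trans by blast
  show ?thesis
  proof (rule integrableI_bounded)
    have "(\<integral>\<^sup>+y. ennreal (norm (bump r (x - y) *\<^sub>R G y)) \<partial>lborel)
       \<le> (\<integral>\<^sup>+y. ennreal B * (indicator (cball 0 R) y + ennreal (norm (G y) ^ CARD('n)) * indicator (cball 0 R) y) \<partial>lborel)"
    proof (intro nn_integral_mono)
      fix y
      show "ennreal (norm (bump r (x - y) *\<^sub>R G y)) \<le> ennreal B * (indicator (cball 0 R) y + ennreal (norm (G y) ^ CARD('n)) * indicator (cball 0 R) y)"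
      proof (cases "y \<in> cball 0 R")
        case True
        have "norm (G y) \<le> 1 + norm (G y) ^ CARD('n)"
        proof (cases "norm (G y) \<le> 1")
          case False
          then have "norm (G y) ^ 1 \<le> norm (G y) ^ CARD('n)"
            by (intro power_increasing) (auto simp: Suc_leI)
          then show ?thesis by simp
        qed (simp add: add_increasing2)
        then have "norm (bump r (x - y) *\<^sub>R G y) \<le> B * (1 + norm (G y) ^ CARD('n))"
          using B[of y] \<open>B \<ge> 0\<close> by (auto intro!: mult_mono)
        then have "ennreal (norm (bump r (x - y) *\<^sub>R G y)) \<le> ennreal (B * (1 + norm (G y) ^ CARD('n)))"
          by (rule ennreal_leI)
        then show ?thesis using True \<open>B \<ge> 0\<close> by (simp add: ennreal_mult ennreal_plus)
      next
        case False
        then have "norm (x - y) \<ge> r" using norm_triangle_ineq2[of y x] by (simp add: R_def norm_minus_commute)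
        then have "bump r (x - y) = 0" by (rule bump_eq_0(1)[OF assms])
        then show ?thesis by simp
      qed
    qed
    also have "\<dots> = ennreal B * (emeasure lborel (cball (0::real^'n) R) +
        (\<integral>\<^sup>+y. ennreal (norm (G y) ^ CARD('n)) * indicator (cball 0 R) y \<partial>lborel))"
      by (subst nn_integral_cmult) (auto simp: nn_integral_add)
    also have "\<dots> < \<infinity>"
      using finite_energy[of R] emeasure_lborel_cball_finite[of "0::real^'n" R] by (auto simp: ennreal_mult_less_top)
    finally show "(\<integral>\<^sup>+y. ennreal (norm (bump r (x - y) *\<^sub>R G y)) \<partial>lborel) < \<infinity>" .
  qed measurable
qed

definition smooth :: "real \<Rightarrow> real^'n \<Rightarrow> real^'n" where
  "smooth r x = (\<chi> i. (1 / bump_mass TYPE(real^'n) r) * (LINT y|lborel. bump r (x - y) * f y $ i))"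

definition smooth_G :: "real \<Rightarrow> real^'n \<Rightarrow> real^'n^'n" where
  "smooth_G r x = (1 / bump_mass TYPE(real^'n) r) *\<^sub>R (LINT y|lborel. bump r (x - y) *\<^sub>R G y)"

lemma cont_component: "continuous_on UNIV (\<lambda>y. f y $ i)"
  by (intro continuous_intros cont_f)

text \<open>The weak derivative condition moves the derivative onto the kernel. The right-hand side
  is the formula for a partial derivative of the mollified component, so \<open>smooth_G\<close> is
  the derivative of \<open>smooth\<close>, and its continuity comes from that formula too.\<close>

lemma smooth_G_nth:
  assumes "r > 0"
  shows "smooth_G r x $ i $ j = (1 / bump_mass TYPE(real^'n) r) * (LINT y|lborel. f y $ i * bump_slope r (x - y) * ((x - y) \<bullet> axis j 1))"
proof -
  have bl: "bounded_linear (\<lambda>M::real^'n^'n. M $ i $ j)"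
    by (rule bounded_linear_compose[OF bounded_linear_vec_nth bounded_linear_vec_nth])
  have "(LINT y|lborel. bump r (x - y) *\<^sub>R G y) $ i $ j = (LINT y|lborel. (bump r (x - y) *\<^sub>R G y) $ i $ j)"
    using integral_bounded_linear[OF bl integrable_bump_G[OF assms]] by simp
  then show ?thesis using weak_derivative[OF assms] by (simp add: smooth_G_def)
qed

lemma has_derivative_smooth:
  assumes "r > 0"
  shows "(smooth r has_derivative (\<lambda>v. smooth_G r x *v v)) (at x)"
  unfolding has_derivative_vec_iff
proof
  fix i
  have "(smooth_G r x *v v) $ i = (1 / bump_mass TYPE(real^'n) r) * (LINT y|lborel. f y $ i * bump_slope r (x - y) * ((x - y) \<bullet> v))" for v
  proof -
    have "(\<Sum>j\<in>UNIV. (LINT y|lborel. f y $ i * bump_slope r (x - y) * ((x - y) \<bullet> axis j 1)) * v $ j)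
        = (\<Sum>j\<in>UNIV. (LINT y|lborel. f y $ i * bump_slope r (x - y) * ((x - y) \<bullet> axis j 1) * v $ j))"
      by (simp add: bump_convolution(2)[OF cont_component assms])
    also have "\<dots> = (LINT y|lborel. (\<Sum>j\<in>UNIV. f y $ i * bump_slope r (x - y) * ((x - y) \<bullet> axis j 1) * v $ j))"
      by (intro Bochner_Integration.integral_sum[symmetric] integrable_mult_left bump_convolution(2)[OF cont_component assms])
    also have "\<dots> = (LINT y|lborel. f y $ i * bump_slope r (x - y) * ((x - y) \<bullet> v))"
      by (intro Bochner_Integration.integral_cong refl) (simp add: inner_axis inner_vec_def[of "x - _" v] sum_distrib_left mult_ac)
    finally show ?thesis
      by (simp add: matrix_vector_mult_def smooth_G_nth[OF assms] mult_ac flip: sum_divide_distrib)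
  qed
  then show "((\<lambda>x. smooth r x $ i) has_derivative (\<lambda>v. (smooth_G r x *v v) $ i)) (at x)"
    unfolding smooth_def
    using has_derivative_mult_right[OF bump_convolution(3)[OF cont_component assms, of i x], of "1 / bump_mass TYPE(real^'n) r"]
    by simp
qed

lemma continuous_on_smooth_G:
  assumes "r > 0"
  shows "continuous_on UNIV (smooth_G r)"
proof -
  have "continuous_on UNIV (\<lambda>x. \<chi> i j. (1 / bump_mass TYPE(real^'n) r) * (LINT y|lborel. f y $ i * bump_slope r (x - y) * ((x - y) \<bullet> axis j 1)))"
    by (intro continuous_intros bump_convolution(4)[OF cont_component assms])
  moreover have "(\<lambda>x. \<chi> i j. (1 / bump_mass TYPE(real^'n) r) * (LINT y|lborel. f y $ i * bump_slope r (x - y) * ((x - y) \<bullet> axis j 1))) = smooth_G r"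
    using smooth_G_nth[OF assms] by (auto simp: fun_eq_iff vec_eq_iff)
  ultimately show ?thesis by (simp only:)
qed

lemma smooth_close:
  assumes r: "r > 0" and close: "\<And>y. norm (x - y) < r \<Longrightarrow> \<bar>f y $ i - f x $ i\<bar> \<le> e"
  shows "\<bar>smooth r x $ i - f x $ i\<bar> \<le> e"
proof -
  let ?m = "bump_mass TYPE(real^'n) r"
  note m = bump_mass[where 'a = "real^'n", OF r]
  have i1: "integrable lborel (\<lambda>y. bump r (x - y) * (f y $ i - f x $ i))"
    by (intro bump_convolution(1) r continuous_intros cont_f)
  have "(LINT y|lborel. bump r (x - y) * f y $ i) - ?m * f x $ i
      = (LINT y|lborel. bump r (x - y) * f y $ i) - (LINT y|lborel. bump r (x - y) * f x $ i)"
    using m(3)[of x] m(5)[of x] by simp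
  also have "\<dots> = (LINT y|lborel. bump r (x - y) * (f y $ i - f x $ i))"
    using Bochner_Integration.integral_diff[OF bump_convolution(1)[OF cont_component r, of x i]
        bump_convolution(1)[where u = "\<lambda>_. f x $ i", OF continuous_on_const r, of x]]
    by (simp add: right_diff_distrib)
  finally have "\<bar>(LINT y|lborel. bump r (x - y) * f y $ i) - ?m * f x $ i\<bar> \<le> (LINT y|lborel. norm (bump r (x - y) * (f y $ i - f x $ i)))"
    using integral_norm_bound[of lborel "\<lambda>y. bump r (x - y) * (f y $ i - f x $ i)"] by simp
  also have "\<dots> \<le> (LINT y|lborel. bump r (x - y) * e)"
  proof (intro integral_mono)
    show "integrable lborel (\<lambda>y. norm (bump r (x - y) * (f y $ i - f x $ i)))" using i1 by simp
    show "integrable lborel (\<lambda>y. bump r (x - y) * e)" using m(5) by simp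
    fix y
    show "norm (bump r (x - y) * (f y $ i - f x $ i)) \<le> bump r (x - y) * e"
    proof (cases "norm (x - y) < r")
      case True
      then show ?thesis using close[OF True] bump_nonneg[of r "x - y"] by (simp add: abs_mult mult_left_mono)
    qed (use bump_eq_0(1)[OF r, of "x - y"] in auto)
  qed
  also have "\<dots> = ?m * e" using m(3,5) by simp
  finally have *: "\<bar>(LINT y|lborel. bump r (x - y) * f y $ i) - ?m * f x $ i\<bar> \<le> ?m * e" .
  have "smooth r x $ i - f x $ i = (1 / ?m) * ((LINT y|lborel. bump r (x - y) * f y $ i) - ?m * f x $ i)"
    using m(1) by (simp add: smooth_def field_simps)
  then have "\<bar>smooth r x $ i - f x $ i\<bar> = (1 / ?m) * \<bar>(LINT y|lborel. bump r (x - y) * f y $ i) - ?m * f x $ i\<bar>"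
    using m(1) by (simp add: abs_mult)
  also have "\<dots> \<le> (1 / ?m) * (?m * e)" using m(1) * by (intro mult_left_mono) auto
  also have "\<dots> = e" using m(1) by simp
  finally show ?thesis .
qed

text \<open>The error is an average of \<open>G y - G x\<close> with probability density bump over
  mass, so Jensen's inequality applies; the substitution \<open>y = x - z\<close> expresses it by
  translations. For \<open>r \<le> 1\<close> only points of the ball of radius \<open>R + 1\<close>
  enter, which allows \<open>G\<close> to be truncated to \<open>g\<close>, a function of finite
  total energy.\<close>

lemma smooth_G_diff_le:
  assumes r: "0 < r" "r \<le> 1" and x: "x \<in> cball 0 R"
  defines "g \<equiv> \<lambda>y. indicat_real (cball 0 (R + 1)) y *\<^sub>R G y"
  shows "ennreal (norm (smooth_G r x - G x) ^ CARD('n)) \<le>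
     (\<integral>\<^sup>+z. ennreal (bump r z / bump_mass TYPE(real^'n) r) * ennreal (norm (g (x - z) - g x) ^ CARD('n)) \<partial>lborel)"
proof -
  let ?m = "bump_mass TYPE(real^'n) r" and ?w = "\<lambda>z. bump r z / bump_mass TYPE(real^'n) r"
  note m = bump_mass[where 'a = "real^'n", OF r(1)]
  have [measurable]: "bump r \<in> borel_measurable (borel :: (real^'n) measure)"
    by (intro borel_measurable_continuous_onI continuous_on_bump)
  have [measurable]: "g \<in> borel_measurable borel" unfolding g_def by measurable
  have gx: "g x = G x" using x by (simp add: g_def)
  have bg: "bump r (x - y) *\<^sub>R G y = bump r (x - y) *\<^sub>R g y" for y
  proof (cases "norm (x - y) < r")
    case True
    then have "norm y \<le> R + 1" using x r norm_triangle_ineq2[of y x] by (simp add: norm_minus_commute)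
    then show ?thesis by (simp add: g_def)
  next
    case False
    then have "bump r (x - y) = 0" by (intro bump_eq_0(1)[OF r(1)]) simp
    then show ?thesis by simp
  qed
  have i1: "integrable lborel (\<lambda>y. bump r (x - y) *\<^sub>R g y)"
    using integrable_bump_G[OF r(1), of x] by (simp only: bg)
  have i2: "integrable lborel (\<lambda>y. bump r (x - y) *\<^sub>R g x)" using m(5)[of x] by simp
  have "smooth_G r x - G x = (1 / ?m) *\<^sub>R ((LINT y|lborel. bump r (x - y) *\<^sub>R g y) - ?m *\<^sub>R g x)"
    using m(1) by (simp add: smooth_G_def bg gx scaleR_diff_right)
  also have "(LINT y|lborel. bump r (x - y) *\<^sub>R g y) - ?m *\<^sub>R g x = (LINT y|lborel. bump r (x - y) *\<^sub>R (g y - g x))"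
    using i1 i2 m(3,5)[of x] by (simp add: scaleR_diff_right)
  finally have eq: "smooth_G r x - G x = (1 / ?m) *\<^sub>R (LINT y|lborel. bump r (x - y) *\<^sub>R (g y - g x))" .
  have "ennreal (norm (LINT y|lborel. bump r (x - y) *\<^sub>R (g y - g x))) \<le> (\<integral>\<^sup>+y. ennreal (norm (bump r (x - y) *\<^sub>R (g y - g x))) \<partial>lborel)"
    using i1 i2 by (intro integral_norm_bound_ennreal) (simp add: scaleR_diff_right)
  then have "ennreal (1 / ?m) * ennreal (norm (LINT y|lborel. bump r (x - y) *\<^sub>R (g y - g x)))
      \<le> ennreal (1 / ?m) * (\<integral>\<^sup>+y. ennreal (norm (bump r (x - y) *\<^sub>R (g y - g x))) \<partial>lborel)"
    by (rule mult_left_mono) simp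
  also have "\<dots> = (\<integral>\<^sup>+y. ennreal (1 / ?m) * ennreal (norm (bump r (x - y) *\<^sub>R (g y - g x))) \<partial>lborel)"
    by (intro nn_integral_cmult[symmetric]) measurable
  also have "\<dots> = (\<integral>\<^sup>+y. ennreal (?w (x - y) * norm (g y - g x)) \<partial>lborel)"
    using m(1) by (intro nn_integral_cong) (simp add: bump_nonneg flip: ennreal_mult)
  finally have "ennreal (norm (smooth_G r x - G x)) \<le> (\<integral>\<^sup>+y. ennreal (?w (x - y) * norm (g y - g x)) \<partial>lborel)"
    unfolding eq using m(1) by (simp flip: ennreal_mult)
  then have "ennreal (norm (smooth_G r x - G x)) ^ CARD('n) \<le> (\<integral>\<^sup>+y. ennreal (?w (x - y) * norm (g y - g x)) \<partial>lborel) ^ CARD('n)"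
    by (rule power_mono) simp
  also have "\<dots> \<le> (\<integral>\<^sup>+y. ennreal (?w (x - y) * norm (g y - g x) ^ CARD('n)) \<partial>lborel)"
  proof -
    obtain k where k: "CARD('n) = Suc k" by (metis One_nat_def not0_implies_Suc zero_less_card_finite less_numeral_extra(3))
    have "(\<integral>\<^sup>+y. ennreal (?w (x - y)) \<partial>lborel) = (\<integral>\<^sup>+y. ennreal (1 / ?m) * ennreal (bump r (x - y)) \<partial>lborel)"
      using m(1) by (intro nn_integral_cong) (simp add: bump_nonneg flip: ennreal_mult)
    also have "\<dots> = ennreal (1 / ?m) * ennreal ?m"
      using m(2)[of x] by (subst nn_integral_cmult) auto
    also have "\<dots> = 1" using m(1) by (simp flip: ennreal_mult)
    finally show ?thesis
      unfolding k using m(1) by (intro nn_integral_power_le) (auto simp: bump_nonneg)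
  qed
  also have "\<dots> = (\<integral>\<^sup>+y. ennreal (?w (x - y)) * ennreal (norm (g (x - (x - y)) - g x) ^ CARD('n)) \<partial>lborel)"
    using m(1) by (intro nn_integral_cong) (simp add: bump_nonneg flip: ennreal_mult)
  also have "\<dots> = (\<integral>\<^sup>+z. ennreal (?w z) * ennreal (norm (g (x - z) - g x) ^ CARD('n)) \<partial>lborel)"
    by (rule nn_integral_lborel_reflect) measurable
  finally show ?thesis by (simp add: ennreal_power)
qed

text \<open>Exchanging the integrals leaves an average over \<open>norm z < r\<close> of the
  translation errors of the truncated \<open>g\<close>, each of which is small by continuity of
  translations.\<close>

lemma smooth_G_Lp_close:
  assumes e: "e > 0"
  obtains d where "d > 0" "\<And>r. 0 < r \<Longrightarrow> r < d \<Longrightarrow>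
    (\<integral>\<^sup>+x. ennreal (norm (smooth_G r x - G x) ^ CARD('n)) * indicator (cball 0 R) x \<partial>lborel) \<le> ennreal e"
proof -
  define g where "g y = indicat_real (cball 0 (R + 1)) y *\<^sub>R G y" for y
  have [measurable]: "g \<in> borel_measurable borel" unfolding g_def by measurable
  have "(\<integral>\<^sup>+x. ennreal (norm (g x) ^ CARD('n)) \<partial>lborel) = (\<integral>\<^sup>+x. ennreal (norm (G x) ^ CARD('n)) * indicator (cball 0 (R + 1)) x \<partial>lborel)"
    by (intro nn_integral_cong) (auto simp: g_def indicator_def power_0_left)
  then have fin: "(\<integral>\<^sup>+x. ennreal (norm (g x) ^ CARD('n)) \<partial>lborel) < \<infinity>" using finite_energy by simp
  have supp: "g x = 0" if "norm x > R + 1" for x using that by (simp add: g_def)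
  have n1: "1 \<le> CARD('n)" by (simp add: Suc_leI)
  obtain d where d: "d > 0" "\<And>z. norm z < d \<Longrightarrow> (\<integral>\<^sup>+x. ennreal (norm (g (x - z) - g x) ^ CARD('n)) \<partial>lborel) \<le> ennreal e"
    by (rule translation_continuous_Lp[OF _ fin supp n1 e]) auto
  show ?thesis
  proof (rule that[of "min d 1"])
    fix r assume r: "0 < r" "r < min d 1"
    let ?m = "bump_mass TYPE(real^'n) r" and ?w = "\<lambda>z. bump r z / bump_mass TYPE(real^'n) r"
    note m = bump_mass[where 'a = "real^'n", OF r(1)]
    have [measurable]: "bump r \<in> borel_measurable (borel :: (real^'n) measure)"
      by (intro borel_measurable_continuous_onI continuous_on_bump)
    have "(\<integral>\<^sup>+x. ennreal (norm (smooth_G r x - G x) ^ CARD('n)) * indicator (cball 0 R) x \<partial>lborel)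
        \<le> (\<integral>\<^sup>+x. (\<integral>\<^sup>+z. ennreal (?w z) * ennreal (norm (g (x - z) - g x) ^ CARD('n)) \<partial>lborel) \<partial>lborel)"
      using smooth_G_diff_le[of r _ R] r by (intro nn_integral_mono) (auto simp: g_def indicator_def)
    also have "\<dots> = (\<integral>\<^sup>+z. (\<integral>\<^sup>+x. ennreal (?w z) * ennreal (norm (g (x - z) - g x) ^ CARD('n)) \<partial>lborel) \<partial>lborel)"
      by (rule lborel_pair.Fubini') measurable
    also have "\<dots> = (\<integral>\<^sup>+z. ennreal (?w z) * (\<integral>\<^sup>+x. ennreal (norm (g (x - z) - g x) ^ CARD('n)) \<partial>lborel) \<partial>lborel)"
      by (intro nn_integral_cong nn_integral_cmult) measurable
    also have "\<dots> \<le> (\<integral>\<^sup>+z. ennreal (?w z) * ennreal e \<partial>(lborel :: (real^'n) measure))"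
    proof (intro nn_integral_mono)
      fix z :: "real^'n"
      show "ennreal (?w z) * (\<integral>\<^sup>+x. ennreal (norm (g (x - z) - g x) ^ CARD('n)) \<partial>lborel) \<le> ennreal (?w z) * ennreal e"
      proof (cases "norm z < d")
        case True
        then show ?thesis by (intro mult_left_mono d) auto
      next
        case False
        then have "bump r z = 0" using r by (intro bump_eq_0(1)) auto
        then show ?thesis by simp
      qed
    qed
    also have "\<dots> = (\<integral>\<^sup>+z. (ennreal (1 / ?m) * ennreal e) * ennreal (bump r z) \<partial>(lborel :: (real^'n) measure))"
      using m(1) e by (intro nn_integral_cong) (simp add: bump_nonneg flip: ennreal_mult)
    also have "\<dots> = (ennreal (1 / ?m) * ennreal e) * ennreal ?m"
      using m(4) by (subst nn_integral_cmult) auto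
    also have "\<dots> = ennreal e" using m(1) e by (simp flip: ennreal_mult)
    finally show "(\<integral>\<^sup>+x. ennreal (norm (smooth_G r x - G x) ^ CARD('n)) * indicator (cball 0 R) x \<partial>lborel) \<le> ennreal e" .
  qed (use d in auto)
qed

theorem C1_approximation:
  assumes e: "e > 0"
  obtains g Dg where "\<And>x. (g has_derivative (\<lambda>v. Dg x *v v)) (at x)" "continuous_on UNIV Dg"
    "\<And>x i. x \<in> cball 0 R \<Longrightarrow> \<bar>g x $ i - f x $ i\<bar> \<le> e"
    "(\<integral>\<^sup>+x. ennreal (norm (Dg x - G x) ^ CARD('n)) * indicator (cball 0 R) x \<partial>lborel) \<le> ennreal e"
proof -
  obtain d1 where d1: "d1 > 0" "\<And>r. 0 < r \<Longrightarrow> r < d1 \<Longrightarrow>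
    (\<integral>\<^sup>+x. ennreal (norm (smooth_G r x - G x) ^ CARD('n)) * indicator (cball 0 R) x \<partial>lborel) \<le> ennreal e"
    using smooth_G_Lp_close[OF e, of R] by blast
  have "uniformly_continuous_on (cball 0 (R + 1)) f"
    by (intro compact_uniformly_continuous continuous_on_subset[OF cont_f]) auto
  then obtain d2 where d2: "d2 > 0" "\<And>x y. x \<in> cball 0 (R + 1) \<Longrightarrow> y \<in> cball 0 (R + 1) \<Longrightarrow> dist y x < d2 \<Longrightarrow> dist (f y) (f x) < e"
    using e unfolding uniformly_continuous_on_def by metis
  define r where "r = min (d1 / 2) (min d2 1)"
  have r: "0 < r" "r < d1" "r \<le> d2" "r \<le> 1" using d1 d2 by (auto simp: r_def)
  show ?thesis
  proof (rule that[of "smooth r" "smooth_G r"])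
    fix x :: "real^'n" and i assume x: "x \<in> cball 0 R"
    show "\<bar>smooth r x $ i - f x $ i\<bar> \<le> e"
    proof (rule smooth_close[OF r(1)])
      fix y assume y: "norm (x - y) < r"
      then have "y \<in> cball 0 (R + 1)" "x \<in> cball 0 (R + 1)"
        using x r norm_triangle_ineq2[of y x] by (auto simp: norm_minus_commute)
      then have "dist (f y) (f x) < e" using y r by (intro d2) (auto simp: dist_norm norm_minus_commute)
      then show "\<bar>f y $ i - f x $ i\<bar> \<le> e"
        using component_le_norm_cart[of "f y - f x" i] by (simp add: dist_norm)
    qed
  qed (use r d1 has_derivative_smooth continuous_on_smooth_G in auto)
qed

end

section \<open>Convergence of integrals of determinants and energies\<close>

lemma abs_prod_diff_le:
  fixes a b :: "'i \<Rightarrow> real"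
  assumes "finite S" "\<And>i. \<bar>a i\<bar> \<le> M" "\<And>i. \<bar>b i\<bar> \<le> M" "\<And>i. \<bar>a i - b i\<bar> \<le> d"
  shows "\<bar>(\<Prod>i\<in>S. a i) - (\<Prod>i\<in>S. b i)\<bar> \<le> real (card S) * d * M ^ (card S - 1)"
  using assms(1)
proof (induction S)
  case (insert x S)
  have "M \<ge> 0" using assms(2) abs_ge_zero order_trans by blast
  have "d \<ge> 0" using assms(4) abs_ge_zero order_trans by blast
  have pa: "\<bar>\<Prod>i\<in>S. a i\<bar> \<le> M ^ card S"
    unfolding abs_prod using prod_mono[of S "\<lambda>i. \<bar>a i\<bar>" "\<lambda>_. M"] assms(2) by simp
  have "a x * (\<Prod>i\<in>S. a i) - b x * (\<Prod>i\<in>S. b i) = (a x - b x) * (\<Prod>i\<in>S. a i) + b x * ((\<Prod>i\<in>S. a i) - (\<Prod>i\<in>S. b i))"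
    by (simp add: algebra_simps)
  then have "\<bar>a x * (\<Prod>i\<in>S. a i) - b x * (\<Prod>i\<in>S. b i)\<bar> \<le> \<bar>a x - b x\<bar> * \<bar>\<Prod>i\<in>S. a i\<bar> + \<bar>b x\<bar> * \<bar>(\<Prod>i\<in>S. a i) - (\<Prod>i\<in>S. b i)\<bar>"
    by (metis abs_mult abs_triangle_ineq)
  also have "\<dots> \<le> d * M ^ card S + M * (real (card S) * d * M ^ (card S - 1))"
    using assms pa insert \<open>M \<ge> 0\<close> \<open>d \<ge> 0\<close> by (intro add_mono mult_mono) auto
  also have "M * (real (card S) * d * M ^ (card S - 1)) = real (card S) * d * M ^ card S"
    by (cases "card S") auto
  finally show ?case using insert by (simp add: algebra_simps)
qed auto

lemma abs_det_diff_le: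
  fixes A B :: "real^'n^'n"
  shows "\<bar>det A - det B\<bar> \<le> fact (CARD('n)) * CARD('n) * norm (A - B) * (norm A + norm B) ^ (CARD('n) - 1)"
proof -
  let ?M = "norm A + norm B"
  have "\<bar>of_int (sign p) * (\<Prod>i\<in>UNIV. A $ i $ p i) - of_int (sign p) * (\<Prod>i\<in>UNIV. B $ i $ p i)\<bar> \<le> CARD('n) * norm (A - B) * ?M ^ (CARD('n) - 1)" for p
  proof -
    have "\<bar>A $ i $ p i\<bar> \<le> ?M" "\<bar>B $ i $ p i\<bar> \<le> ?M" "\<bar>A $ i $ p i - B $ i $ p i\<bar> \<le> norm (A - B)" for i
      using abs_entry_le_norm[of A i "p i"] abs_entry_le_norm[of B i "p i"] abs_entry_le_norm[of "A - B" i "p i"] norm_ge_zero[of A] norm_ge_zero[of B]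
      by auto
    then have "\<bar>(\<Prod>i\<in>UNIV. A $ i $ p i) - (\<Prod>i\<in>UNIV. B $ i $ p i)\<bar> \<le> CARD('n) * norm (A - B) * ?M ^ (CARD('n) - 1)"
      by (intro abs_prod_diff_le) auto
    then show ?thesis by (simp add: sign_def abs_minus_commute)
  qed
  then have "\<bar>det A - det B\<bar> \<le> (\<Sum>p | p permutes (UNIV :: 'n set). CARD('n) * norm (A - B) * ?M ^ (CARD('n) - 1))"
    unfolding det_def sum_subtractf[symmetric] by (intro order_trans[OF sum_abs] sum_mono) auto
  then show ?thesis by (simp add: card_permutations[OF refl finite] mult.assoc)
qed

lemma abs_power_norm_diff_le:
  fixes a b :: "'a::real_normed_vector"
  assumes "n \<ge> 1"
  shows "\<bar>norm a ^ n - norm b ^ n\<bar> \<le> real n * norm (a - b) * (norm a + norm b) ^ (n - 1)"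
proof -
  obtain k where k: "n = Suc k" using assms by (cases n) auto
  have *: "s ^ n - t ^ n \<le> real n * d * (s + t) ^ (n - 1)" if "0 \<le> s" "0 \<le> t" "s - t \<le> d" "0 \<le> d" for s t d :: real
  proof -
    have "s ^ n - t ^ n \<le> real n * s ^ (n - 1) * (s - t)"
      using power_tangent_le[OF that(1,2), of k] by (simp add: k algebra_simps)
    also have "\<dots> \<le> real n * s ^ (n - 1) * d" using that by (intro mult_left_mono) auto
    also have "\<dots> \<le> real n * (s + t) ^ (n - 1) * d" using that by (intro mult_right_mono mult_left_mono power_mono) auto
    finally show ?thesis by (simp add: mult_ac)
  qed
  show ?thesis
    using *[of "norm a" "norm b" "norm (a - b)"] *[of "norm b" "norm a" "norm (a - b)"]
      norm_triangle_ineq2[of a b] norm_triangle_ineq2[of b a] by (simp add: norm_minus_commute add.commute abs_le_iff)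
qed

text \<open>Young's inequality with a parameter, by applying the plain form to
  \<open>s / \<tau>\<close> and \<open>t\<close>: the power of \<open>t\<close> gets a small
  coefficient at the expense of that of \<open>s\<close>.\<close>

lemma mult_power_pred_le_scaled:
  fixes s t :: real
  assumes "0 \<le> s" "0 \<le> t" "n \<ge> 1" "\<tau> > 0"
  shows "s * t ^ (n - 1) \<le> s ^ n / \<tau> ^ (n - 1) + \<tau> * t ^ n"
proof -
  have "(s / \<tau>) * t ^ (n - 1) \<le> (s / \<tau>) ^ n + t ^ n"
    using assms by (intro mult_power_pred_le) auto
  then have "\<tau> * ((s / \<tau>) * t ^ (n - 1)) \<le> \<tau> * ((s / \<tau>) ^ n + t ^ n)"
    using assms by (intro mult_left_mono) auto
  moreover have "\<tau> * (s / \<tau>) ^ n = s ^ n / \<tau> ^ (n - 1)"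
    using assms by (cases n) (auto simp: power_divide field_simps)
  ultimately show ?thesis using assms by (simp add: algebra_simps)
qed

text \<open>The hypothesis on \<open>\<Phi>\<close> is the common property of the determinant and of
  the n-th power of the norm. The factor \<open>norm (D x) + norm (G x)\<close> is bounded through
  \<open>D x - G x\<close> and \<open>G x\<close>, so the fixed energy of \<open>G\<close> carries
  only the factor \<open>\<tau> * 4 ^ n\<close>, while the large coefficient falls on the error of
  approximation.\<close>

lemma integral_growth_diff_le:
  fixes \<Phi> :: "'v::euclidean_space \<Rightarrow> real" and D G :: "'a::euclidean_space \<Rightarrow> 'v"
  assumes n: "n \<ge> 1"
    and \<Phi>: "\<And>a b. \<bar>\<Phi> a - \<Phi> b\<bar> \<le> C * norm (a - b) * (norm a + norm b) ^ (n - 1)" "\<Phi> 0 = 0"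
    and [measurable]: "\<Phi> \<in> borel_measurable borel" "D \<in> borel_measurable borel" "G \<in> borel_measurable borel"
      "w \<in> borel_measurable borel" and w: "\<And>x. \<bar>w x\<bar> \<le> indicat_real S x" and S: "S \<in> sets borel"
    and int: "integrable lborel (\<lambda>x. indicat_real S x * norm (G x) ^ n)"
      "integrable lborel (\<lambda>x. indicat_real S x * norm (D x - G x) ^ n)"
    and \<tau>: "\<tau> > 0" and C: "C \<ge> 0"
  shows "integrable lborel (\<lambda>x. w x * \<Phi> (G x))" "integrable lborel (\<lambda>x. w x * \<Phi> (D x))"
    "\<bar>(LINT x|lborel. w x * \<Phi> (D x)) - (LINT x|lborel. w x * \<Phi> (G x))\<bar> \<le>
      C * ((1 / \<tau> ^ (n - 1) + \<tau> * 2 ^ n) * (LINT x|lborel. indicat_real S x * norm (D x - G x) ^ n) +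
       \<tau> * 4 ^ n * (LINT x|lborel. indicat_real S x * norm (G x) ^ n))"
proof -
  have bound: "\<bar>w x * \<Phi> (D x) - w x * \<Phi> (G x)\<bar> \<le> C * ((1 / \<tau> ^ (n - 1) + \<tau> * 2 ^ n) * (indicat_real S x * norm (D x - G x) ^ n) +
       \<tau> * 4 ^ n * (indicat_real S x * norm (G x) ^ n))" for x
  proof -
    let ?d = "norm (D x - G x)" and ?g = "norm (G x)"
    have "\<bar>w x * \<Phi> (D x) - w x * \<Phi> (G x)\<bar> = \<bar>w x\<bar> * \<bar>\<Phi> (D x) - \<Phi> (G x)\<bar>"
      by (simp add: abs_mult[symmetric] right_diff_distrib)
    also have "\<dots> \<le> indicat_real S x * (C * ?d * (norm (D x) + ?g) ^ (n - 1))"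
      using w \<Phi>(1) by (intro mult_mono) auto
    also have "\<dots> \<le> indicat_real S x * (C * ((1 / \<tau> ^ (n - 1) + \<tau> * 2 ^ n) * ?d ^ n + \<tau> * 4 ^ n * ?g ^ n))"
    proof (intro mult_left_mono)
      have "?d * (norm (D x) + ?g) ^ (n - 1) \<le> ?d ^ n / \<tau> ^ (n - 1) + \<tau> * (norm (D x) + ?g) ^ n"
        by (rule mult_power_pred_le_scaled) (use n \<tau> in auto)
      also have "(norm (D x) + ?g) ^ n \<le> (?d + 2 * ?g) ^ n"
        using norm_triangle_ineq2[of "D x" "G x"] by (intro power_mono) auto
      also have "\<dots> \<le> 2 ^ n * (?d ^ n + (2 * ?g) ^ n)" by (intro power_add_le) auto
      also have "\<dots> = 2 ^ n * ?d ^ n + 4 ^ n * ?g ^ n"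
      proof -
        have "(4::real) ^ n = 2 ^ n * 2 ^ n" by (simp flip: power_mult_distrib)
        then show ?thesis by (simp add: power_mult_distrib distrib_left)
      qed
      finally have "?d * (norm (D x) + ?g) ^ (n - 1) \<le> ?d ^ n / \<tau> ^ (n - 1) + \<tau> * (2 ^ n * ?d ^ n + 4 ^ n * ?g ^ n)"
        using \<tau> by (simp add: mult_left_mono)
      also have "\<dots> = (1 / \<tau> ^ (n - 1) + \<tau> * 2 ^ n) * ?d ^ n + \<tau> * 4 ^ n * ?g ^ n"
        by (simp add: algebra_simps)
      finally show "C * ?d * (norm (D x) + ?g) ^ (n - 1) \<le> C * ((1 / \<tau> ^ (n - 1) + \<tau> * 2 ^ n) * ?d ^ n + \<tau> * 4 ^ n * ?g ^ n)"
        using C by (simp add: mult.assoc mult_left_mono)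
    qed auto
    finally show ?thesis by (simp add: algebra_simps)
  qed
  show i1: "integrable lborel (\<lambda>x. w x * \<Phi> (G x))"
  proof (rule Bochner_Integration.integrable_bound)
    show "integrable lborel (\<lambda>x. C * (indicat_real S x * norm (G x) ^ n))" using int by simp
    show "AE x in lborel. norm (w x * \<Phi> (G x)) \<le> norm (C * (indicat_real S x * norm (G x) ^ n))"
    proof (intro AE_I2)
      fix x
      have "\<bar>\<Phi> (G x)\<bar> \<le> C * norm (G x) ^ n"
        using \<Phi>(1)[of "G x" 0] \<Phi>(2) n by (cases n) (auto simp: mult.assoc)
      then have "\<bar>w x\<bar> * \<bar>\<Phi> (G x)\<bar> \<le> indicat_real S x * (C * norm (G x) ^ n)" using w by (intro mult_mono) auto
      then show "norm (w x * \<Phi> (G x)) \<le> norm (C * (indicat_real S x * norm (G x) ^ n))"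
        using C by (simp add: abs_mult mult_ac)
    qed
  qed measurable
  have ib: "integrable lborel (\<lambda>x. C * ((1 / \<tau> ^ (n - 1) + \<tau> * 2 ^ n) * (indicat_real S x * norm (D x - G x) ^ n) +
       \<tau> * 4 ^ n * (indicat_real S x * norm (G x) ^ n)))"
    using int by (intro integrable_mult_right Bochner_Integration.integrable_add)
  have i2: "integrable lborel (\<lambda>x. w x * \<Phi> (D x) - w x * \<Phi> (G x))"
    by (rule Bochner_Integration.integrable_bound[OF ib]) (use bound in \<open>auto intro: order_trans[OF _ abs_ge_self]\<close>)
  from Bochner_Integration.integrable_add[OF i2 i1] show i3: "integrable lborel (\<lambda>x. w x * \<Phi> (D x))" by simp
  have "(LINT x|lborel. w x * \<Phi> (D x)) - (LINT x|lborel. w x * \<Phi> (G x)) = (LINT x|lborel. w x * \<Phi> (D x) - w x * \<Phi> (G x))"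
    using i1 i3 by simp
  also have "\<bar>\<dots>\<bar> \<le> (LINT x|lborel. C * ((1 / \<tau> ^ (n - 1) + \<tau> * 2 ^ n) * (indicat_real S x * norm (D x - G x) ^ n) +
       \<tau> * 4 ^ n * (indicat_real S x * norm (G x) ^ n)))"
    using integral_norm_bound_integral_or_zero[OF ib, of "\<lambda>x. w x * \<Phi> (D x) - w x * \<Phi> (G x)"] bound by simp
  also have "\<dots> = C * ((1 / \<tau> ^ (n - 1) + \<tau> * 2 ^ n) * (LINT x|lborel. indicat_real S x * norm (D x - G x) ^ n) +
       \<tau> * 4 ^ n * (LINT x|lborel. indicat_real S x * norm (G x) ^ n))"
    using int by simp
  finally show "\<bar>(LINT x|lborel. w x * \<Phi> (D x)) - (LINT x|lborel. w x * \<Phi> (G x))\<bar> \<le>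
      C * ((1 / \<tau> ^ (n - 1) + \<tau> * 2 ^ n) * (LINT x|lborel. indicat_real S x * norm (D x - G x) ^ n) +
       \<tau> * 4 ^ n * (LINT x|lborel. indicat_real S x * norm (G x) ^ n))" .
qed

lemma integral_growth_tendsto:
  fixes \<Phi> :: "'v::euclidean_space \<Rightarrow> real" and D :: "nat \<Rightarrow> 'a::euclidean_space \<Rightarrow> 'v"
  assumes n: "n \<ge> 1"
    and \<Phi>: "\<And>a b. \<bar>\<Phi> a - \<Phi> b\<bar> \<le> C * norm (a - b) * (norm a + norm b) ^ (n - 1)" "\<Phi> 0 = 0"
    and meas: "\<Phi> \<in> borel_measurable borel" "\<And>k. D k \<in> borel_measurable borel" "G \<in> borel_measurable borel"
      "w \<in> borel_measurable borel" and w: "\<And>x. \<bar>w x\<bar> \<le> indicat_real S x" and S: "S \<in> sets borel"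
    and int: "integrable lborel (\<lambda>x. indicat_real S x * norm (G x) ^ n)"
      "\<And>k. integrable lborel (\<lambda>x. indicat_real S x * norm (D k x - G x) ^ n)"
    and lim: "(\<lambda>k. LINT x|lborel. indicat_real S x * norm (D k x - G x) ^ n) \<longlonglongrightarrow> 0" and C: "C \<ge> 0"
  shows "(\<lambda>k. LINT x|lborel. w x * \<Phi> (D k x)) \<longlonglongrightarrow> (LINT x|lborel. w x * \<Phi> (G x))"
proof (rule LIMSEQ_I)
  fix e :: real assume e: "e > 0"
  define E where "E = (LINT x|lborel. indicat_real S x * norm (G x) ^ n)"
  have "E \<ge> 0" unfolding E_def by (intro integral_nonneg_AE) auto
  \<comment> \<open>Chosen before the index \<open>k\<close>, so small that the contribution of the
    energy \<open>E\<close> stays below \<open>e\<close>; the summand 1 avoids a division by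
    0.\<close>
  define \<tau> where "\<tau> = e / (2 * (C * 4 ^ n * E + 1))"
  have pos: "C * 4 ^ n * E + 1 > 0" using C \<open>E \<ge> 0\<close> by (intro add_nonneg_pos) auto
  have \<tau>: "\<tau> > 0" using e pos by (simp add: \<tau>_def)
  have half: "C * (\<tau> * 4 ^ n * E) < e"
  proof -
    have scaled: "X * (e / (2 * (X + 1))) < e" if "X + 1 > 0" for X :: real
    proof -
      have "X < 2 * (X + 1)" using that by (simp add: distrib_left)
      then have "e * X < e * (2 * (X + 1))" using e by (rule mult_strict_left_mono)
      then have "e * X / (2 * (X + 1)) < e" using that by (subst pos_divide_less_eq) auto
      then show ?thesis by (simp add: mult.commute)
    qed
    have "C * (\<tau> * 4 ^ n * E) = (C * 4 ^ n * E) * \<tau>" by (simp add: mult_ac)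
    also have "\<dots> < e" unfolding \<tau>_def by (rule scaled[OF pos])
    finally show ?thesis .
  qed
  let ?\<delta> = "\<lambda>k. LINT x|lborel. indicat_real S x * norm (D k x - G x) ^ n"
  have "(\<lambda>k. C * ((1 / \<tau> ^ (n - 1) + \<tau> * 2 ^ n) * ?\<delta> k + \<tau> * 4 ^ n * E)) \<longlonglongrightarrow> C * ((1 / \<tau> ^ (n - 1) + \<tau> * 2 ^ n) * 0 + \<tau> * 4 ^ n * E)"
    by (intro tendsto_intros lim)
  then have "\<forall>\<^sub>F k in sequentially. C * ((1 / \<tau> ^ (n - 1) + \<tau> * 2 ^ n) * ?\<delta> k + \<tau> * 4 ^ n * E) < e"
    using half by (intro order_tendstoD) auto
  then obtain N where N: "\<And>k. k \<ge> N \<Longrightarrow> C * ((1 / \<tau> ^ (n - 1) + \<tau> * 2 ^ n) * ?\<delta> k + \<tau> * 4 ^ n * E) < e"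
    unfolding eventually_sequentially by blast
  show "\<exists>N. \<forall>k\<ge>N. norm ((LINT x|lborel. w x * \<Phi> (D k x)) - (LINT x|lborel. w x * \<Phi> (G x))) < e"
  proof (intro exI[of _ N] allI impI)
    fix k assume "k \<ge> N"
    have "\<bar>(LINT x|lborel. w x * \<Phi> (D k x)) - (LINT x|lborel. w x * \<Phi> (G x))\<bar> \<le>
      C * ((1 / \<tau> ^ (n - 1) + \<tau> * 2 ^ n) * ?\<delta> k + \<tau> * 4 ^ n * E)"
      unfolding E_def by (rule integral_growth_diff_le(3)) (fact n \<Phi> meas w S int \<tau> C)+
    with N[OF \<open>k \<ge> N\<close>] show "norm ((LINT x|lborel. w x * \<Phi> (D k x)) - (LINT x|lborel. w x * \<Phi> (G x))) < e" by simp
  qed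
qed

context continuous_W1n
begin

lemma card_ge_1: "1 \<le> CARD('n)"
  by (simp add: Suc_leI)

lemma integrable_energy: "integrable lborel (\<lambda>x. indicat_real (cball 0 R) x * norm (G x) ^ CARD('n))"
proof (rule integrableI_bounded)
  have "(\<integral>\<^sup>+x. ennreal (norm (indicat_real (cball 0 R) x * norm (G x) ^ CARD('n))) \<partial>lborel)
     = (\<integral>\<^sup>+x. ennreal (norm (G x) ^ CARD('n)) * indicator (cball 0 R) x \<partial>lborel)"
    by (intro nn_integral_cong) (auto simp: indicator_def)
  then show "(\<integral>\<^sup>+x. ennreal (norm (indicat_real (cball 0 R) x * norm (G x) ^ CARD('n))) \<partial>lborel) < \<infinity>"
    using finite_energy by simp
qed measurable

lemma C1_approximating_sequence:
  obtains g Dg where "\<And>k x. (g k has_derivative (\<lambda>v. Dg k x *v v)) (at x)" "\<And>k. continuous_on UNIV (Dg k)"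
    "\<And>k x i. x \<in> cball 0 R \<Longrightarrow> \<bar>g k x $ i - f x $ i\<bar> \<le> 1 / real (Suc k)"
    "\<And>k. integrable lborel (\<lambda>x. indicat_real (cball 0 R) x * norm (Dg k x - G x) ^ CARD('n))"
    "(\<lambda>k. LINT x|lborel. indicat_real (cball 0 R) x * norm (Dg k x - G x) ^ CARD('n)) \<longlonglongrightarrow> 0"
proof -
  \<comment> \<open>All properties of the k-th approximant in one predicate, so that map and
    derivative can be chosen together for every \<open>k\<close>.\<close>
  define Q where "Q k g Dg \<longleftrightarrow> (\<forall>x. (g has_derivative (\<lambda>v. Dg x *v v)) (at x)) \<and> continuous_on UNIV Dg \<and>
    (\<forall>x i. x \<in> cball 0 R \<longrightarrow> \<bar>g x $ i - f x $ i\<bar> \<le> 1 / real (Suc k)) \<and>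
    (\<integral>\<^sup>+x. ennreal (norm (Dg x - G x) ^ CARD('n)) * indicator (cball 0 R) x \<partial>lborel) \<le> ennreal (1 / real (Suc k))"
    for k :: nat and g and Dg :: "real^'n \<Rightarrow> real^'n^'n"
  have "\<exists>g Dg. Q k g Dg" for k
  proof -
    have "1 / real (Suc k) > 0" by simp
    then obtain g Dg where "\<And>x. (g has_derivative (\<lambda>v. Dg x *v v)) (at x)" "continuous_on UNIV Dg"
      "\<And>x i. x \<in> cball 0 R \<Longrightarrow> \<bar>g x $ i - f x $ i\<bar> \<le> 1 / real (Suc k)"
      "(\<integral>\<^sup>+x. ennreal (norm (Dg x - G x) ^ CARD('n)) * indicator (cball 0 R) x \<partial>lborel) \<le> ennreal (1 / real (Suc k))"
      by (rule C1_approximation[of "1 / real (Suc k)" R]) blast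
    then have "Q k g Dg" unfolding Q_def by blast
    then show ?thesis by blast
  qed
  then obtain g Dg where Q: "\<And>k. Q k (g k) (Dg k)" by metis
  have g: "\<And>k x. (g k has_derivative (\<lambda>v. Dg k x *v v)) (at x)" "\<And>k. continuous_on UNIV (Dg k)"
    "\<And>k x i. x \<in> cball 0 R \<Longrightarrow> \<bar>g k x $ i - f x $ i\<bar> \<le> 1 / real (Suc k)"
    "\<And>k. (\<integral>\<^sup>+x. ennreal (norm (Dg k x - G x) ^ CARD('n)) * indicator (cball 0 R) x \<partial>lborel) \<le> ennreal (1 / real (Suc k))"
    using Q unfolding Q_def by blast+
  have [measurable]: "Dg k \<in> borel_measurable borel" for k
    by (intro borel_measurable_continuous_onI g)
  have nn: "(\<integral>\<^sup>+x. ennreal (indicat_real (cball 0 R) x * norm (Dg k x - G x) ^ CARD('n)) \<partial>lborel) \<le> ennreal (1 / real (Suc k))" for k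
  proof -
    have "(\<integral>\<^sup>+x. ennreal (indicat_real (cball 0 R) x * norm (Dg k x - G x) ^ CARD('n)) \<partial>lborel)
      = (\<integral>\<^sup>+x. ennreal (norm (Dg k x - G x) ^ CARD('n)) * indicator (cball 0 R) x \<partial>lborel)"
      by (intro nn_integral_cong) (auto simp: indicator_def)
    then show ?thesis using g(4) by simp
  qed
  have int: "integrable lborel (\<lambda>x. indicat_real (cball 0 R) x * norm (Dg k x - G x) ^ CARD('n))" for k
  proof (rule integrableI_bounded)
    have "(\<integral>\<^sup>+x. ennreal (norm (indicat_real (cball 0 R) x * norm (Dg k x - G x) ^ CARD('n))) \<partial>lborel) \<le> ennreal (1 / real (Suc k))"
      using nn[of k] by simp
    also have "\<dots> < \<infinity>" by simp
    finally show "(\<integral>\<^sup>+x. ennreal (norm (indicat_real (cball 0 R) x * norm (Dg k x - G x) ^ CARD('n))) \<partial>lborel) < \<infinity>" .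
  qed measurable
  have le: "(LINT x|lborel. indicat_real (cball 0 R) x * norm (Dg k x - G x) ^ CARD('n)) \<le> 1 / real (Suc k)" for k
  proof -
    have "ennreal (LINT x|lborel. indicat_real (cball 0 R) x * norm (Dg k x - G x) ^ CARD('n)) \<le> ennreal (1 / real (Suc k))"
      using nn[of k] by (subst nn_integral_eq_integral[symmetric, OF int]) auto
    then show ?thesis by (subst (asm) ennreal_le_iff) auto
  qed
  have "(\<lambda>k. LINT x|lborel. indicat_real (cball 0 R) x * norm (Dg k x - G x) ^ CARD('n)) \<longlonglongrightarrow> 0"
  proof (rule tendsto_sandwich[OF _ _ tendsto_const LIMSEQ_inverse_real_of_nat])
    show "\<forall>\<^sub>F k in sequentially. 0 \<le> (LINT x|lborel. indicat_real (cball 0 R) x * norm (Dg k x - G x) ^ CARD('n))"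
      by (intro always_eventually allI integral_nonneg_AE) auto
    show "\<forall>\<^sub>F k in sequentially. (LINT x|lborel. indicat_real (cball 0 R) x * norm (Dg k x - G x) ^ CARD('n)) \<le> inverse (real (Suc k))"
      using le by (intro always_eventually allI) (simp add: inverse_eq_divide)
  qed
  with g int show ?thesis using that by blast
qed

lemma compact_subset_cball_0:
  assumes "compact (S :: (real^'n) set)"
  obtains R where "S \<subseteq> cball 0 R"
  using bounded_subset_ballD[OF compact_imp_bounded[OF assms], of 0] ball_subset_cball by (metis order_trans)

text \<open>The weight \<open>w\<close> is later a cutoff function or the indicator of a subset of
  the ball; both cases are needed in passing from C1 maps to \<open>f\<close>.\<close>

lemma det_energy_tendsto:
  assumes "\<And>k. continuous_on UNIV (Dg k)"
    "\<And>k. integrable lborel (\<lambda>x. indicat_real (cball 0 R) x * norm (Dg k x - G x) ^ CARD('n))"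
    "(\<lambda>k. LINT x|lborel. indicat_real (cball 0 R) x * norm (Dg k x - G x) ^ CARD('n)) \<longlonglongrightarrow> 0"
    and w: "w \<in> borel_measurable borel" "\<And>x. \<bar>w x\<bar> \<le> indicat_real (cball 0 R) x"
  shows "(\<lambda>k. LINT x|lborel. w x * det (Dg k x)) \<longlonglongrightarrow> (LINT x|lborel. w x * det (G x))"
    and "(\<lambda>k. LINT x|lborel. w x * norm (Dg k x) ^ CARD('n)) \<longlonglongrightarrow> (LINT x|lborel. w x * norm (G x) ^ CARD('n))"
    and "integrable lborel (\<lambda>x. w x * det (G x))"
proof -
  have m: "Dg k \<in> borel_measurable borel" for k by (intro borel_measurable_continuous_onI assms)
  have d: "(det :: real^'n^'n \<Rightarrow> real) \<in> borel_measurable borel"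
    unfolding det_def by (intro borel_measurable_continuous_onI continuous_intros)
  have p: "(\<lambda>A :: real^'n^'n. norm A ^ CARD('n)) \<in> borel_measurable borel" by measurable
  have d0: "det (0 :: real^'n^'n) = 0"
    by (rule det_zero_row(1)[of undefined]) (simp add: row_def vec_eq_iff)
  show "(\<lambda>k. LINT x|lborel. w x * det (Dg k x)) \<longlonglongrightarrow> (LINT x|lborel. w x * det (G x))"
    by (rule integral_growth_tendsto[OF card_ge_1 abs_det_diff_le d0 d m meas_G w _ integrable_energy assms(2,3)]) auto
  show "(\<lambda>k. LINT x|lborel. w x * norm (Dg k x) ^ CARD('n)) \<longlonglongrightarrow> (LINT x|lborel. w x * norm (G x) ^ CARD('n))"
    by (rule integral_growth_tendsto[OF card_ge_1 abs_power_norm_diff_le[OF card_ge_1] _ p m meas_G w _ integrable_energy assms(2,3)]) auto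
  show "integrable lborel (\<lambda>x. w x * det (G x))"
    by (rule integral_growth_diff_le(1)[OF card_ge_1 abs_det_diff_le d0 d m meas_G w _ integrable_energy assms(2), of 1]) auto
qed

end

section \<open>Poincare inequalities\<close>

lemma borel_measurable_vec_component [measurable (raw)]:
  fixes f :: "'a \<Rightarrow> 'b::real_normed_vector^'n"
  assumes "f \<in> borel_measurable M"
  shows "(\<lambda>x. f x $ i) \<in> borel_measurable M"
  by (rule measurable_compose[OF assms borel_measurable_continuous_onI]) (intro continuous_intros)

text \<open>The increment is the integral of the derivative along the segment, and Jensen's
  inequality on the unit interval moves the power inside.\<close>

lemma C1_increment_power_le:
  fixes g :: "real^'n \<Rightarrow> real^'n"
  assumes g: "\<And>x. (g has_derivative (\<lambda>v. Dg x *v v)) (at x)" "continuous_on UNIV Dg"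
  shows "ennreal (\<bar>g (y + h) $ i - g y $ i\<bar> ^ Suc k) \<le>
    ennreal (norm h ^ Suc k) * (\<integral>\<^sup>+t. indicator {0..1} t * ennreal (norm (Dg (y + t *\<^sub>R h)) ^ Suc k) \<partial>lborel)"
proof -
  let ?p' = "\<lambda>t. (Dg (y + t *\<^sub>R h) *v h) $ i" and ?a = "\<lambda>t. norm (Dg (y + t *\<^sub>R h)) * norm h"
  have contD: "continuous_on A (\<lambda>t. Dg (y + t *\<^sub>R h))" for A :: "real set"
    by (intro continuous_on_compose2[OF g(2)] continuous_intros) auto
  have cont: "continuous_on A ?p'" for A :: "real set"
    unfolding matrix_vector_mult_def by (auto intro!: continuous_intros contD)
  have [measurable]: "(\<lambda>t. Dg (y + t *\<^sub>R h)) \<in> borel_measurable borel"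
    by (intro borel_measurable_continuous_onI contD)
  have "(LBINT t. indicator {0..1} t *\<^sub>R ?p' t) = g (y + 1 *\<^sub>R h) $ i - g (y + 0 *\<^sub>R h) $ i"
  proof (rule integral_FTC_atLeastAtMost[where F = "\<lambda>t. g (y + t *\<^sub>R h) $ i"])
    fix t :: real
    have "((\<lambda>t. y + t *\<^sub>R h) has_derivative (\<lambda>s. s *\<^sub>R h)) (at t within {0..1})"
      by (auto intro!: derivative_eq_intros)
    from has_derivative_compose[OF this g(1)]
    have "((\<lambda>t. g (y + t *\<^sub>R h)) has_derivative (\<lambda>s. Dg (y + t *\<^sub>R h) *v (s *\<^sub>R h))) (at t within {0..1})" .
    then have "((\<lambda>t. g (y + t *\<^sub>R h) $ i) has_derivative (\<lambda>s. (Dg (y + t *\<^sub>R h) *v (s *\<^sub>R h)) $ i)) (at t within {0..1})"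
      unfolding has_derivative_vec_iff by blast
    then show "((\<lambda>t. g (y + t *\<^sub>R h) $ i) has_vector_derivative ?p' t) (at t within {0..1})"
      unfolding has_vector_derivative_def by (simp add: matrix_vector_mult_scaleR)
  qed (use cont in auto)
  then have "ennreal \<bar>g (y + h) $ i - g y $ i\<bar> = ennreal (norm (LBINT t. indicator {0..1} t *\<^sub>R ?p' t))"
    by simp
  also have "\<dots> \<le> (\<integral>\<^sup>+t. ennreal (norm (indicator {0..1} t *\<^sub>R ?p' t)) \<partial>lborel)"
    by (intro integral_norm_bound_ennreal borel_integrable_compact cont) auto
  also have "\<dots> \<le> (\<integral>\<^sup>+t. ennreal (indicator {0..1} t * ?a t) \<partial>lborel)"
  proof (intro nn_integral_mono ennreal_leI)
    fix t
    have "\<bar>?p' t\<bar> \<le> ?a t"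
      using component_le_norm_cart norm_matrix_vector_mult_le order_trans by blast
    then show "norm (indicator {0..1} t *\<^sub>R ?p' t) \<le> indicator {0..1} t * ?a t"
      by (simp add: indicator_def)
  qed
  finally have "ennreal \<bar>g (y + h) $ i - g y $ i\<bar> ^ Suc k \<le> (\<integral>\<^sup>+t. ennreal (indicator {0..1} t * ?a t) \<partial>lborel) ^ Suc k"
    by (intro power_mono) auto
  also have "\<dots> \<le> (\<integral>\<^sup>+t. ennreal (indicator {0..1} t * ?a t ^ Suc k) \<partial>lborel)"
    by (rule nn_integral_power_le) (auto simp: ennreal_indicator)
  also have "\<dots> = (\<integral>\<^sup>+t. ennreal (norm h ^ Suc k) * (indicator {0..1} t * ennreal (norm (Dg (y + t *\<^sub>R h)) ^ Suc k)) \<partial>lborel)"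
    by (intro nn_integral_cong) (auto simp: indicator_def power_mult_distrib ennreal_mult mult_ac simp del: power_Suc)
  also have "\<dots> = ennreal (norm h ^ Suc k) * (\<integral>\<^sup>+t. indicator {0..1} t * ennreal (norm (Dg (y + t *\<^sub>R h)) ^ Suc k) \<partial>lborel)"
    by (intro nn_integral_cmult) measurable
  finally show ?thesis by (simp only: ennreal_power[OF abs_ge_zero])
qed

text \<open>By convexity the segment from \<open>y\<close> to \<open>y + h\<close> stays in
  \<open>S\<close>. After exchanging the integrals over \<open>y\<close> and over the segment
  parameter, translation invariance removes the shift, and each parameter contributes at most the
  energy on \<open>S\<close>.\<close>

lemma C1_translation_estimate:
  fixes g :: "real^'n \<Rightarrow> real^'n"
  assumes g: "\<And>x. (g has_derivative (\<lambda>v. Dg x *v v)) (at x)" "continuous_on UNIV Dg"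
    and S: "convex S" "S \<in> sets borel"
  shows "(\<integral>\<^sup>+y. indicator S y * indicator S (y + h) * ennreal (\<bar>g (y + h) $ i - g y $ i\<bar> ^ Suc k) \<partial>lborel) \<le>
    ennreal (norm h ^ Suc k) * (\<integral>\<^sup>+y. indicator S y * ennreal (norm (Dg y) ^ Suc k) \<partial>lborel)"
proof -
  note [measurable] = S(2)
  have [measurable]: "Dg \<in> borel_measurable borel" by (intro borel_measurable_continuous_onI g)
  let ?E = "\<lambda>y. indicator S y * ennreal (norm (Dg y) ^ Suc k) :: ennreal"
  have "(\<integral>\<^sup>+y. indicator S y * indicator S (y + h) * ennreal (\<bar>g (y + h) $ i - g y $ i\<bar> ^ Suc k) \<partial>lborel)
      \<le> (\<integral>\<^sup>+y. ennreal (norm h ^ Suc k) * (\<integral>\<^sup>+t. indicator {0..1} t * ?E (y + t *\<^sub>R h) \<partial>lborel) \<partial>lborel)"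
  proof (intro nn_integral_mono)
    fix y
    show "indicator S y * indicator S (y + h) * ennreal (\<bar>g (y + h) $ i - g y $ i\<bar> ^ Suc k)
      \<le> ennreal (norm h ^ Suc k) * (\<integral>\<^sup>+t. indicator {0..1} t * ?E (y + t *\<^sub>R h) \<partial>lborel)"
    proof (cases "y \<in> S \<and> y + h \<in> S")
      case True
      have "y + t *\<^sub>R h \<in> S" if "t \<in> {0..1}" for t
      proof -
        have "(1 - t) *\<^sub>R y + t *\<^sub>R (y + h) \<in> S" using S(1) True that by (intro convexD) auto
        then show ?thesis by (simp add: algebra_simps)
      qed
      then have "(\<integral>\<^sup>+t. indicator {0..1} t * ?E (y + t *\<^sub>R h) \<partial>lborel) = (\<integral>\<^sup>+t. indicator {0..1} t * ennreal (norm (Dg (y + t *\<^sub>R h)) ^ Suc k) \<partial>lborel)"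
        by (intro nn_integral_cong) (auto simp: indicator_def)
      then show ?thesis using C1_increment_power_le[OF g, of y h i k] True by simp
    qed auto
  qed
  also have "\<dots> = ennreal (norm h ^ Suc k) * (\<integral>\<^sup>+y. (\<integral>\<^sup>+t. indicator {0..1} t * ?E (y + t *\<^sub>R h) \<partial>lborel) \<partial>lborel)"
    by (intro nn_integral_cmult) measurable
  also have "(\<integral>\<^sup>+y. (\<integral>\<^sup>+t. indicator {0..1} t * ?E (y + t *\<^sub>R h) \<partial>lborel) \<partial>lborel)
      = (\<integral>\<^sup>+t. (\<integral>\<^sup>+y. indicator {0..1} t * ?E (y + t *\<^sub>R h) \<partial>lborel) \<partial>lborel)"
    by (rule lborel_pair.Fubini') measurable
  also have "\<dots> = (\<integral>\<^sup>+t. indicator {0..1::real} t * (\<integral>\<^sup>+y. ?E y \<partial>lborel) \<partial>lborel)"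
  proof (intro nn_integral_cong)
    fix t :: real
    have "(\<integral>\<^sup>+y. indicator {0..1} t * ?E (y + t *\<^sub>R h) \<partial>lborel) = indicator {0..1} t * (\<integral>\<^sup>+y. ?E (y + t *\<^sub>R h) \<partial>lborel)"
      by (intro nn_integral_cmult) measurable
    also have "(\<integral>\<^sup>+y. ?E (y + t *\<^sub>R h) \<partial>lborel) = (\<integral>\<^sup>+y. ?E y \<partial>lborel)"
      using nn_integral_lborel_shift[of ?E "t *\<^sub>R h"] by (simp add: add.commute)
    finally show "(\<integral>\<^sup>+y. indicator {0..1} t * ?E (y + t *\<^sub>R h) \<partial>lborel) = indicator {0..1} t * (\<integral>\<^sup>+y. ?E y \<partial>lborel)" .
  qed
  also have "\<dots> = (\<integral>\<^sup>+y. ?E y \<partial>lborel)"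
    by (simp add: nn_integral_multc)
  finally show ?thesis .
qed

lemma norm_diff_in_cube_le:
  fixes x y :: "real^'n" and r :: real
  assumes "x \<in> cube a r" "y \<in> cube a r"
  shows "x - y \<in> cube 0 (2 * r)" "norm (x - y) \<le> CARD('n) * (2 * r)"
proof -
  have *: "\<bar>(x - y) $ i\<bar> \<le> 2 * r" for i
  proof -
    have "\<bar>x $ i - a $ i\<bar> \<le> r" "\<bar>y $ i - a $ i\<bar> \<le> r" using assms by (auto simp: cube_def)
    then show ?thesis by simp
  qed
  then show "x - y \<in> cube 0 (2 * r)" by (simp add: cube_def)
  show "norm (x - y) \<le> CARD('n) * (2 * r)"
    using norm_le_l1_cart[of "x - y"] sum_mono[of UNIV "\<lambda>i. \<bar>(x - y) $ i\<bar>" "\<lambda>_. 2 * r"] * by simp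
qed

lemma emeasure_cube:
  fixes r :: real
  assumes r: "r \<ge> 0"
  shows "emeasure lborel (cube (a :: real^'n) r) = ennreal ((2 * r) ^ CARD('n))"
proof -
  have "\<forall>k\<in>Basis. (\<chi> j. a $ j - r) \<bullet> k \<le> (\<chi> j. a $ j + r) \<bullet> k"
    using r by (auto simp: Basis_vec_def inner_axis)
  then show ?thesis
    by (simp add: cube_eq_cbox emeasure_lborel_cbox_eq prod_Basis_vec inner_axis prod_ennreal)
qed

lemma measure_cube: "(r :: real) \<ge> 0 \<Longrightarrow> measure lborel (cube (a :: real^'n) r) = (2 * r) ^ CARD('n)"
  using emeasure_cube[of r a] by (simp add: measure_def)

context continuous_W1n
begin

definition energy :: "(real^'n) set \<Rightarrow> real" where
  "energy S = (LINT x|lborel. indicat_real S x * norm (G x) ^ CARD('n))"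

lemma integrable_energy_subset:
  assumes "bounded S" "S \<in> sets borel"
  shows "integrable lborel (\<lambda>x. indicat_real S x * norm (G x) ^ CARD('n))"
proof -
  obtain R where R: "S \<subseteq> cball 0 R"
    using bounded_subset_ballD[OF assms(1), of 0] ball_subset_cball by (metis order_trans)
  note [measurable] = assms(2)
  show ?thesis
  proof (rule Bochner_Integration.integrable_bound[OF integrable_energy[of R]])
    show "AE x in lborel. norm (indicat_real S x * norm (G x) ^ CARD('n)) \<le> norm (indicat_real (cball 0 R) x * norm (G x) ^ CARD('n))"
      using R by (intro AE_I2) (auto simp: indicator_def)
  qed measurable
qed

lemma energy_nonneg: "0 \<le> energy S"
  unfolding energy_def by (intro integral_nonneg_AE) auto

lemma energy_mono:
  assumes "S \<subseteq> T" "bounded T" "S \<in> sets borel" "T \<in> sets borel"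
  shows "energy S \<le> energy T"
  unfolding energy_def
  using assms by (intro integral_mono integrable_energy_subset bounded_subset[OF assms(2)]) (auto simp: indicator_def)

text \<open>The C1 estimate passes to the limit: Fatou's lemma and pointwise convergence on the
  left, convergence of the energies on the right.\<close>

lemma translation_estimate:
  assumes S: "convex S" "bounded S" "S \<in> sets borel"
  shows "(\<integral>\<^sup>+y. indicator S y * indicator S (y + h) * ennreal (\<bar>f (y + h) $ i - f y $ i\<bar> ^ CARD('n)) \<partial>lborel) \<le>
    ennreal (norm h ^ CARD('n) * energy S)"
proof -
  obtain R where R: "S \<subseteq> cball 0 R"
    using bounded_subset_ballD[OF S(2), of 0] ball_subset_cball by (metis order_trans)
  obtain g Dg where g: "\<And>k x. (g k has_derivative (\<lambda>v. Dg k x *v v)) (at x)" "\<And>k. continuous_on UNIV (Dg k)"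
    "\<And>k x i. x \<in> cball 0 R \<Longrightarrow> \<bar>g k x $ i - f x $ i\<bar> \<le> 1 / real (Suc k)"
    "\<And>k. integrable lborel (\<lambda>x. indicat_real (cball 0 R) x * norm (Dg k x - G x) ^ CARD('n))"
    "(\<lambda>k. LINT x|lborel. indicat_real (cball 0 R) x * norm (Dg k x - G x) ^ CARD('n)) \<longlonglongrightarrow> 0"
    using C1_approximating_sequence[of R] by blast
  note [measurable] = S(3)
  have cont_g: "continuous_on UNIV (g k)" for k
    using has_derivative_continuous[OF g(1)] by (auto simp: continuous_on_eq_continuous_at)
  have [measurable]: "g k \<in> borel_measurable borel" "Dg k \<in> borel_measurable borel" for k
    by (intro borel_measurable_continuous_onI cont_g g)+
  obtain m where m: "CARD('n) = Suc m" using card_ge_1 by (cases "CARD('n)") auto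
  define J where "J k = (LINT x|lborel. indicat_real S x * norm (Dg k x) ^ CARD('n))" for k
  have J: "J \<longlonglongrightarrow> energy S"
    unfolding J_def energy_def by (rule det_energy_tendsto(2)[OF g(2,4,5)]) (use R in \<open>auto simp: indicator_def\<close>)
  have nnJ: "(\<integral>\<^sup>+y. indicator S y * ennreal (norm (Dg k y) ^ CARD('n)) \<partial>lborel) = ennreal (J k)" for k
  proof -
    have "integrable lborel (\<lambda>x. indicat_real (cball 0 R) x *\<^sub>R norm (Dg k x) ^ CARD('n))"
      by (intro borel_integrable_compact continuous_intros continuous_on_subset[OF g(2)]) auto
    then have "integrable lborel (\<lambda>x. indicat_real S x * norm (Dg k x) ^ CARD('n))"
      by (rule Bochner_Integration.integrable_bound) (use R in \<open>auto simp: indicator_def intro!: AE_I2\<close>)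
    then have "(\<integral>\<^sup>+y. ennreal (indicat_real S y * norm (Dg k y) ^ CARD('n)) \<partial>lborel) = ennreal (J k)"
      unfolding J_def by (intro nn_integral_eq_integral) auto
    moreover have "(\<integral>\<^sup>+y. ennreal (indicat_real S y * norm (Dg k y) ^ CARD('n)) \<partial>lborel) = (\<integral>\<^sup>+y. indicator S y * ennreal (norm (Dg k y) ^ CARD('n)) \<partial>lborel)"
      by (intro nn_integral_cong) (auto simp: indicator_def)
    ultimately show ?thesis by simp
  qed
  let ?u = "\<lambda>k y. indicator S y * indicator S (y + h) * ennreal (\<bar>g k (y + h) $ i - g k y $ i\<bar> ^ CARD('n)) :: ennreal"
  have lim: "(\<lambda>k. ?u k y) \<longlonglongrightarrow> indicator S y * indicator S (y + h) * ennreal (\<bar>f (y + h) $ i - f y $ i\<bar> ^ CARD('n))" for y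
  proof (cases "y \<in> S \<and> y + h \<in> S")
    case True
    have comp: "(\<lambda>k. g k x $ i) \<longlonglongrightarrow> f x $ i" if "x \<in> S" for x
    proof (rule LIM_zero_cancel, rule Lim_null_comparison[OF _ LIMSEQ_inverse_real_of_nat])
      show "\<forall>\<^sub>F k in sequentially. norm (g k x $ i - f x $ i) \<le> inverse (real (Suc k))"
        using g(3)[of x _ i] that R by (intro always_eventually) (auto simp: inverse_eq_divide)
    qed
    have "(\<lambda>k. ennreal (\<bar>g k (y + h) $ i - g k y $ i\<bar> ^ CARD('n))) \<longlonglongrightarrow> ennreal (\<bar>f (y + h) $ i - f y $ i\<bar> ^ CARD('n))"
      using True by (intro tendsto_ennrealI tendsto_power tendsto_rabs tendsto_diff comp) auto
    then show ?thesis using True by simp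
  qed auto
  have "(\<integral>\<^sup>+y. indicator S y * indicator S (y + h) * ennreal (\<bar>f (y + h) $ i - f y $ i\<bar> ^ CARD('n)) \<partial>lborel)
      = (\<integral>\<^sup>+y. liminf (\<lambda>k. ?u k y) \<partial>lborel)"
    by (intro nn_integral_cong lim_imp_Liminf[symmetric] lim) auto
  also have "\<dots> \<le> liminf (\<lambda>k. \<integral>\<^sup>+y. ?u k y \<partial>lborel)"
    by (rule nn_integral_liminf) measurable
  also have "\<dots> \<le> liminf (\<lambda>k. ennreal (norm h ^ CARD('n) * J k))"
  proof (intro Liminf_mono always_eventually allI)
    fix k
    have "(\<integral>\<^sup>+y. ?u k y \<partial>lborel) \<le> ennreal (norm h ^ CARD('n)) * ennreal (J k)"
      using C1_translation_estimate[OF g(1)[of k] g(2)[of k] S(1,3), where h = h and i = i and k = m] unfolding m[symmetric] nnJ .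
    also have "\<dots> = ennreal (norm h ^ CARD('n) * J k)"
      by (intro ennreal_mult[symmetric]) (auto simp: J_def intro!: integral_nonneg_AE)
    finally show "(\<integral>\<^sup>+y. ?u k y \<partial>lborel) \<le> ennreal (norm h ^ CARD('n) * J k)" .
  qed
  also have "\<dots> = ennreal (norm h ^ CARD('n) * energy S)"
    by (intro lim_imp_Liminf tendsto_ennrealI tendsto_intros J) auto
  finally show ?thesis .
qed

text \<open>
  The centre \<open>f y\<close> is chosen to minimise the left-hand side, which is therefore at most its average
  over \<open>y \<in> S\<close>; that average is estimated by integrating the translation estimate over all increments.
\<close>

lemma poincare_cbox:
  fixes a :: "real^'n" and r :: real
  assumes r: "r > 0" and S: "S = cbox l v" "S \<subseteq> cube a (2 * r)" "r ^ CARD('n) \<le> measure lborel S"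
  obtains y where "y \<in> S"
    "(LINT x|lborel. indicat_real S x * \<bar>f x $ i - f y $ i\<bar> ^ CARD('n)) \<le> (32 * CARD('n)) ^ CARD('n) * r ^ CARD('n) * energy S"
proof -
  let ?n = "CARD('n)"
  have rn: "r ^ ?n > 0" using r by simp
  have S': "convex S" "bounded S" "S \<in> sets borel" "compact S" using S(1) by auto
  note [measurable] = S'(3)
  have "S \<noteq> {}" using S(3) rn by (auto simp: less_le_not_le)
  have [measurable]: "f \<in> borel_measurable borel" by (intro borel_measurable_continuous_onI cont_f)
  define F where "F y = (LINT x|lborel. indicat_real S x * \<bar>f x $ i - f y $ i\<bar> ^ ?n)" for y
  have intF: "integrable lborel (\<lambda>x. indicat_real S x * \<bar>f x $ i - f y $ i\<bar> ^ ?n)" for y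
  proof -
    have "integrable lborel (\<lambda>x. indicat_real S x *\<^sub>R \<bar>f x $ i - f y $ i\<bar> ^ ?n)"
      by (intro borel_integrable_compact S' continuous_intros continuous_on_subset[OF cont_f]) auto
    then show ?thesis by simp
  qed
  have F_eq: "F y = integral (cbox l v) (\<lambda>x. \<bar>f x $ i - f y $ i\<bar> ^ ?n)" for y
    using set_borel_integral_eq_integral(2)[of S "\<lambda>x. \<bar>f x $ i - f y $ i\<bar> ^ ?n"] intF[of y] S(1)
    unfolding F_def set_integrable_def set_lebesgue_integral_def by simp
  have "continuous_on UNIV F"
    unfolding F_eq[abs_def]
    by (intro integral_continuous_on_param)
      (auto simp: split_beta intro!: continuous_intros continuous_on_compose2[OF cont_f])
  then obtain y where y: "y \<in> S" "\<And>z. z \<in> S \<Longrightarrow> F y \<le> F z"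
    using continuous_attains_inf[OF S'(4) \<open>S \<noteq> {}\<close>] continuous_on_subset[of UNIV F S] by blast
  have F0: "F y \<ge> 0" unfolding F_def by (intro integral_nonneg_AE) auto
  let ?q = "\<lambda>x y. indicator S y * indicator S x * ennreal (\<bar>f x $ i - f y $ i\<bar> ^ ?n) :: ennreal"
  have nnF: "indicator S z * ennreal (F z) = (\<integral>\<^sup>+x. ?q x z \<partial>lborel)" for z
  proof -
    have "ennreal (F z) = (\<integral>\<^sup>+x. ennreal (indicat_real S x * \<bar>f x $ i - f z $ i\<bar> ^ ?n) \<partial>lborel)"
      unfolding F_def by (intro nn_integral_eq_integral[symmetric] intF) auto
    then have "indicator S z * ennreal (F z) = (\<integral>\<^sup>+x. indicator S z * ennreal (indicat_real S x * \<bar>f x $ i - f z $ i\<bar> ^ ?n) \<partial>lborel)"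
      by (simp add: nn_integral_cmult)
    also have "\<dots> = (\<integral>\<^sup>+x. ?q x z \<partial>lborel)"
      by (intro nn_integral_cong) (auto simp: indicator_def)
    finally show ?thesis .
  qed
  \<comment> \<open>Increments between points of the cube of half-side \<open>2 * r\<close> lie in
    the cube of half-side \<open>4 * r\<close>: their norm is at most n times \<open>4 * r\<close>,
    hence \<open>D\<close>, and they fill a volume of at most \<open>8 * r\<close> to the power n.
    The constant 32 is 4 * 8.\<close>
  define D where "D = (?n * (4 * r)) ^ ?n"
  have D0: "D \<ge> 0" using r by (simp add: D_def)
  have "ennreal (r ^ ?n * F y) \<le> ennreal (F y) * emeasure lborel S"
  proof -
    have "emeasure lborel S = ennreal (measure lborel S)"
      using emeasure_bounded_finite[OF S'(2)] by (intro emeasure_eq_ennreal_measure) auto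
    then have "ennreal (F y) * emeasure lborel S = ennreal (F y * measure lborel S)"
      using F0 by (simp add: ennreal_mult)
    then show ?thesis using mult_left_mono[OF S(3) F0] by (simp add: mult.commute ennreal_leI)
  qed
  also have "\<dots> = (\<integral>\<^sup>+z. ennreal (F y) * indicator S z \<partial>lborel)"
    by (simp add: nn_integral_cmult_indicator)
  also have "\<dots> \<le> (\<integral>\<^sup>+z. indicator S z * ennreal (F z) \<partial>lborel)"
    using y(2) by (intro nn_integral_mono) (auto simp: indicator_def ennreal_leI)
  also have "\<dots> = (\<integral>\<^sup>+z. (\<integral>\<^sup>+x. ?q x z \<partial>lborel) \<partial>lborel)"
    by (simp only: nnF)
  also have "\<dots> = (\<integral>\<^sup>+z. (\<integral>\<^sup>+h. ?q (z + h) z \<partial>lborel) \<partial>lborel)"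
    by (intro nn_integral_cong nn_integral_lborel_shift[symmetric]) measurable
  also have "\<dots> = (\<integral>\<^sup>+h. (\<integral>\<^sup>+z. ?q (z + h) z \<partial>lborel) \<partial>lborel)"
    by (rule lborel_pair.Fubini') measurable
  also have "\<dots> \<le> (\<integral>\<^sup>+h. ennreal (D * energy S) * indicator (cube 0 (4 * r)) h \<partial>(lborel :: (real^'n) measure))"
  proof (intro nn_integral_mono)
    fix h :: "real^'n"
    show "(\<integral>\<^sup>+z. ?q (z + h) z \<partial>lborel) \<le> ennreal (D * energy S) * indicator (cube 0 (4 * r)) h"
    proof (cases "\<exists>z. z \<in> S \<and> z + h \<in> S")
      case True
      then obtain z where z: "z \<in> cube a (2 * r)" "z + h \<in> cube a (2 * r)" using S(2) by auto
      have h: "h \<in> cube 0 (4 * r)" "norm h \<le> ?n * (4 * r)"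
        using norm_diff_in_cube_le[OF z(2,1)] by simp_all
      have "(\<integral>\<^sup>+z. ?q (z + h) z \<partial>lborel) \<le> ennreal (norm h ^ ?n * energy S)"
        by (rule translation_estimate) (use S' in auto)
      also have "\<dots> \<le> ennreal (D * energy S)"
        unfolding D_def using h(2) by (intro ennreal_leI mult_right_mono power_mono energy_nonneg) auto
      finally show ?thesis using h(1) by simp
    next
      case False
      then have "(\<integral>\<^sup>+z. ?q (z + h) z \<partial>lborel) = (\<integral>\<^sup>+z. 0 \<partial>(lborel :: (real^'n) measure))"
        by (intro nn_integral_cong) (auto simp: indicator_def)
      then show ?thesis by simp
    qed
  qed
  also have "\<dots> = ennreal (D * energy S) * ennreal ((2 * (4 * r)) ^ ?n)"
    using r by (simp add: nn_integral_cmult_indicator emeasure_cube borel_closed compact_imp_closed)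
  also have "\<dots> = ennreal (D * energy S * (2 * (4 * r)) ^ ?n)"
    using D0 energy_nonneg r by (intro ennreal_mult[symmetric]) auto
  finally have "r ^ ?n * F y \<le> D * energy S * (2 * (4 * r)) ^ ?n"
    using D0 energy_nonneg r by (subst (asm) ennreal_le_iff) auto
  also have "\<dots> = r ^ ?n * ((32 * ?n) ^ ?n * r ^ ?n * energy S)"
  proof -
    have "(32::real) ^ ?n = 4 ^ ?n * 8 ^ ?n" by (simp flip: power_mult_distrib)
    then show ?thesis by (simp add: D_def power_mult_distrib mult_ac)
  qed
  finally have "F y \<le> (32 * ?n) ^ ?n * r ^ ?n * energy S"
    using rn by simp
  then show ?thesis using y(1) that unfolding F_def by blast
qed

lemma integrable_power_component:
  assumes "compact S"
  shows "integrable lborel (\<lambda>x. indicat_real S x * \<bar>f x $ i - c\<bar> ^ k)"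
proof -
  have "integrable lborel (\<lambda>x. indicat_real S x *\<^sub>R \<bar>f x $ i - c\<bar> ^ k)"
    by (intro borel_integrable_compact assms continuous_intros continuous_on_subset[OF cont_f]) auto
  then show ?thesis by simp
qed

lemma integrable_indicator_compact: "compact S \<Longrightarrow> integrable lborel (indicat_real (S :: (real^'n) set))"
  using borel_integrable_compact[of S "\<lambda>_. 1 :: real"] by simp

text \<open>Two constants that approximate the same function on sets with a substantial intersection
  must be close: their difference is integrated over the intersection and split at the value of
  \<open>f\<close>.\<close>

lemma power_diff_le_overlap:
  fixes c d m :: real
  assumes S: "compact S" "compact T" "m \<le> measure lborel (S \<inter> T)"
    and X: "(LINT x|lborel. indicat_real S x * \<bar>f x $ i - c\<bar> ^ k) \<le> X"
    and Y: "(LINT x|lborel. indicat_real T x * \<bar>f x $ i - d\<bar> ^ k) \<le> Y"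
  shows "m * \<bar>c - d\<bar> ^ k \<le> 2 ^ k * (X + Y)"
proof -
  have "m * \<bar>c - d\<bar> ^ k \<le> measure lborel (S \<inter> T) * \<bar>c - d\<bar> ^ k"
    using S(3) by (intro mult_right_mono) auto
  also have "\<dots> = (LINT x|lborel. indicat_real (S \<inter> T) x * \<bar>c - d\<bar> ^ k)"
    using integrable_indicator_compact[OF compact_Int[OF S(1,2)]] by simp
  also have "\<dots> \<le> (LINT x|lborel. 2 ^ k * (indicat_real S x * \<bar>f x $ i - c\<bar> ^ k + indicat_real T x * \<bar>f x $ i - d\<bar> ^ k))"
  proof (intro integral_mono integrable_mult_right Bochner_Integration.integrable_add integrable_power_component S)
    show "integrable lborel (\<lambda>x. indicat_real (S \<inter> T) x * \<bar>c - d\<bar> ^ k)"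
      using integrable_indicator_compact[OF compact_Int[OF S(1,2)]] by simp
    fix x
    show "indicat_real (S \<inter> T) x * \<bar>c - d\<bar> ^ k \<le> 2 ^ k * (indicat_real S x * \<bar>f x $ i - c\<bar> ^ k + indicat_real T x * \<bar>f x $ i - d\<bar> ^ k)"
    proof (cases "x \<in> S \<inter> T")
      case True
      have "\<bar>c - d\<bar> ^ k \<le> 2 ^ k * (\<bar>c - f x $ i\<bar> ^ k + \<bar>f x $ i - d\<bar> ^ k)"
        using norm_add_power_le[of "c - f x $ i" "f x $ i - d" k] by simp
      then show ?thesis using True by (simp add: abs_minus_commute)
    next
      case False
      then show ?thesis by (auto simp: indicator_def)
    qed
  qed
  also have "\<dots> = 2 ^ k * ((LINT x|lborel. indicat_real S x * \<bar>f x $ i - c\<bar> ^ k) + (LINT x|lborel. indicat_real T x * \<bar>f x $ i - d\<bar> ^ k))"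
    by (simp add: integrable_power_component S)
  also have "\<dots> \<le> 2 ^ k * (X + Y)" using X Y by simp
  finally show ?thesis .
qed

text \<open>Changing the centre from \<open>d\<close> to \<open>c\<close> costs the distance of the
  centres times the volume; used to bring all pieces of the annulus to one common centre.\<close>

lemma integral_power_recentre_le:
  fixes c d m :: real
  assumes T: "compact T" "measure lborel T \<le> m"
    and Y: "(LINT x|lborel. indicat_real T x * \<bar>f x $ i - d\<bar> ^ k) \<le> Y"
  shows "(LINT x|lborel. indicat_real T x * \<bar>f x $ i - c\<bar> ^ k) \<le> 2 ^ k * (Y + m * \<bar>d - c\<bar> ^ k)"
proof -
  have "(LINT x|lborel. indicat_real T x * \<bar>f x $ i - c\<bar> ^ k) \<le> (LINT x|lborel. 2 ^ k * (indicat_real T x * \<bar>f x $ i - d\<bar> ^ k + indicat_real T x * \<bar>d - c\<bar> ^ k))"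
  proof (intro integral_mono integrable_mult_right Bochner_Integration.integrable_add integrable_power_component T)
    show "integrable lborel (\<lambda>x. indicat_real T x * \<bar>d - c\<bar> ^ k)"
      using integrable_indicator_compact[OF T(1)] by simp
    fix x
    show "indicat_real T x * \<bar>f x $ i - c\<bar> ^ k \<le> 2 ^ k * (indicat_real T x * \<bar>f x $ i - d\<bar> ^ k + indicat_real T x * \<bar>d - c\<bar> ^ k)"
      using norm_add_power_le[of "f x $ i - d" "d - c" k] by (simp add: indicator_def)
  qed
  also have "\<dots> = 2 ^ k * ((LINT x|lborel. indicat_real T x * \<bar>f x $ i - d\<bar> ^ k) + measure lborel T * \<bar>d - c\<bar> ^ k)"
    using integrable_indicator_compact[OF T(1)] by (simp add: integrable_power_component T)
  also have "\<dots> \<le> 2 ^ k * (Y + m * \<bar>d - c\<bar> ^ k)"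
    using Y T(2) by (intro mult_left_mono add_mono mult_right_mono) auto
  finally show ?thesis .
qed

end

text \<open>One box for each face of the cube; the Boolean selects the side.\<close>

definition slab :: "real^'n \<Rightarrow> real \<Rightarrow> 'n \<times> bool \<Rightarrow> (real^'n) set" where
  "slab a r = (\<lambda>(i, s). {x \<in> cube a (2 * r). if s then r \<le> x $ i - a $ i else r \<le> a $ i - x $ i})"

lemma annulus_eq_Union_slab: "annulus a r = (\<Union>p. slab a r p)"
proof (rule set_eqI)
  fix x
  have "r \<le> \<bar>x $ i - a $ i\<bar> \<longleftrightarrow> (\<exists>s. if s then r \<le> x $ i - a $ i else r \<le> a $ i - x $ i)" for i
    by (auto simp: ex_bool_eq)
  then show "x \<in> annulus a r \<longleftrightarrow> x \<in> (\<Union>p. slab a r p)"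
    unfolding annulus_def slab_def by auto
qed

lemma slab_eq_cbox:
  "r > 0 \<Longrightarrow> slab a r (i, s) = cbox (\<chi> j. if j = i \<and> s then a $ j + r else a $ j - 2 * r)
     (\<chi> j. if j = i \<and> \<not> s then a $ j - r else a $ j + 2 * r)"
  unfolding slab_def cube_def by (auto simp: mem_box_cart abs_le_iff algebra_simps split: if_splits) (smt (verit))+

lemma slab_subset: "slab a r p \<subseteq> cube a (2 * r)" "slab a r p \<subseteq> annulus a r"
  using annulus_eq_Union_slab[of a r] by (auto simp: slab_def split: prod.splits)

lemma compact_slab: "r > 0 \<Longrightarrow> compact (slab a r p)"
  by (cases p) (simp add: slab_eq_cbox)

text \<open>The intersection contains the cube of half-side \<open>r / 2\<close> around
  \<open>p\<close>, whose coordinates sit in the middle, at distance \<open>3 * r / 2\<close>, of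
  the chosen sides. Opposite faces are excluded because their slabs are disjoint; equal indices give
  the volume of a single slab.\<close>

lemma measure_slab_Int_slab_ge:
  fixes a :: "real^'n" and r :: real
  assumes r: "r > 0" and ij: "i \<noteq> j \<or> s = t"
  shows "r ^ CARD('n) \<le> measure lborel (slab a r (i, s) \<inter> slab a r (j, t))"
proof -
  define p where "p = (\<chi> k. a $ k + (if k = i then if s then 3 * r / 2 else - 3 * r / 2 else
    if k = j then if t then 3 * r / 2 else - 3 * r / 2 else 0))"
  have "cube p (r / 2) \<subseteq> slab a r (i, s) \<inter> slab a r (j, t)"
  proof
    fix x assume xp: "x \<in> cube p (r / 2)"
    have x: "x $ k - p $ k \<le> r / 2 \<and> p $ k - x $ k \<le> r / 2" for k
    proof -
      have "\<bar>x $ k - p $ k\<bar> \<le> r / 2" using xp unfolding cube_def by blast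
      then show ?thesis by (simp only: abs_le_iff minus_diff_eq)
    qed
    have "\<bar>x $ k - a $ k\<bar> \<le> 2 * r" for k
      by (rule abs_leI; use x[of k] r in \<open>simp add: p_def split: if_splits; linarith\<close>)
    moreover have "if s then r \<le> x $ i - a $ i else r \<le> a $ i - x $ i"
      using x[of i] r by (simp add: p_def split: if_splits; linarith)
    moreover have "if t then r \<le> x $ j - a $ j else r \<le> a $ j - x $ j"
      using x[of j] r ij by (cases "i = j"; simp add: p_def split: if_splits; linarith)
    ultimately show "x \<in> slab a r (i, s) \<inter> slab a r (j, t)" by (simp add: slab_def cube_def)
  qed
  then have "measure lborel (cube p (r / 2)) \<le> measure lborel (slab a r (i, s) \<inter> slab a r (j, t))"
    using compact_slab[OF r]
    by (intro measure_mono_fmeasurable fmeasurable_compact compact_Int) (auto intro: borel_compact)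
  then show ?thesis using r measure_cube[of "r / 2" p] by simp
qed

lemma measure_slab_le:
  fixes a :: "real^'n" and r :: real
  assumes r: "r > 0"
  shows "measure lborel (slab a r p) \<le> (4 * r) ^ CARD('n)"
proof -
  have "measure lborel (slab a r p) \<le> measure lborel (cube a (2 * r))"
    using slab_subset(1) borel_compact[OF compact_slab[OF r]]
    by (intro measure_mono_fmeasurable fmeasurable_compact) simp_all
  then show ?thesis using r measure_cube[of "2 * r" a] by simp
qed

section \<open>Energy decay and Hoelder continuity\<close>

context continuous_W1n
begin

text \<open>Each slab is a box and has its own centre by the box inequality. Slabs of different axes
  overlap enough for their centres to be compared; the two slabs of one axis are compared through a
  slab of another axis. All slabs are then recentred and summed.\<close>

lemma annulus_poincare:
  assumes n2: "CARD('n) \<ge> 2"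
  obtains C where "C \<ge> 0"
    "\<And>a r i. r > 0 \<Longrightarrow> \<exists>b. (LINT x|lborel. indicat_real (annulus a r) x * \<bar>f x $ i - b\<bar> ^ CARD('n))
      \<le> C * r ^ CARD('n) * energy (annulus a r)"
proof -
  let ?n = "CARD('n)"
  define CP :: real where "CP = (32 * ?n) ^ ?n"
  \<comment> \<open>Number of slabs times the recentred bound on one slab: its own Poincare term and
    the slab volume \<open>(4 * r) ^ n\<close> times the distance of centres after at most two
    comparisons, with \<open>r ^ n\<close> and the energy factored out.\<close>
  define C where "C = CARD('n \<times> bool) * (2 ^ ?n * (CP + 4 ^ ?n * (2 ^ ?n * (2 * (2 ^ ?n * 2 * CP)))))"
  have CP: "CP \<ge> 0" by (simp add: CP_def)
  \<comment> \<open>This is where dimension at least 2 enters: in dimension one the annulus consists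
    of two separate intervals and the inequality fails.\<close>
  obtain j1 j2 :: 'n where j12: "j1 \<noteq> j2"
    using n2 by (metis (full_types) UNIV_I card_2_iff' card_le_Suc0_iff_eq finite not_less_eq_eq numeral_2_eq_2)
  show ?thesis
  proof (rule that[of C])
    show "C \<ge> 0" using CP by (simp add: C_def)
    fix a :: "real^'n" and r :: real and i :: 'n assume r: "r > 0"
    define E where "E = energy (annulus a r)"
    have E: "E \<ge> 0" by (simp add: E_def energy_nonneg)
    define P where "P = CP * r ^ ?n * E"
    define Q where "Q = 2 ^ ?n * 2 * CP * E"
    have rn: "r ^ ?n > 0" using r by simp
    have Q: "Q \<ge> 0" using CP E by (simp add: Q_def)
    have "\<exists>c. (LINT x|lborel. indicat_real (slab a r p) x * \<bar>f x $ i - c\<bar> ^ ?n) \<le> P" for p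
    proof -
      obtain j s where p: "p = (j, s)" by force
      have meas: "r ^ ?n \<le> measure lborel (slab a r (j, s))"
        using measure_slab_Int_slab_ge[OF r, of j j s s a] by simp
      obtain y where "(LINT x|lborel. indicat_real (slab a r p) x * \<bar>f x $ i - f y $ i\<bar> ^ ?n) \<le> (32 * ?n) ^ ?n * r ^ ?n * energy (slab a r p)"
        unfolding p by (rule poincare_cbox[OF r slab_eq_cbox[OF r, of a j s] slab_subset(1) meas, of i])
      also have "\<dots> \<le> P"
        unfolding P_def CP_def E_def using slab_subset(2)[of a r p] rn compact_slab[OF r, of a p] compact_annulus[of a r] CP
        by (intro mult_left_mono energy_mono) (auto intro: borel_compact compact_imp_bounded)
      finally show ?thesis by blast
    qed
    then obtain c where c: "\<And>p. (LINT x|lborel. indicat_real (slab a r p) x * \<bar>f x $ i - c p\<bar> ^ ?n) \<le> P" by metis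
    have adj: "\<bar>c (j, s) - c (k, t)\<bar> ^ ?n \<le> Q" if "j \<noteq> k" for j k s t
    proof -
      have "r ^ ?n * \<bar>c (j, s) - c (k, t)\<bar> ^ ?n \<le> 2 ^ ?n * (P + P)"
        by (rule power_diff_le_overlap[OF compact_slab[OF r] compact_slab[OF r] measure_slab_Int_slab_ge[OF r] c c]) (use that in auto)
      also have "\<dots> = r ^ ?n * Q" by (simp add: P_def Q_def)
      finally show ?thesis using rn by simp
    qed
    define b where "b = c (j1, True)"
    \<comment> \<open>A slab of another axis than \<open>j1\<close> meets the reference slab
      directly; a slab of axis \<open>j1\<close> reaches it through axis \<open>j2\<close>.\<close>
    have cb: "\<bar>c p - b\<bar> ^ ?n \<le> 2 ^ ?n * (2 * Q)" for p
    proof -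
      obtain j s where p: "p = (j, s)" by force
      show ?thesis
      proof (cases "j = j1")
        case False
        have "(1::real) * Q \<le> 2 ^ ?n * (2 * Q)" using Q by (intro mult_mono) auto
        then show ?thesis using adj[OF False, of s True] by (simp add: p b_def)
      next
        case True
        have "\<bar>c p - b\<bar> ^ ?n \<le> 2 ^ ?n * (\<bar>c p - c (j2, True)\<bar> ^ ?n + \<bar>c (j2, True) - b\<bar> ^ ?n)"
          using norm_add_power_le[of "c p - c (j2, True)" "c (j2, True) - b" ?n] by simp
        also have "\<dots> \<le> 2 ^ ?n * (Q + Q)"
          unfolding p b_def using adj[of j j2 s True] adj[of j2 j1 True True] j12 True by (intro mult_left_mono add_mono) auto
        finally show ?thesis by simp
      qed
    qed
    have each: "(LINT x|lborel. indicat_real (slab a r p) x * \<bar>f x $ i - b\<bar> ^ ?n) \<le> 2 ^ ?n * (P + (4 * r) ^ ?n * (2 ^ ?n * (2 * Q)))" for p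
    proof -
      have "(LINT x|lborel. indicat_real (slab a r p) x * \<bar>f x $ i - b\<bar> ^ ?n) \<le> 2 ^ ?n * (P + (4 * r) ^ ?n * \<bar>c p - b\<bar> ^ ?n)"
        by (rule integral_power_recentre_le[OF compact_slab[OF r] measure_slab_le[OF r] c])
      also have "\<dots> \<le> 2 ^ ?n * (P + (4 * r) ^ ?n * (2 ^ ?n * (2 * Q)))"
        using cb[of p] r by (intro mult_left_mono add_left_mono) auto
      finally show ?thesis .
    qed
    have "(LINT x|lborel. indicat_real (annulus a r) x * \<bar>f x $ i - b\<bar> ^ ?n)
        \<le> (LINT x|lborel. (\<Sum>p\<in>UNIV. indicat_real (slab a r p) x * \<bar>f x $ i - b\<bar> ^ ?n))"
    proof (rule integral_mono)
      show "integrable lborel (\<lambda>x. indicat_real (annulus a r) x * \<bar>f x $ i - b\<bar> ^ ?n)"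
        by (intro integrable_power_component) simp
      show "integrable lborel (\<lambda>x. \<Sum>p\<in>UNIV. indicat_real (slab a r p) x * \<bar>f x $ i - b\<bar> ^ ?n)"
        by (intro Bochner_Integration.integrable_sum integrable_power_component compact_slab r)
      fix x
      show "indicat_real (annulus a r) x * \<bar>f x $ i - b\<bar> ^ ?n \<le> (\<Sum>p\<in>UNIV. indicat_real (slab a r p) x * \<bar>f x $ i - b\<bar> ^ ?n)"
      proof (cases "x \<in> annulus a r")
        case True
        then obtain p where "x \<in> slab a r p" using annulus_eq_Union_slab by blast
        then have "indicat_real (annulus a r) x * \<bar>f x $ i - b\<bar> ^ ?n = indicat_real (slab a r p) x * \<bar>f x $ i - b\<bar> ^ ?n"
          using True by simp
        also have "\<dots> \<le> (\<Sum>p\<in>UNIV. indicat_real (slab a r p) x * \<bar>f x $ i - b\<bar> ^ ?n)"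
          by (rule member_le_sum) auto
        finally show ?thesis .
      qed (simp add: sum_nonneg)
    qed
    also have "\<dots> = (\<Sum>p\<in>UNIV. (LINT x|lborel. indicat_real (slab a r p) x * \<bar>f x $ i - b\<bar> ^ ?n))"
      by (intro Bochner_Integration.integral_sum integrable_power_component compact_slab r)
    also have "\<dots> \<le> (\<Sum>p\<in>(UNIV :: ('n \<times> bool) set). 2 ^ ?n * (P + (4 * r) ^ ?n * (2 ^ ?n * (2 * Q))))"
      by (intro sum_mono each)
    also have "\<dots> = C * r ^ ?n * E"
      by (simp add: C_def P_def Q_def power_mult_distrib algebra_simps)
    finally show "\<exists>b. (LINT x|lborel. indicat_real (annulus a r) x * \<bar>f x $ i - b\<bar> ^ ?n) \<le> C * r ^ ?n * energy (annulus a r)"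
      unfolding E_def by blast
  qed
qed

text \<open>All three integrals of the C1 inequality converge along the mollified maps: determinant
  and energy by convergence of derivatives, the middle one by dominated convergence, since the
  approximants stay within 1 of \<open>f\<close> on a ball containing the annulus.\<close>

lemma caccioppoli:
  fixes a :: "real^'n"
  assumes \<eta>: "\<And>x. (\<eta> has_derivative (\<lambda>h. v x \<bullet> h)) (at x)" "continuous_on UNIV v"
    and \<eta>1: "\<And>x. x \<in> cube a r \<Longrightarrow> v x = 0" and \<eta>b: "\<And>x. 0 \<le> \<eta> x" "\<And>x. \<eta> x \<le> 1"
    and \<eta>0: "\<And>x. x \<notin> cube a (2 * r) \<Longrightarrow> \<eta> x = 0 \<and> v x = 0"
    and L: "\<And>x. norm (v x) \<le> L / r" and r: "r > 0"
  shows "(LINT x|lborel. \<eta> x * det (G x)) \<le> fact (CARD('n)) * L *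
    ((LINT x|lborel. indicat_real (annulus a r) x * \<bar>f x $ i - c\<bar> ^ CARD('n)) / r ^ CARD('n) + energy (annulus a r))"
    and "integrable lborel (\<lambda>x. \<eta> x * det (G x))"
proof -
  let ?n = "CARD('n)" and ?A = "annulus a r"
  obtain R where R: "cube a (2 * r) \<subseteq> cball 0 R" using compact_subset_cball_0 compact_cube by metis
  have AR: "?A \<subseteq> cball 0 R" using R by (auto simp: annulus_def)
  obtain g Dg where g: "\<And>k x. (g k has_derivative (\<lambda>v. Dg k x *v v)) (at x)" "\<And>k. continuous_on UNIV (Dg k)"
    "\<And>k x i. x \<in> cball 0 R \<Longrightarrow> \<bar>g k x $ i - f x $ i\<bar> \<le> 1 / real (Suc k)"
    "\<And>k. integrable lborel (\<lambda>x. indicat_real (cball 0 R) x * norm (Dg k x - G x) ^ ?n)"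
    "(\<lambda>k. LINT x|lborel. indicat_real (cball 0 R) x * norm (Dg k x - G x) ^ ?n) \<longlonglongrightarrow> 0"
    using C1_approximating_sequence[of R] by blast
  have cont_g: "continuous_on UNIV (g k)" for k
    using has_derivative_continuous[OF g(1)] by (auto simp: continuous_on_eq_continuous_at)
  have "continuous_on UNIV \<eta>"
    using has_derivative_continuous[OF \<eta>(1)] by (auto simp: continuous_on_eq_continuous_at)
  then have m\<eta>: "\<eta> \<in> borel_measurable borel" by (rule borel_measurable_continuous_onI)
  have w\<eta>: "\<bar>\<eta> x\<bar> \<le> indicat_real (cball 0 R) x" for x
  proof (cases "x \<in> cube a (2 * r)")
    case True
    then have "x \<in> cball 0 R" using R by blast
    then show ?thesis using \<eta>b[of x] by simp
  qed (simp add: \<eta>0)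
  have [measurable]: "?A \<in> sets borel" by (intro borel_compact compact_annulus)
  show "integrable lborel (\<lambda>x. \<eta> x * det (G x))"
    by (rule det_energy_tendsto(3)[OF g(2,4,5) m\<eta> w\<eta>])
  have intA: "integrable lborel (\<lambda>x. indicat_real ?A x * h x)" if "continuous_on UNIV h" for h :: "real^'n \<Rightarrow> real"
  proof -
    have "integrable lborel (\<lambda>x. indicat_real ?A x *\<^sub>R h x)"
      by (intro borel_integrable_compact continuous_on_subset[OF that]) auto
    then show ?thesis by simp
  qed
  have le: "(LINT x|lborel. \<eta> x * det (Dg k x)) \<le> fact ?n * L *
     ((LINT x|lborel. indicat_real ?A x * (\<bar>g k x $ i - c\<bar> ^ ?n)) / r ^ ?n + (LINT x|lborel. indicat_real ?A x * norm (Dg k x) ^ ?n))" for k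
  proof -
    have "(LINT x|lborel. \<eta> x * det (Dg k x)) \<le> fact ?n * L * (LINT x:?A|lborel. (\<bar>g k x $ i - c\<bar> / r) ^ ?n + norm (Dg k x) ^ ?n)"
      by (rule caccioppoli_C1[OF g(1,2) \<eta> \<eta>1 \<eta>0 L r])
    also have "(LINT x:?A|lborel. (\<bar>g k x $ i - c\<bar> / r) ^ ?n + norm (Dg k x) ^ ?n)
        = (LINT x|lborel. indicat_real ?A x * (\<bar>g k x $ i - c\<bar> ^ ?n) / r ^ ?n + indicat_real ?A x * norm (Dg k x) ^ ?n)"
      unfolding set_lebesgue_integral_def by (simp add: power_divide algebra_simps)
    also have "\<dots> = (LINT x|lborel. indicat_real ?A x * (\<bar>g k x $ i - c\<bar> ^ ?n)) / r ^ ?n + (LINT x|lborel. indicat_real ?A x * norm (Dg k x) ^ ?n)"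
      by (subst Bochner_Integration.integral_add)
        (auto intro!: integrable_divide intA continuous_intros cont_g g(2))
    finally show ?thesis .
  qed
  have lim1: "(\<lambda>k. LINT x|lborel. \<eta> x * det (Dg k x)) \<longlonglongrightarrow> (LINT x|lborel. \<eta> x * det (G x))"
    by (rule det_energy_tendsto(1)[OF g(2,4,5) m\<eta> w\<eta>])
  have lim2: "(\<lambda>k. LINT x|lborel. indicat_real ?A x * norm (Dg k x) ^ ?n) \<longlonglongrightarrow> energy ?A"
    unfolding energy_def by (rule det_energy_tendsto(2)[OF g(2,4,5)]) (use AR in \<open>auto simp: indicator_def\<close>)
  have lim3: "(\<lambda>k. LINT x|lborel. indicat_real ?A x * (\<bar>g k x $ i - c\<bar> ^ ?n)) \<longlonglongrightarrow> (LINT x|lborel. indicat_real ?A x * \<bar>f x $ i - c\<bar> ^ ?n)"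
  proof (rule integral_dominated_convergence[where w = "\<lambda>x. indicat_real ?A x * (\<bar>f x $ i - c\<bar> + 1) ^ ?n"])
    show "integrable lborel (\<lambda>x. indicat_real ?A x * (\<bar>f x $ i - c\<bar> + 1) ^ ?n)"
      by (intro intA continuous_intros cont_f)
    show "(\<lambda>x. indicat_real ?A x * \<bar>f x $ i - c\<bar> ^ ?n) \<in> borel_measurable lborel"
      using integrable_power_component[OF compact_annulus] by (rule borel_measurable_integrable)
    show "(\<lambda>x. indicat_real ?A x * (\<bar>g k x $ i - c\<bar> ^ ?n)) \<in> borel_measurable lborel" for k
      by (intro borel_measurable_integrable intA continuous_intros cont_g)
    show "AE x in lborel. (\<lambda>k. indicat_real ?A x * (\<bar>g k x $ i - c\<bar> ^ ?n)) \<longlonglongrightarrow> indicat_real ?A x * \<bar>f x $ i - c\<bar> ^ ?n"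
    proof (intro AE_I2)
      fix x
      show "(\<lambda>k. indicat_real ?A x * (\<bar>g k x $ i - c\<bar> ^ ?n)) \<longlonglongrightarrow> indicat_real ?A x * \<bar>f x $ i - c\<bar> ^ ?n"
      proof (cases "x \<in> ?A")
        case True
        have comp: "(\<lambda>k. g k x $ i) \<longlonglongrightarrow> f x $ i"
        proof (rule LIM_zero_cancel, rule Lim_null_comparison[OF _ LIMSEQ_inverse_real_of_nat])
          show "\<forall>\<^sub>F k in sequentially. norm (g k x $ i - f x $ i) \<le> inverse (real (Suc k))"
            using g(3)[of x _ i] True AR by (intro always_eventually) (auto simp: inverse_eq_divide)
        qed
        show ?thesis by (intro tendsto_mult tendsto_const tendsto_power tendsto_rabs tendsto_diff comp)
      qed simp
    qed
    show "AE x in lborel. norm (indicat_real ?A x * (\<bar>g k x $ i - c\<bar> ^ ?n)) \<le> indicat_real ?A x * (\<bar>f x $ i - c\<bar> + 1) ^ ?n" for k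
    proof (intro AE_I2)
      fix x
      show "norm (indicat_real ?A x * (\<bar>g k x $ i - c\<bar> ^ ?n)) \<le> indicat_real ?A x * (\<bar>f x $ i - c\<bar> + 1) ^ ?n"
      proof (cases "x \<in> ?A")
        case True
        have "\<bar>g k x $ i - f x $ i\<bar> \<le> 1 / real (Suc k)" using g(3) True AR by blast
        also have "\<dots> \<le> 1" by simp
        finally have "\<bar>g k x $ i - c\<bar> \<le> \<bar>f x $ i - c\<bar> + 1" by linarith
        then show ?thesis using True by (simp add: power_mono)
      qed simp
    qed
  qed
  have "(\<lambda>k. fact ?n * L * ((LINT x|lborel. indicat_real ?A x * (\<bar>g k x $ i - c\<bar> ^ ?n)) / r ^ ?n +
      (LINT x|lborel. indicat_real ?A x * norm (Dg k x) ^ ?n)))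
    \<longlonglongrightarrow> fact ?n * L * ((LINT x|lborel. indicat_real ?A x * \<bar>f x $ i - c\<bar> ^ ?n) / r ^ ?n + energy ?A)"
    by (intro tendsto_intros lim2 lim3) (use r in auto)
  from LIMSEQ_le[OF lim1 this] le
  show "(LINT x|lborel. \<eta> x * det (G x)) \<le> fact ?n * L *
    ((LINT x|lborel. indicat_real ?A x * \<bar>f x $ i - c\<bar> ^ ?n) / r ^ ?n + energy ?A)"
    by blast
qed

end

text \<open>The norm here is the Euclidean norm of the matrix, so \<open>K\<close> is a distortion
  constant enlarged by the comparison with the operator norm.\<close>

locale quasiregular_W1n = continuous_W1n f G for f :: "real^'n \<Rightarrow> real^'n" and G +
  fixes K :: real
  assumes dim_ge_2: "2 \<le> CARD('n)" and K_nonneg: "0 \<le> K"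
    and distortion: "AE x in lborel. norm (G x) ^ CARD('n) \<le> K * det (G x)"
begin

text \<open>The distortion inequality bounds the energy of the cube by the weighted integral of the
  determinant, to which the Caccioppoli and annulus Poincare inequalities apply. The powers of
  \<open>r\<close> cancel, so \<open>Q\<close> depends neither on the centre nor on the
  size.\<close>

lemma energy_cube_le_annulus:
  obtains Q where "Q \<ge> 0" "\<And>a r. r > 0 \<Longrightarrow> energy (cube a r) \<le> Q * energy (annulus a r)"
proof -
  let ?n = "CARD('n)"
  obtain C where C: "C \<ge> 0" "\<And>a r i. r > 0 \<Longrightarrow> \<exists>b. (LINT x|lborel. indicat_real (annulus a r) x * \<bar>f x $ i - b\<bar> ^ ?n)
      \<le> C * r ^ ?n * energy (annulus a r)"
    using annulus_poincare[OF dim_ge_2] by blast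
  define L where "L = real (8 * ?n)"
  show ?thesis
  proof (rule that[of "K * (fact ?n * L * (C + 1))"])
    show "0 \<le> K * (fact ?n * L * (C + 1))" using K_nonneg C(1) by (simp add: L_def)
    fix a :: "real^'n" and r :: real assume r: "r > 0"
    obtain \<eta> v where \<eta>: "\<And>x. (\<eta> has_derivative (\<lambda>h. v x \<bullet> h)) (at x)" "continuous_on UNIV v"
      "\<And>x. 0 \<le> \<eta> x" "\<And>x. \<eta> x \<le> 1" "\<And>x. x \<in> cube a r \<Longrightarrow> \<eta> x = 1 \<and> v x = 0"
      "\<And>x. x \<notin> cube a (2 * r) \<Longrightarrow> \<eta> x = 0 \<and> v x = 0" "\<And>x. norm (v x) \<le> L / r"
      using cutoff_cube[OF r, of a] unfolding L_def by blast
    \<comment> \<open>Any component serves: the null Lagrangian identity may be applied in an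
      arbitrary row.\<close>
    obtain i :: 'n where True by blast
    obtain b where b: "(LINT x|lborel. indicat_real (annulus a r) x * \<bar>f x $ i - b\<bar> ^ ?n)
      \<le> C * r ^ ?n * energy (annulus a r)"
      using C(2)[OF r] by blast
    have v0: "v x = 0" if "x \<in> cube a r" for x using \<eta>(5)[OF that] by simp
    note cac = caccioppoli[OF \<eta>(1,2) v0 \<eta>(3,4,6,7) r]
    have "energy (cube a r) \<le> (LINT x|lborel. K * (\<eta> x * det (G x)))"
      unfolding energy_def
    proof (rule integral_mono_AE)
      show "integrable lborel (\<lambda>x. indicat_real (cube a r) x * norm (G x) ^ ?n)"
        by (intro integrable_energy_subset compact_imp_bounded borel_compact compact_cube)
      show "integrable lborel (\<lambda>x. K * (\<eta> x * det (G x)))" using cac(2) by simp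
      show "AE x in lborel. indicat_real (cube a r) x * norm (G x) ^ ?n \<le> K * (\<eta> x * det (G x))"
        using distortion
      proof eventually_elim
        case (elim x)
        have "indicat_real (cube a r) x * norm (G x) ^ ?n \<le> \<eta> x * norm (G x) ^ ?n"
          using \<eta>(3)[of x] \<eta>(5)[of x] by (intro mult_right_mono) (auto simp: indicator_def)
        also have "\<dots> \<le> \<eta> x * (K * det (G x))" using elim \<eta>(3)[of x] by (intro mult_left_mono) auto
        finally show ?case by (simp add: mult_ac)
      qed
    qed
    also have "\<dots> = K * (LINT x|lborel. \<eta> x * det (G x))" by simp
    also have "\<dots> \<le> K * (fact ?n * L * ((LINT x|lborel. indicat_real (annulus a r) x * \<bar>f x $ i - b\<bar> ^ ?n) / r ^ ?n + energy (annulus a r)))"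
      using cac(1)[where i = i and c = b] K_nonneg by (intro mult_left_mono)
    also have "\<dots> \<le> K * (fact ?n * L * (C * energy (annulus a r) + energy (annulus a r)))"
    proof -
      have "(LINT x|lborel. indicat_real (annulus a r) x * \<bar>f x $ i - b\<bar> ^ ?n) / r ^ ?n \<le> C * energy (annulus a r)"
        using b r by (simp add: divide_le_eq mult_ac)
      then show ?thesis using K_nonneg by (intro mult_left_mono add_right_mono) (auto simp: L_def)
    qed
    also have "\<dots> = K * (fact ?n * L * (C + 1)) * energy (annulus a r)" by (simp add: algebra_simps)
    finally show "energy (cube a r) \<le> K * (fact ?n * L * (C + 1)) * energy (annulus a r)" .
  qed
qed

text \<open>Hole filling: \<open>Q\<close> times the energy of the inner cube is added to both sides of the annulus bound.\<close>

lemma energy_decay: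
  obtains q where "1 / 2 \<le> q" "q < 1"
    "\<And>a r. r > 0 \<Longrightarrow> energy (cube a (r / 4)) \<le> q * energy (cube a r)"
proof -
  obtain Q where Q: "Q \<ge> 0" "\<And>a r. r > 0 \<Longrightarrow> energy (cube a r) \<le> Q * energy (annulus a r)"
    using energy_cube_le_annulus by blast
  \<comment> \<open>The maximum with 1/2 keeps \<open>q\<close> positive, so that its n-th root can
    later serve as the base of a Hoelder scale.\<close>
  define q where "q = max (1 / 2) (Q / (1 + Q))"
  show ?thesis
  proof (rule that[of q])
    show "1 / 2 \<le> q" by (simp add: q_def)
    show "q < 1" using Q by (simp add: q_def)
    fix a :: "real^'n" and r :: real assume r: "r > 0"
    have B: "cube a s \<in> sets borel" "bounded (cube a s)" "annulus a s \<in> sets borel" "bounded (annulus a s)" for s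
      by (auto intro: borel_compact compact_imp_bounded)
    \<comment> \<open>The cube of half-side \<open>r / 2\<close> touches the closed annulus along
      its boundary; passing to \<open>r / 4\<close> makes the two sets disjoint without a null set
      argument.\<close>
    have "energy (cube a (r / 4)) + energy (annulus a (r / 2)) \<le> energy (cube a r)"
    proof -
      have "cube a (r / 4) \<inter> annulus a (r / 2) = {}"
      proof -
        have "\<not> r / 2 \<le> \<bar>x $ i - a $ i\<bar>" if "x \<in> cube a (r / 4)" for x i
        proof -
          have "\<bar>x $ i - a $ i\<bar> \<le> r / 4" using that by (simp add: cube_def)
          then show ?thesis using r by linarith
        qed
        then show ?thesis by (auto simp: annulus_def)
      qed
      moreover have "cube a (r / 4) \<subseteq> cube a r" "annulus a (r / 2) \<subseteq> cube a r"
        using r by (auto simp: annulus_def intro!: cube_mono)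
      ultimately have "indicat_real (cube a (r / 4)) x * norm (G x) ^ CARD('n) + indicat_real (annulus a (r / 2)) x * norm (G x) ^ CARD('n)
        \<le> indicat_real (cube a r) x * norm (G x) ^ CARD('n)" for x
        by (auto simp: indicator_def)
      then have "(LINT x|lborel. indicat_real (cube a (r / 4)) x * norm (G x) ^ CARD('n) + indicat_real (annulus a (r / 2)) x * norm (G x) ^ CARD('n))
        \<le> energy (cube a r)"
        unfolding energy_def
        by (intro integral_mono Bochner_Integration.integrable_add integrable_energy_subset B)
      then show ?thesis
        unfolding energy_def
        by (subst (asm) Bochner_Integration.integral_add) (auto intro: integrable_energy_subset B)
    qed
    moreover have "energy (cube a (r / 4)) \<le> Q * energy (annulus a (r / 2))"
    proof -
      have "energy (cube a (r / 4)) \<le> energy (cube a (r / 2))"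
        using r by (intro energy_mono cube_mono B) auto
      then show ?thesis using Q(2)[of "r / 2" a] r by simp
    qed
    ultimately have "energy (cube a (r / 4)) \<le> Q * (energy (cube a r) - energy (cube a (r / 4)))"
      using Q(1) by (smt (verit) mult_left_mono)
    then have "energy (cube a (r / 4)) * (1 + Q) \<le> Q * energy (cube a r)" by (simp add: algebra_simps)
    then have "energy (cube a (r / 4)) \<le> Q / (1 + Q) * energy (cube a r)"
      using Q(1) by (simp add: field_simps)
    also have "\<dots> \<le> q * energy (cube a r)"
      by (intro mult_right_mono energy_nonneg) (simp add: q_def)
    finally show "energy (cube a (r / 4)) \<le> q * energy (cube a r)" .
  qed
qed

end

text \<open>Iterating the step collects a geometric series, and the remaining term disappears in the
  limit.\<close>

lemma geometric_telescope:
  fixes d :: "nat \<Rightarrow> real"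
  assumes step: "\<And>k. d k \<le> d (Suc k) + B * \<mu> ^ k" and lim: "d \<longlonglongrightarrow> 0" and \<mu>: "0 \<le> \<mu>" "\<mu> < 1" and B: "B \<ge> 0"
  shows "d k \<le> B / (1 - \<mu>) * \<mu> ^ k"
proof -
  have "d k \<le> d (k + j) + B * \<mu> ^ k * (\<Sum>i<j. \<mu> ^ i)" for j
  proof (induction j)
    case (Suc j)
    then show ?case using step[of "k + j"] by (simp add: algebra_simps power_add)
  qed simp
  also have "d (k + j) + B * \<mu> ^ k * (\<Sum>i<j. \<mu> ^ i) \<le> d (k + j) + B * \<mu> ^ k * (1 / (1 - \<mu>))" for j
  proof -
    have "(\<Sum>i<j. \<mu> ^ i) \<le> 1 / (1 - \<mu>)"
    proof -
      have "(\<Sum>i<j. \<mu> ^ i) = (1 - \<mu> ^ j) / (1 - \<mu>)"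
        using \<mu> sum_gp_strict[of \<mu> j] by simp
      then show ?thesis using \<mu> by (simp add: divide_right_mono)
    qed
    then show ?thesis using B \<mu> by (intro add_left_mono mult_left_mono) auto
  qed
  finally have le: "d k \<le> d (k + j) + B * \<mu> ^ k * (1 / (1 - \<mu>))" for j .
  have "(\<lambda>j. d (k + j) + B * \<mu> ^ k * (1 / (1 - \<mu>))) \<longlonglongrightarrow> 0 + B * \<mu> ^ k * (1 / (1 - \<mu>))"
    using LIMSEQ_ignore_initial_segment[OF lim, of k] by (intro tendsto_intros) (simp add: add.commute)
  then have "d k \<le> 0 + B * \<mu> ^ k * (1 / (1 - \<mu>))"
    by (rule LIMSEQ_le_const) (use le in blast)
  then show ?thesis by simp
qed

text \<open>A gain of the factor \<mu> per scale of ratio 1/4 is a power law with the exponent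
  \<alpha> for which \<open>(1 / 4) powr \<alpha> = \<mu>\<close>. Distances above 1/4 are covered
  by the boundedness of the image.\<close>

lemma hoelder_from_dyadic:
  fixes f :: "'a::metric_space \<Rightarrow> 'b::metric_space"
  assumes bdd: "\<And>x y. x \<in> E \<Longrightarrow> y \<in> E \<Longrightarrow> dist (f x) (f y) \<le> D"
    and dyadic: "\<And>x y k. x \<in> E \<Longrightarrow> y \<in> E \<Longrightarrow> dist x y \<le> (1 / 4) ^ Suc k \<Longrightarrow> dist (f x) (f y) \<le> M * \<mu> ^ k"
    and \<mu>: "0 < \<mu>" "\<mu> < 1" and M: "M \<ge> 0"
  obtains C \<alpha> where "C > 0" "\<alpha> > 0" "\<And>x y. x \<in> E \<Longrightarrow> y \<in> E \<Longrightarrow> dist (f x) (f y) \<le> C * dist x y powr \<alpha>"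
proof -
  define \<alpha> where "\<alpha> = ln \<mu> / ln (1 / 4)"
  have \<alpha>: "\<alpha> > 0" using \<mu> by (simp add: \<alpha>_def zero_less_divide_iff ln_less_zero)
  have "(1 / 4) powr \<alpha> = \<mu>" using \<mu> by (simp add: powr_def \<alpha>_def)
  then have pw: "((1 / 4) ^ k) powr \<alpha> = \<mu> ^ k" for k
    by (simp flip: powr_realpow add: powr_powr) (simp add: powr_realpow \<mu> mult.commute flip: powr_powr)
  \<comment> \<open>The first term pays for two lost scales, the second for distances above 1/4,
    where \<open>4 powr \<alpha> * d powr \<alpha> \<ge> 1\<close>; the summand 1 ensures
    positivity.\<close>
  define C where "C = M / \<mu>\<^sup>2 + \<bar>D\<bar> * 4 powr \<alpha> + 1"
  have parts: "0 \<le> M / \<mu>\<^sup>2" "0 \<le> \<bar>D\<bar> * 4 powr \<alpha>" using M by auto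
  have C: "C > 0" "M / \<mu>\<^sup>2 \<le> C" "\<bar>D\<bar> * 4 powr \<alpha> \<le> C" using parts unfolding C_def by linarith+
  show ?thesis
  proof (rule that[of C \<alpha>])
    show "C > 0" by (fact C)
    fix x y assume xy: "x \<in> E" "y \<in> E"
    define d where "d = dist x y"
    consider "d = 0" | "d > 1 / 4" | "0 < d" "d \<le> 1 / 4" using zero_le_dist[of x y] unfolding d_def by linarith
    then show "dist (f x) (f y) \<le> C * dist x y powr \<alpha>"
    proof cases
      case 1
      then show ?thesis by (simp add: d_def)
    next
      case 2
      have "1 powr \<alpha> \<le> (4 * d) powr \<alpha>" using 2 \<alpha> by (intro powr_mono2) auto
      then have ge1: "1 \<le> 4 powr \<alpha> * d powr \<alpha>" using 2 by (simp add: powr_mult)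
      have "dist (f x) (f y) \<le> \<bar>D\<bar> * 1" using bdd[OF xy] by simp
      also have "\<dots> \<le> \<bar>D\<bar> * (4 powr \<alpha> * d powr \<alpha>)" using ge1 by (intro mult_left_mono) auto
      also have "\<dots> = (\<bar>D\<bar> * 4 powr \<alpha>) * d powr \<alpha>" by simp
      also have "\<dots> \<le> C * d powr \<alpha>" using C by (intro mult_right_mono) auto
      finally show ?thesis by (simp add: d_def)
    next
      case 3
      \<comment> \<open>The first scale below \<open>d\<close>. Since \<open>d \<le> 1 / 4\<close>,
        it is at least 2, and the preceding scale \<open>Suc k = j - 1\<close> is still at least
        \<open>d\<close>, as the hypothesis \<open>dyadic\<close> demands; hence the quotient
        \<open>\<mu> ^ k = \<mu> ^ j / \<mu>\<^sup>2\<close>.\<close>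
      define j where "j = (LEAST j. (1 / 4) ^ j < d)"
      have ex: "\<exists>j. (1 / 4) ^ j < d" using 3 by (intro real_arch_pow_inv) auto
      then have j: "(1 / 4) ^ j < d" unfolding j_def by (rule LeastI_ex)
      have "j \<noteq> 0" "j \<noteq> 1" using j 3 by (auto intro!: gr0I)
      then obtain k where k: "j = Suc (Suc k)" by (metis One_nat_def not0_implies_Suc)
      have "\<not> (1 / 4) ^ Suc k < d" using not_less_Least[of "Suc k" "\<lambda>j. (1 / 4) ^ j < d"] k by (simp add: j_def)
      then have "dist (f x) (f y) \<le> M * \<mu> ^ k" using dyadic[OF xy, of k] by (simp add: d_def)
      also have "\<dots> = M / \<mu>\<^sup>2 * \<mu> ^ j" using \<mu> by (simp add: k power2_eq_square)
      also have "\<dots> = M / \<mu>\<^sup>2 * ((1 / 4) ^ j) powr \<alpha>" by (simp add: pw)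
      also have "\<dots> \<le> M / \<mu>\<^sup>2 * d powr \<alpha>" using j \<alpha> M by (intro mult_left_mono powr_mono2) auto
      also have "\<dots> \<le> C * d powr \<alpha>" using C by (intro mult_right_mono) auto
      finally show ?thesis by (simp add: d_def)
    qed
  qed (fact \<alpha>)
qed

context quasiregular_W1n
begin

text \<open>The Poincare centres of cubes around a point form a sequence whose steps decay like
  \<open>\<mu> ^ k\<close>, because the n-th power of a step is controlled by the energy alone:
  volume and Poincare factor scale alike. The limit is the value of \<open>f\<close>, and two nearby
  points are compared through nested cubes.\<close>

theorem hoelder_on_compact:
  assumes E: "compact E"
  obtains C \<alpha> where "C > 0" "\<alpha> > 0" "\<And>x y. x \<in> E \<Longrightarrow> y \<in> E \<Longrightarrow> dist (f x) (f y) \<le> C * dist x y powr \<alpha>"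
proof -
  let ?n = "CARD('n)"
  have n0: "?n > 0" by simp
  define rad :: "nat \<Rightarrow> real" where "rad k = (1 / 4) ^ k" for k
  have rad: "rad k > 0" "rad (Suc k) = rad k / 4" for k by (auto simp: rad_def)
  obtain q where q: "1 / 2 \<le> q" "q < 1" "\<And>a r. r > 0 \<Longrightarrow> energy (cube a (r / 4)) \<le> q * energy (cube a r)"
    using energy_decay by blast
  have B: "cube a s \<in> sets borel" "bounded (cube a s)" for a :: "real^'n" and s
    by (auto intro: borel_compact compact_imp_bounded)
  have decay: "energy (cube a (rad k)) \<le> q ^ k * energy (cube a 1)" for a k
  proof (induction k)
    case (Suc k)
    have "energy (cube a (rad (Suc k))) \<le> q * energy (cube a (rad k))"
      unfolding rad(2) by (rule q(3)[OF rad(1)])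
    also have "\<dots> \<le> q * (q ^ k * energy (cube a 1))" using Suc q by (intro mult_left_mono) auto
    finally show ?case by simp
  qed (simp add: rad_def)
  obtain R where R: "E \<subseteq> cball 0 R" using compact_subset_cball_0[OF E] by blast
  \<comment> \<open>A single energy bound for all unit cubes centred in \<open>E\<close>, which
    makes the constants uniform on \<open>E\<close>.\<close>
  define \<Phi> where "\<Phi> = energy (cube (0 :: real^'n) (R + 1))"
  have \<Phi>0: "\<Phi> \<ge> 0" by (simp add: \<Phi>_def energy_nonneg)
  have unit: "energy (cube a 1) \<le> \<Phi>" if "a \<in> E" for a
  proof -
    have "cube a 1 \<subseteq> cube 0 (R + 1)"
    proof
      fix x assume x: "x \<in> cube a 1"
      have "\<bar>x $ i\<bar> \<le> R + 1" for i
      proof -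
        have "\<bar>a $ i\<bar> \<le> R" using that R component_le_norm_cart[of a i] by (auto intro: order_trans)
        moreover have "\<bar>x $ i - a $ i\<bar> \<le> 1" using x by (simp add: cube_def)
        ultimately show ?thesis by linarith
      qed
      then show "x \<in> cube 0 (R + 1)" by (simp add: cube_def)
    qed
    then show ?thesis unfolding \<Phi>_def by (intro energy_mono B)
  qed
  define CP :: real where "CP = (32 * ?n) ^ ?n"
  have CP: "CP \<ge> 0" by (simp add: CP_def)
  define good where "good a k i y \<longleftrightarrow> y \<in> cube a (rad k) \<and>
    (LINT x|lborel. indicat_real (cube a (rad k)) x * \<bar>f x $ i - f y $ i\<bar> ^ ?n) \<le> CP * rad k ^ ?n * energy (cube a (rad k))"
    for a k i y
  have "\<exists>y. good a k i y" for a k i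
  proof -
    have meas: "rad k ^ ?n \<le> measure lborel (cube a (rad k))"
      using rad(1)[of k] by (subst measure_cube) (auto intro!: power_mono)
    have sub: "cube a (rad k) \<subseteq> cube a (2 * rad k)" using rad(1)[of k] by (intro cube_mono) auto
    show ?thesis unfolding CP_def good_def
      by (rule poincare_cbox[OF rad(1) cube_eq_cbox sub meas, of i]) blast
  qed
  then obtain Y where "\<And>a k i. good a k i (Y a k i)" by metis
  then have Y: "\<And>a k i. Y a k i \<in> cube a (rad k)"
    "\<And>a k i. (LINT x|lborel. indicat_real (cube a (rad k)) x * \<bar>f x $ i - f (Y a k i) $ i\<bar> ^ ?n) \<le> CP * rad k ^ ?n * energy (cube a (rad k))"
    unfolding good_def by blast+
  define c where "c a k i = f (Y a k i) $ i" for a k i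
  define \<mu> where "\<mu> = root ?n q"
  have \<mu>n: "\<mu> ^ ?n = q" using q by (simp add: \<mu>_def)
  have \<mu>: "0 < \<mu>" "\<mu> < 1" using q by (auto simp: \<mu>_def)
  \<comment> \<open>The factor \<open>4 ^ n\<close> is the volume ratio of consecutive cubes,
    \<open>2 ^ n\<close> the cost of splitting a difference, and \<open>2 * CP * \<Phi>\<close> the
    two Poincare bounds; the root undoes the n-th power.\<close>
  define A where "A = root ?n (4 ^ ?n * (2 ^ ?n * (2 * CP * \<Phi>)))"
  have A: "A \<ge> 0" "A ^ ?n = 4 ^ ?n * (2 ^ ?n * (2 * CP * \<Phi>))"
    using CP \<Phi>0 by (auto simp: A_def)
  have bound: "(LINT x|lborel. indicat_real (cube a (rad k)) x * \<bar>f x $ i - c a k i\<bar> ^ ?n) \<le> CP * rad k ^ ?n * (q ^ k * \<Phi>)"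
    if "a \<in> E" for a k i
  proof -
    have "energy (cube a (rad k)) \<le> q ^ k * \<Phi>"
      by (rule order_trans[OF decay mult_left_mono[OF unit[OF that]]]) (use q in auto)
    then have "CP * rad k ^ ?n * energy (cube a (rad k)) \<le> CP * rad k ^ ?n * (q ^ k * \<Phi>)"
      using CP rad(1)[of k] by (intro mult_left_mono) auto
    then show ?thesis using Y(2)[of a k i] unfolding c_def by linarith
  qed
  \<comment> \<open>The centres \<open>a\<close> and \<open>b\<close> may differ: with equal ones
    this is a step of the telescoping at one point, with different ones it links two nearby
    points.\<close>
  have overlap: "\<bar>c a k i - c b (Suc k) i\<bar> \<le> A * \<mu> ^ k"
    if ab: "a \<in> E" "b \<in> E" "cube b (rad (Suc k)) \<subseteq> cube a (rad k)" for a b k i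
  proof -
    let ?X = "CP * rad k ^ ?n * (q ^ k * \<Phi>)"
    have "CP * rad (Suc k) ^ ?n * (q ^ Suc k * \<Phi>) \<le> ?X"
    proof -
      have "rad (Suc k) ^ ?n \<le> rad k ^ ?n" unfolding rad(2) using rad(1)[of k] by (intro power_mono) auto
      moreover have "q ^ Suc k * \<Phi> \<le> q ^ k * \<Phi>" using q \<Phi>0 by (intro mult_right_mono power_decreasing) auto
      ultimately show ?thesis using CP rad(1)[of k] rad(1)[of "Suc k"] q(1,2) \<Phi>0 by (intro mult_mono) auto
    qed
    then have b2: "(LINT x|lborel. indicat_real (cube b (rad (Suc k))) x * \<bar>f x $ i - c b (Suc k) i\<bar> ^ ?n) \<le> ?X"
      using bound[OF ab(2), of "Suc k" i] by linarith
    have meas: "rad (Suc k) ^ ?n \<le> measure lborel (cube a (rad k) \<inter> cube b (rad (Suc k)))"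
    proof -
      have "cube a (rad k) \<inter> cube b (rad (Suc k)) = cube b (rad (Suc k))" using ab(3) by auto
      then show ?thesis using rad(1)[of "Suc k"] by (simp add: measure_cube power_mono less_imp_le)
    qed
    have "rad (Suc k) ^ ?n * \<bar>c a k i - c b (Suc k) i\<bar> ^ ?n \<le> 2 ^ ?n * (?X + ?X)"
      by (rule power_diff_le_overlap[OF compact_cube compact_cube meas bound[OF ab(1)] b2])
    also have "\<dots> = rad (Suc k) ^ ?n * (A * \<mu> ^ k) ^ ?n"
    proof -
      have "(\<mu> ^ k) ^ ?n = q ^ k" by (metis \<mu>n power_mult mult.commute)
      moreover have "rad k ^ ?n = rad (Suc k) ^ ?n * 4 ^ ?n" by (simp add: rad(2) flip: power_mult_distrib)
      ultimately show ?thesis by (simp add: power_mult_distrib[of A] A(2) mult_ac)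
    qed
    finally have "\<bar>c a k i - c b (Suc k) i\<bar> ^ ?n \<le> (A * \<mu> ^ k) ^ ?n" using rad(1)[of "Suc k"] by simp
    then show ?thesis using A(1) \<mu> by (subst (asm) power_mono_iff) auto
  qed
  have near: "\<bar>f a $ i - c a k i\<bar> \<le> A / (1 - \<mu>) * \<mu> ^ k" if a: "a \<in> E" for a k i
  proof (rule geometric_telescope[where d = "\<lambda>k. \<bar>f a $ i - c a k i\<bar>"])
    fix k
    have "cube a (rad (Suc k)) \<subseteq> cube a (rad k)" using rad[of k] by (intro cube_mono) auto
    from overlap[OF a a this, of i]
    show "\<bar>f a $ i - c a k i\<bar> \<le> \<bar>f a $ i - c a (Suc k) i\<bar> + A * \<mu> ^ k" by linarith
  next
    \<comment> \<open>The constants are values of \<open>f\<close> at points \<open>Y a k i\<close>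
      of the shrinking cubes, so continuity gives convergence at every \<open>a\<close>, not merely
      at almost every one.\<close>
    have rad0: "rad \<longlonglongrightarrow> 0" unfolding rad_def by (intro LIMSEQ_power_zero) auto
    have "(\<lambda>k. Y a k i) \<longlonglongrightarrow> a"
    proof (rule vec_tendstoI)
      fix j
      show "(\<lambda>k. Y a k i $ j) \<longlonglongrightarrow> a $ j"
      proof (rule LIM_zero_cancel, rule Lim_null_comparison[OF _ rad0])
        show "\<forall>\<^sub>F k in sequentially. norm (Y a k i $ j - a $ j) \<le> rad k"
          using Y(1)[of a _ i] by (intro always_eventually) (simp add: cube_def)
      qed
    qed
    moreover have "isCont (\<lambda>x. f x $ i) a"
      using cont_component[of i] by (simp add: continuous_on_eq_continuous_at)
    ultimately have "(\<lambda>k. f (Y a k i) $ i) \<longlonglongrightarrow> f a $ i" by (rule isCont_tendsto_compose[rotated])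
    then have "(\<lambda>k. \<bar>f a $ i - c a k i\<bar>) \<longlonglongrightarrow> \<bar>f a $ i - f a $ i\<bar>"
      unfolding c_def by (intro tendsto_rabs tendsto_diff tendsto_const)
    then show "(\<lambda>k. \<bar>f a $ i - c a k i\<bar>) \<longlonglongrightarrow> 0" by simp
  qed (use \<mu> A in auto)
  \<comment> \<open>Two tails of the telescoping, one for each point, and one link between them; the
    dimension passes from components to the norm.\<close>
  define M where "M = ?n * (2 * (A / (1 - \<mu>)) + A)"
  have A': "A / (1 - \<mu>) \<ge> 0" using A \<mu> by simp
  have dyadic: "dist (f x) (f y) \<le> M * \<mu> ^ k" if xy: "x \<in> E" "y \<in> E" "dist x y \<le> (1 / 4) ^ Suc k" for x y k
  proof -
    have sub: "cube y (rad (Suc k)) \<subseteq> cube x (rad k)"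
    proof
      fix z assume z: "z \<in> cube y (rad (Suc k))"
      have "\<bar>z $ i - x $ i\<bar> \<le> rad k" for i
      proof -
        have "\<bar>(x - y) $ i\<bar> \<le> rad (Suc k)"
          using component_le_norm_cart[of "x - y" i] xy(3) unfolding rad_def dist_norm by linarith
        moreover have "\<bar>z $ i - y $ i\<bar> \<le> rad (Suc k)" using z by (simp add: cube_def)
        moreover have "rad (Suc k) + rad (Suc k) \<le> rad k" using rad(1)[of k] unfolding rad(2) by simp
        ultimately show ?thesis unfolding vector_minus_component by linarith
      qed
      then show "z \<in> cube x (rad k)" by (simp add: cube_def)
    qed
    have "\<bar>(f x - f y) $ i\<bar> \<le> (2 * (A / (1 - \<mu>)) + A) * \<mu> ^ k" for i
    proof -
      have "A / (1 - \<mu>) * \<mu> ^ Suc k \<le> A / (1 - \<mu>) * \<mu> ^ k"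
        using A' \<mu> by (intro mult_left_mono power_decreasing) auto
      then have "\<bar>f y $ i - c y (Suc k) i\<bar> \<le> A / (1 - \<mu>) * \<mu> ^ k" using near[OF xy(2), of i "Suc k"] by linarith
      moreover note near[OF xy(1), of i k] overlap[OF xy(1,2) sub, of i]
      ultimately have "\<bar>f x $ i - f y $ i\<bar> \<le> A / (1 - \<mu>) * \<mu> ^ k + A * \<mu> ^ k + A / (1 - \<mu>) * \<mu> ^ k" by linarith
      then show ?thesis by (simp add: algebra_simps)
    qed
    then have "(\<Sum>i\<in>UNIV. \<bar>(f x - f y) $ i\<bar>) \<le> (\<Sum>i\<in>(UNIV :: 'n set). (2 * (A / (1 - \<mu>)) + A) * \<mu> ^ k)"
      by (intro sum_mono)
    also have "\<dots> = M * \<mu> ^ k" by (simp add: M_def)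
    finally show ?thesis using norm_le_l1_cart[of "f x - f y"] by (simp add: dist_norm)
  qed
  have "bounded (f ` E)"
    by (intro compact_imp_bounded compact_continuous_image continuous_on_subset[OF cont_f] E) auto
  then have bdd: "dist (f x) (f y) \<le> diameter (f ` E)" if "x \<in> E" "y \<in> E" for x y
    using that by (intro diameter_bounded_bound) auto
  have "M \<ge> 0" using A A' by (simp add: M_def)
  show ?thesis
  proof (rule hoelder_from_dyadic)
    show "dist (f x) (f y) \<le> diameter (f ` E)" if "x \<in> E" "y \<in> E" for x y
      using that by (rule bdd)
    show "dist (f x) (f y) \<le> M * \<mu> ^ k" if "x \<in> E" "y \<in> E" "dist x y \<le> (1 / 4) ^ Suc k" for x y k
      using that by (rule dyadic)
    show "0 < \<mu>" "\<mu> < 1" "0 \<le> M" by fact+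
  qed (rule that)
qed

end

section \<open>Quasiconformal maps\<close>

lemma norm_matrix_le_onorm:
  fixes A :: "real^'n^'m"
  shows "norm A \<le> CARD('m) * CARD('n) * onorm ((*v) A)"
proof -
  have "norm (A $ i) \<le> CARD('n) * onorm ((*v) A)" for i
    using norm_le_l1_cart[of "A $ i"] sum_mono[of UNIV "\<lambda>j. \<bar>A $ i $ j\<bar>" "\<lambda>_. onorm ((*v) A)"] matrix_component_le_onorm[of A i]
    by simp
  then have "(\<Sum>i\<in>UNIV. norm (A $ i)) \<le> (\<Sum>i\<in>(UNIV :: 'm set). CARD('n) * onorm ((*v) A))"
    by (intro sum_mono)
  moreover have "norm A \<le> (\<Sum>i\<in>UNIV. norm (A $ i))"
    unfolding norm_vec_def[of A] by (rule L2_set_le_sum) simp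
  ultimately show ?thesis by simp
qed

text \<open>Each real entry agrees almost everywhere with a Borel function; as there are finitely
  many entries, the exceptional sets combine to a null set.\<close>

lemma borel_representative_matrix:
  fixes D :: "real^'n \<Rightarrow> real^'n^'n"
  assumes "D \<in> borel_measurable lebesgue"
  obtains G where "G \<in> borel_measurable borel" "AE x in lborel. D x = G x"
proof -
  have "(\<lambda>x. D x $ i $ j) \<in> borel_measurable lebesgue" for i j
    by (rule measurable_compose[OF assms borel_measurable_continuous_onI]) (intro continuous_intros)
  from completion_ex_borel_measurable_real[OF this]
  have "\<exists>g. (\<lambda>i j. g \<in> borel_measurable lborel \<and> (AE x in lborel. D x $ i $ j = g x)) i j" for i j
    by blast
  then have "\<exists>g. \<forall>i j. (\<lambda>i j h. h \<in> borel_measurable lborel \<and> (AE x in lborel. D x $ i $ j = h x)) i j (g i j)"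
    by (intro choice allI) blast
  then obtain g where g: "\<And>i j. g i j \<in> borel_measurable lborel" "\<And>i j. AE x in lborel. D x $ i $ j = g i j x"
    by blast
  show ?thesis
  proof
    show "(\<lambda>x. \<chi> i j. g i j x) \<in> borel_measurable borel"
    proof (rule borel_measurable_euclidean_space[THEN iffD2], rule ballI)
      fix b :: "real^'n^'n" assume "b \<in> Basis"
      then obtain i j where "b = axis i (axis j 1)" by (auto simp: Basis_vec_def)
      then show "(\<lambda>x. (\<chi> i j. g i j x) \<bullet> b) \<in> borel_measurable borel"
        using g(1)[of i j] by (simp add: inner_axis)
    qed
    have "AE x in lborel. \<forall>i j. D x $ i $ j = g i j x"
      using g(2) by (simp add: AE_all_countable)
    then show "AE x in lborel. D x = (\<chi> i j. g i j x)"
      by eventually_elim (simp add: vec_eq_iff)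
  qed
qed

text \<open>The given weak Jacobian is replaced by a Borel representative, which changes neither the
  integrals nor the inequalities that hold almost everywhere; the translated bumps are admissible
  test functions.\<close>

lemma quasiregular_W1n_if_quasiconformal:
  fixes f :: "real^'n \<Rightarrow> real^'n"
  assumes n2: "CARD('n) \<ge> 2" and qc: "quasiconformal UNIV UNIV f"
  obtains G K where "quasiregular_W1n f G K"
proof -
  let ?n = "CARD('n)"
  obtain K g Df where K: "K \<ge> 1" and hom: "homeomorphism UNIV UNIV f g"
    and W: "W1p_loc_with_derivative (real ?n) UNIV f Df"
    and dist: "AE x in lebesgue_on UNIV. onorm ((*v) (Df x)) ^ ?n \<le> K * det (Df x)"
    using qc unfolding quasiconformal_def K_quasiconformal_def by blast
  have contf: "continuous_on UNIV f" using hom by (simp add: homeomorphism_def)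
  have measf: "f \<in> borel_measurable borel" using contf by (rule borel_measurable_continuous_onI)
  have Dm: "Df \<in> borel_measurable lebesgue"
    and Di: "\<And>C. compact C \<Longrightarrow> integrable (lebesgue_on C) (\<lambda>x. norm (Df x) powr real ?n)"
    and Dw: "\<And>i j \<phi>. test_function UNIV \<phi> \<Longrightarrow>
        integral\<^sup>L lebesgue (\<lambda>x. f x $ i * frechet_derivative \<phi> (at x) (axis j 1)) =
        - integral\<^sup>L lebesgue (\<lambda>x. Df x $ i $ j * \<phi> x)"
    using W unfolding W1p_loc_with_derivative_def Lp_loc_def weak_partial_def lebesgue_on_UNIV_eq by auto
  obtain G where G: "G \<in> borel_measurable borel" "AE x in lborel. Df x = G x"
    using borel_representative_matrix[OF Dm] by blast
  have GA: "AE x in lebesgue. Df x = G x" using G(2) by (rule AE_completion)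
  note [measurable] = G(1) measf borel_closed[OF closed_cball]
  have "quasiregular_W1n f G ((?n * ?n) ^ ?n * K)"
  proof
    show "continuous_on UNIV f" by (fact contf)
    show "G \<in> borel_measurable borel" by (fact G(1))
    show "2 \<le> ?n" by (fact n2)
    show "0 \<le> (?n * ?n) ^ ?n * K" using K by simp
    show "AE x in lborel. norm (G x) ^ ?n \<le> (?n * ?n) ^ ?n * K * det (G x)"
    proof -
      have "AE x in lborel. onorm ((*v) (Df x)) ^ ?n \<le> K * det (Df x)"
        using dist unfolding lebesgue_on_UNIV_eq AE_completion_iff .
      with G(2) show ?thesis
      proof eventually_elim
        case (elim x)
        \<comment> \<open>Passing from the operator norm to the Euclidean norm of the matrix costs
          the square of the dimension, hence the enlarged distortion constant.\<close>
        have "norm (G x) ^ ?n \<le> (?n * ?n * onorm ((*v) (G x))) ^ ?n"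
          using norm_matrix_le_onorm[of "G x"] by (intro power_mono) auto
        also have "\<dots> = (?n * ?n) ^ ?n * onorm ((*v) (G x)) ^ ?n" by (simp add: power_mult_distrib)
        also have "\<dots> \<le> (?n * ?n) ^ ?n * (K * det (G x))" using elim by (intro mult_left_mono) auto
        finally show ?case by (simp add: mult.assoc)
      qed
    qed
    show "(\<integral>\<^sup>+x. ennreal (norm (G x) ^ ?n) * indicator (cball 0 R) x \<partial>lborel) < \<infinity>" for R
    proof -
      have "integrable lebesgue (\<lambda>x. indicat_real (cball 0 R) x *\<^sub>R norm (Df x) powr real ?n)"
        using Di[OF compact_cball] integrable_restrict_space[of "cball 0 R" lebesgue "\<lambda>x. norm (Df x) powr real ?n"]
        by simp
      then have "integrable lebesgue (\<lambda>x. indicat_real (cball 0 R) x *\<^sub>R norm (G x) ^ ?n)"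
      proof (rule integrable_cong_AE_imp)
        show "(\<lambda>x. indicat_real (cball 0 R) x *\<^sub>R norm (G x) ^ ?n) \<in> borel_measurable lebesgue"
          by (rule measurable_completion) measurable
        show "AE x in lebesgue. indicat_real (cball 0 R) x *\<^sub>R norm (Df x) powr real ?n = indicat_real (cball 0 R) x *\<^sub>R norm (G x) ^ ?n"
          using GA by eventually_elim (auto simp: powr_realpow')
      qed
      then have "integrable lborel (\<lambda>x. indicat_real (cball 0 R) x *\<^sub>R norm (G x) ^ ?n)"
        by (subst (asm) integrable_completion) measurable
      then have "(\<integral>\<^sup>+x. ennreal (norm (indicat_real (cball 0 R) x *\<^sub>R norm (G x) ^ ?n)) \<partial>lborel) < \<infinity>"
        unfolding integrable_iff_bounded by blast
      also have "(\<integral>\<^sup>+x. ennreal (norm (indicat_real (cball 0 R) x *\<^sub>R norm (G x) ^ ?n)) \<partial>lborel)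
          = (\<integral>\<^sup>+x. ennreal (norm (G x) ^ ?n) * indicator (cball 0 R) x \<partial>lborel)"
        by (intro nn_integral_cong) (auto simp: indicator_def)
      finally show ?thesis .
    qed
    show "(LINT y|lborel. f y $ i * bump_slope r (x - y) * ((x - y) \<bullet> axis j 1)) = (LINT y|lborel. bump r (x - y) * G y $ i $ j)"
      if "r > 0" for r i x j
    proof -
      have [measurable]: "bump r \<in> borel_measurable (borel :: (real^'n) measure)" "bump_slope r \<in> borel_measurable (borel :: (real^'n) measure)"
        by (intro borel_measurable_continuous_onI continuous_on_bump)+
      \<comment> \<open>The derivative is taken in \<open>y\<close>, where the kernel is reflected;
        its sign cancels the one in the definition of \<open>weak_partial\<close>.\<close>
      have fd: "frechet_derivative (\<lambda>y. bump r (x - y)) (at y) = (\<lambda>v. - (bump_slope r (x - y) * ((x - y) \<bullet> v)))" for y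
        using frechet_derivative_at[OF has_derivative_bump_reflected] by metis
      have "- (LINT y|lborel. f y $ i * bump_slope r (x - y) * ((x - y) \<bullet> axis j 1))
          = (LINT y|lborel. f y $ i * (- (bump_slope r (x - y) * ((x - y) \<bullet> axis j 1))))"
        by (simp add: mult.assoc)
      also have "\<dots> = (LINT y|lebesgue. f y $ i * (- (bump_slope r (x - y) * ((x - y) \<bullet> axis j 1))))"
        by (rule integral_completion[symmetric]) measurable
      also have "\<dots> = - (LINT y|lebesgue. Df y $ i $ j * bump r (x - y))"
        using Dw[OF test_function_bump[OF that], of i x j] unfolding fd .
      also have "(LINT y|lebesgue. Df y $ i $ j * bump r (x - y)) = (LINT y|lebesgue. G y $ i $ j * bump r (x - y))"
      proof (rule integral_cong_AE)
        show "(\<lambda>y. G y $ i $ j * bump r (x - y)) \<in> borel_measurable lebesgue"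
          by (rule measurable_completion) measurable
        have "(\<lambda>y. Df y $ i $ j) \<in> borel_measurable lebesgue"
          by (rule measurable_compose[OF Dm borel_measurable_continuous_onI]) (intro continuous_intros)
        moreover have "(\<lambda>y. bump r (x - y)) \<in> borel_measurable lebesgue"
          by (rule measurable_completion) measurable
        ultimately show "(\<lambda>y. Df y $ i $ j * bump r (x - y)) \<in> borel_measurable lebesgue"
          by (rule borel_measurable_times)
        show "AE y in lebesgue. Df y $ i $ j * bump r (x - y) = G y $ i $ j * bump r (x - y)"
          using GA by eventually_elim simp
      qed
      also have "\<dots> = (LINT y|lborel. G y $ i $ j * bump r (x - y))"
        by (rule integral_completion) measurable
      finally show ?thesis by (simp add: mult.commute)
    qed
  qed
  then show ?thesis by (rule that)
qed

section \<open>Intermediate dimensions of Hoelder images\<close>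

text \<open>The innermost existential of \<open>intermediate_admissible\<close>, named so that the
  quantifiers over \<open>\<epsilon>\<close> and \<open>\<delta>\<close> can be handled without
  unfolding covers.\<close>

definition has_admissible_cover :: "real \<Rightarrow> 'a::metric_space set \<Rightarrow> real \<Rightarrow> real \<Rightarrow> real \<Rightarrow> bool" where
  "has_admissible_cover \<theta> A s \<delta> \<epsilon> \<longleftrightarrow>
     (\<exists>(I :: nat set) U. A \<subseteq> (\<Union>i\<in>I. U i) \<and>
        (\<forall>i\<in>I. bounded (U i) \<and> \<delta> powr (1 / \<theta>) \<le> diameter (U i) \<and> diameter (U i) \<le> \<delta>) \<and>
        (\<Sum>\<^sub>\<infinity>i\<in>I. ennreal (diameter (U i) powr s)) < ennreal \<epsilon>)"

lemma has_admissible_coverE: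
  assumes "has_admissible_cover \<theta> A s \<delta> \<epsilon>"
  obtains I :: "nat set" and U where "A \<subseteq> (\<Union>i\<in>I. U i)" "\<And>i. i \<in> I \<Longrightarrow> bounded (U i)"
    "\<And>i. i \<in> I \<Longrightarrow> \<delta> powr (1 / \<theta>) \<le> diameter (U i)" "\<And>i. i \<in> I \<Longrightarrow> diameter (U i) \<le> \<delta>"
    "(\<Sum>\<^sub>\<infinity>i\<in>I. ennreal (diameter (U i) powr s)) < ennreal \<epsilon>"
  using assms unfolding has_admissible_cover_def by blast

lemma intermediate_admissible_iff:
  "intermediate_admissible \<theta> A s \<longleftrightarrow>
     (\<forall>\<epsilon>>0. \<exists>\<delta>0>0. \<forall>\<delta>. 0 < \<delta> \<and> \<delta> \<le> \<delta>0 \<longrightarrow> has_admissible_cover \<theta> A s \<delta> \<epsilon>)"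
  unfolding intermediate_admissible_def has_admissible_cover_def by (rule refl)

text \<open>A cover at scale \<open>min \<delta> \<delta>0\<close> competes in the premeasure at
  scale \<open>\<delta>\<close>. Through this the Hausdorff dimension lies below all intermediate
  ones, which fixes the value at 0 in the difference quotients.\<close>

lemma hausdorff_measure_eq_0_if_admissible:
  assumes "intermediate_admissible \<theta> A s"
  shows "hausdorff_measure s A = 0"
proof -
  have le: "hausdorff_premeasure s \<delta> A \<le> ennreal e" if "\<delta> > 0" "e > 0" for \<delta> e
  proof -
    obtain \<delta>0 where \<delta>0: "\<delta>0 > 0" "\<And>d. 0 < d \<Longrightarrow> d \<le> \<delta>0 \<Longrightarrow>
        has_admissible_cover \<theta> A s d e"
      using assms \<open>e > 0\<close> unfolding intermediate_admissible_iff by blast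
    have "has_admissible_cover \<theta> A s (min \<delta> \<delta>0) e" using \<delta>0 that by simp
    then obtain I :: "nat set" and U where U: "A \<subseteq> (\<Union>i\<in>I. U i)" "\<And>i. i \<in> I \<Longrightarrow> bounded (U i)"
      "\<And>i. i \<in> I \<Longrightarrow> min \<delta> \<delta>0 powr (1 / \<theta>) \<le> diameter (U i)"
      "\<And>i. i \<in> I \<Longrightarrow> diameter (U i) \<le> min \<delta> \<delta>0" "(\<Sum>\<^sub>\<infinity>i\<in>I. ennreal (diameter (U i) powr s)) < ennreal e"
      by (rule has_admissible_coverE) blast
    have "hausdorff_premeasure s \<delta> A \<le> (\<Sum>\<^sub>\<infinity>i\<in>I. ennreal (diameter (U i) powr s))"
      unfolding hausdorff_premeasure_def using U(1,2,4) by (intro Inf_lower CollectI exI[of _ I] exI[of _ U]) auto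
    then show ?thesis using U(5) by (meson less_imp_le order_trans)
  qed
  have "hausdorff_premeasure s \<delta> A \<le> 0" if "\<delta> > 0" for \<delta>
  proof (rule ennreal_le_epsilon)
    fix e :: real assume "0 < e"
    then show "hausdorff_premeasure s \<delta> A \<le> 0 + ennreal e" using le[OF that] by simp
  qed
  then have "hausdorff_measure s A \<le> 0" unfolding hausdorff_measure_def by (intro SUP_least) auto
  then show ?thesis by simp
qed

lemma upper_intermediate_dim_eq:
  "\<theta> > 0 \<Longrightarrow> upper_intermediate_dim \<theta> A = Inf {ereal s | s. s > 0 \<and> intermediate_admissible \<theta> A s}"
  by (simp add: upper_intermediate_dim_def)

lemma hausdorff_dim_le_upper_intermediate_dim:
  "\<theta> > 0 \<Longrightarrow> hausdorff_dim A \<le> upper_intermediate_dim \<theta> A"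
  unfolding upper_intermediate_dim_eq hausdorff_dim_def
  by (intro Inf_superset_mono) (auto simp: hausdorff_measure_eq_0_if_admissible)

lemma hausdorff_dim_nonneg: "0 \<le> hausdorff_dim A"
  unfolding hausdorff_dim_def by (intro Inf_greatest) auto

text \<open>For \<open>d \<le> 1\<close> a smaller exponent parameter lowers the least permitted
  diameter, so the same covers remain admissible.\<close>

lemma intermediate_admissible_mono:
  assumes \<theta>: "0 < \<theta>'" "\<theta>' \<le> \<theta>" and adm: "intermediate_admissible \<theta> A s"
  shows "intermediate_admissible \<theta>' A s"
  unfolding intermediate_admissible_iff
proof (intro allI impI)
  fix e :: real assume "e > 0"
  then obtain \<delta>0 where \<delta>0: "\<delta>0 > 0" "\<And>d. 0 < d \<Longrightarrow> d \<le> \<delta>0 \<Longrightarrow>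
        has_admissible_cover \<theta> A s d e"
    using adm unfolding intermediate_admissible_iff by blast
  show "\<exists>\<delta>0>0. \<forall>d. 0 < d \<and> d \<le> \<delta>0 \<longrightarrow>
        has_admissible_cover \<theta>' A s d e"
  proof (intro exI[of _ "min \<delta>0 1"] conjI allI impI)
    fix d assume d: "0 < d \<and> d \<le> min \<delta>0 1"
    have "1 / \<theta> \<le> 1 / \<theta>'" using \<theta> by (simp add: frac_le)
    then have "d powr (1 / \<theta>') \<le> d powr (1 / \<theta>)" using d by (intro powr_mono') auto
    moreover have "has_admissible_cover \<theta> A s d e" using \<delta>0(2)[of d] d by simp
    ultimately show "has_admissible_cover \<theta>' A s d e"
      unfolding has_admissible_cover_def by (meson order_trans)
  qed (use \<delta>0 in auto)
qed

lemma upper_intermediate_dim_mono: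
  "0 < \<theta>' \<Longrightarrow> \<theta>' \<le> \<theta> \<Longrightarrow> upper_intermediate_dim \<theta>' A \<le> upper_intermediate_dim \<theta> A"
  by (auto simp: upper_intermediate_dim_eq intro!: Inf_superset_mono intermediate_admissible_mono)

text \<open>The definition uses \<open>Lim\<close>, which says something only once convergence is
  known. By monotonicity the limit is the infimum over positive \<theta>.\<close>

lemma tendsto_quasi_hausdorff_dim:
  "((\<lambda>\<theta>. upper_intermediate_dim \<theta> A) \<longlongrightarrow> quasi_hausdorff_dim A) (at_right 0)"
proof -
  define L where "L = (INF \<theta>\<in>{0<..}. upper_intermediate_dim \<theta> A)"
  have "((\<lambda>\<theta>. upper_intermediate_dim \<theta> A) \<longlongrightarrow> L) (at_right 0)"
  proof (rule order_tendstoI)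
    fix l assume l: "l < L"
    show "\<forall>\<^sub>F \<theta> in at_right 0. l < upper_intermediate_dim \<theta> A"
      unfolding eventually_at_right_field
    proof (intro exI[of _ 1] conjI allI impI)
      fix \<theta> :: real assume "0 < \<theta>"
      then have "L \<le> upper_intermediate_dim \<theta> A" unfolding L_def by (intro INF_lower) auto
      with l show "l < upper_intermediate_dim \<theta> A" by (rule less_le_trans)
    qed auto
  next
    fix u assume "L < u"
    then obtain t where t: "t > 0" "upper_intermediate_dim t A < u" unfolding L_def by (auto simp: INF_less_iff)
    show "\<forall>\<^sub>F \<theta> in at_right 0. upper_intermediate_dim \<theta> A < u"
      unfolding eventually_at_right_field
    proof (intro exI[of _ t] conjI allI impI)
      fix \<theta> assume "0 < \<theta>" "\<theta> < t"
      then show "upper_intermediate_dim \<theta> A < u"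
        using upper_intermediate_dim_mono[of \<theta> t A] t by (meson le_less_trans less_imp_le)
    qed (fact t)
  qed
  then show ?thesis unfolding quasi_hausdorff_dim_def by (metis tendsto_Lim trivial_limit_at_right_real)
qed

lemma hausdorff_dim_le_quasi_hausdorff_dim: "hausdorff_dim A \<le> quasi_hausdorff_dim A"
proof (rule tendsto_lowerbound[OF tendsto_quasi_hausdorff_dim])
  show "\<forall>\<^sub>F \<theta> in at_right 0. hausdorff_dim A \<le> upper_intermediate_dim \<theta> A"
    unfolding eventually_at_right_field using hausdorff_dim_le_upper_intermediate_dim by (intro exI[of _ 1]) auto
qed simp

section \<open>Transport of covers by Hoelder maps\<close>

lemma infsum_ennreal_le_cmult:
  fixes f g :: "'a \<Rightarrow> real"
  assumes "\<And>i. i \<in> I \<Longrightarrow> f i \<le> B * g i" "B \<ge> 0" "\<And>i. i \<in> I \<Longrightarrow> 0 \<le> g i"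
  shows "(\<Sum>\<^sub>\<infinity>i\<in>I. ennreal (f i)) \<le> ennreal B * (\<Sum>\<^sub>\<infinity>i\<in>I. ennreal (g i))"
proof (rule infsum_le_finite_sums)
  fix F assume F: "finite F" "F \<subseteq> I"
  have "(\<Sum>i\<in>F. ennreal (f i)) \<le> (\<Sum>i\<in>F. ennreal B * ennreal (g i))"
    using assms F by (intro sum_mono) (auto simp: ennreal_mult[symmetric] subset_iff intro!: ennreal_leI)
  also have "\<dots> = ennreal B * (\<Sum>i\<in>F. ennreal (g i))" by (simp add: sum_distrib_left)
  also have "\<dots> \<le> ennreal B * (\<Sum>\<^sub>\<infinity>i\<in>I. ennreal (g i))"
    using F by (intro mult_left_mono) (auto simp: nonneg_infsum_complete intro: SUP_upper)
  finally show "(\<Sum>i\<in>F. ennreal (f i)) \<le> ennreal B * (\<Sum>\<^sub>\<infinity>i\<in>I. ennreal (g i))" .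
qed (auto intro: nonneg_summable_on_complete)

text \<open>Small images are enlarged by one extra point, since the members of an admissible cover
  must not be too small.\<close>

lemma enlarge_to_diameter_ge:
  fixes W :: "'b::euclidean_space set"
  assumes W: "\<And>x y. x \<in> W \<Longrightarrow> y \<in> W \<Longrightarrow> dist x y \<le> D" and D: "D \<ge> 0" and t: "t \<ge> 0"
  shows "\<exists>V. W \<subseteq> V \<and> bounded V \<and> t \<le> diameter V \<and> diameter V \<le> D + t"
proof -
  obtain e :: 'b where e: "norm e = 1" using norm_Basis nonempty_Basis by blast
  obtain v where v: "\<And>x. x \<in> W \<Longrightarrow> dist v x \<le> D"
    using W by (cases "W = {}") auto
  define V where "V = insert v (insert (v + t *\<^sub>R e) W)"
  have dvt: "dist v (v + t *\<^sub>R e) = t" using e t by (simp add: dist_norm)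
  have far: "dist (v + t *\<^sub>R e) x \<le> D + t" if "x \<in> W" for x
    using dist_triangle[of "v + t *\<^sub>R e" x v] v[OF that] dvt by (simp add: dist_commute)
  have near: "dist x y \<le> D + t" if "x \<in> V" "y \<in> V" for x y
    using that v far dvt W D t unfolding V_def
    by (auto simp: dist_commute intro: order_trans[OF v] order_trans[OF W] add_increasing add_increasing2)
  have bV: "bounded V" unfolding bounded_two_points using near by blast
  show ?thesis
  proof (intro exI[of _ V] conjI)
    show "W \<subseteq> V" by (auto simp: V_def)
    show "bounded V" by fact
    show "t \<le> diameter V" using diameter_bounded_bound[OF bV, of v "v + t *\<^sub>R e"] dvt by (simp add: V_def)
    show "diameter V \<le> D + t" using near by (intro diameter_le) (auto simp: V_def dist_norm)
  qed
qed

text \<open>Half of the scale \<open>d\<close> is reserved for the images and half for the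
  enlargement \<open>t\<close>, the least permitted diameter. The lower bound on the diameters of
  the original cover makes \<open>t\<close> at most a constant times
  \<open>diameter (U i) powr \<alpha>\<close>, so the enlarged images are still comparable to the
  Hoelder images and the sum grows by the constant \<open>B\<close> only. Without that lower bound
  the enlargement could not be controlled.\<close>

lemma intermediate_admissible_hoelder_image:
  fixes f :: "'a::metric_space \<Rightarrow> 'b::euclidean_space"
  assumes \<theta>: "0 < \<theta>" "\<theta> < 1" and C: "C > 0" and \<alpha>: "\<alpha> > 0"
    and hoelder: "\<And>x y. x \<in> A \<Longrightarrow> y \<in> A \<Longrightarrow> dist (f x) (f y) \<le> C * dist x y powr \<alpha>"
    and adm: "intermediate_admissible \<theta> A s" and s: "s > 0"
  shows "intermediate_admissible \<theta> (f ` A) (s / \<alpha>)"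
  unfolding intermediate_admissible_iff
proof (intro allI impI)
  fix e :: real assume "e > 0"
  \<comment> \<open>The image diameter is at most \<open>C\<close> times the power from the Hoelder
    bound plus \<open>(2 * C) powr (1 / \<theta>)\<close> times the same power from the enlargement;
    \<open>B\<close> is this total raised to \<open>s / \<alpha>\<close>.\<close>
  define B where "B = (C + (2 * C) powr (1 / \<theta>)) powr (s / \<alpha>)"
  have "C + (2 * C) powr (1 / \<theta>) > 0" using C by (intro add_pos_nonneg) auto
  then have B: "B > 0" unfolding B_def by simp
  have e2: "e / (2 * B) > 0" using \<open>e > 0\<close> B by simp
  obtain \<delta>0 where \<delta>0: "\<delta>0 > 0" "\<And>d. 0 < d \<Longrightarrow> d \<le> \<delta>0 \<Longrightarrow> has_admissible_cover \<theta> A s d (e / (2 * B))"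
    using adm[unfolded intermediate_admissible_iff, rule_format, OF e2] by blast
  define \<gamma> where "\<gamma> = 1 / \<theta> - 1"
  have \<gamma>: "\<gamma> > 0" using \<theta> by (simp add: \<gamma>_def)
  \<comment> \<open>The first bound ensures \<open>r \<le> \<delta>0\<close>; the second gives
    \<open>d powr \<gamma> \<le> 1 / 2\<close>, that is, \<open>t \<le> d / 2\<close>. Here
    \<open>\<theta> < 1\<close> is needed for \<open>\<gamma> > 0\<close>.\<close>
  define \<delta>1 where "\<delta>1 = min (2 * C * \<delta>0 powr \<alpha>) ((1 / 2) powr (1 / \<gamma>))"
  have "\<delta>1 > 0" using C \<delta>0 by (simp add: \<delta>1_def)
  show "\<exists>\<delta>0>0. \<forall>d. 0 < d \<and> d \<le> \<delta>0 \<longrightarrow>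
        has_admissible_cover \<theta> (f ` A) (s / \<alpha>) d e"
  proof (intro exI[of _ \<delta>1] conjI allI impI)
    show "\<delta>1 > 0" by fact
    fix d assume d: "0 < d \<and> d \<le> \<delta>1"
    \<comment> \<open>The scale of the original cover, adjusted so that
      \<open>C * r powr \<alpha>\<close> is exactly \<open>d / 2\<close>.\<close>
    define r where "r = (d / (2 * C)) powr (1 / \<alpha>)"
    have r: "r > 0" "r powr \<alpha> = d / (2 * C)" using d C \<alpha> by (auto simp: r_def powr_powr)
    have "r \<le> \<delta>0"
    proof -
      have "d / (2 * C) \<le> \<delta>0 powr \<alpha>" using d C by (simp add: \<delta>1_def field_simps)
      then have "r \<le> (\<delta>0 powr \<alpha>) powr (1 / \<alpha>)" unfolding r_def using d C \<alpha> by (intro powr_mono2) auto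
      also have "\<dots> = \<delta>0" using \<delta>0 \<alpha> by (simp add: powr_powr)
      finally show ?thesis .
    qed
    then obtain I :: "nat set" and U where U: "A \<subseteq> (\<Union>i\<in>I. U i)"
      "\<And>i. i \<in> I \<Longrightarrow> bounded (U i)" "\<And>i. i \<in> I \<Longrightarrow> r powr (1 / \<theta>) \<le> diameter (U i)" "\<And>i. i \<in> I \<Longrightarrow> diameter (U i) \<le> r"
      "(\<Sum>\<^sub>\<infinity>i\<in>I. ennreal (diameter (U i) powr s)) < ennreal (e / (2 * B))"
      by (rule has_admissible_coverE[OF \<delta>0(2)[OF r(1)]]) blast
    define t where "t = d powr (1 / \<theta>)"
    have t0: "t \<ge> 0" by (simp add: t_def)
    have t_half: "t \<le> d / 2"
    proof -
      have "d powr \<gamma> \<le> ((1 / 2) powr (1 / \<gamma>)) powr \<gamma>" using d \<gamma> by (intro powr_mono2) (auto simp: \<delta>1_def)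
      also have "\<dots> = 1 / 2" using \<gamma> by (simp add: powr_powr)
      finally have "d * d powr \<gamma> \<le> d * (1 / 2)" using d by (intro mult_left_mono) auto
      moreover have "t = d * d powr \<gamma>" unfolding t_def \<gamma>_def using d by (simp add: powr_mult_base)
      ultimately show ?thesis by simp
    qed
    have t_le: "t \<le> (2 * C) powr (1 / \<theta>) * diameter (U i) powr \<alpha>" if "i \<in> I" for i
    proof -
      have "d = (2 * C) * r powr \<alpha>" using r C by simp
      then have "t = (2 * C) powr (1 / \<theta>) * (r powr \<alpha>) powr (1 / \<theta>)" unfolding t_def by (simp only: powr_mult)
      also have "(r powr \<alpha>) powr (1 / \<theta>) = (r powr (1 / \<theta>)) powr \<alpha>" by (simp add: powr_powr mult.commute)
      also have "(2 * C) powr (1 / \<theta>) * \<dots> \<le> (2 * C) powr (1 / \<theta>) * diameter (U i) powr \<alpha>"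
        using U(3)[OF that] \<alpha> by (intro mult_left_mono powr_mono2) auto
      finally show ?thesis .
    qed
    have "\<exists>V. f ` (A \<inter> U i) \<subseteq> V \<and> bounded V \<and> t \<le> diameter V \<and> diameter V \<le> C * diameter (U i) powr \<alpha> + t" if "i \<in> I" for i
    proof (rule enlarge_to_diameter_ge)
      show "0 \<le> C * diameter (U i) powr \<alpha>" using C by simp
      show "0 \<le> t" by fact
      show "dist x y \<le> C * diameter (U i) powr \<alpha>" if xy: "x \<in> f ` (A \<inter> U i)" "y \<in> f ` (A \<inter> U i)" for x y
      proof -
        obtain p q where pq: "p \<in> A" "p \<in> U i" "x = f p" "q \<in> A" "q \<in> U i" "y = f q" using xy by auto
        have "dist x y \<le> C * dist p q powr \<alpha>" using hoelder pq by simp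
        also have "\<dots> \<le> C * diameter (U i) powr \<alpha>"
          using pq C \<alpha> U(2)[OF \<open>i \<in> I\<close>] by (intro mult_left_mono powr_mono2 diameter_bounded_bound) auto
        finally show ?thesis .
      qed
    qed
    then obtain V where V: "\<And>i. i \<in> I \<Longrightarrow> f ` (A \<inter> U i) \<subseteq> V i" "\<And>i. i \<in> I \<Longrightarrow> bounded (V i)"
      "\<And>i. i \<in> I \<Longrightarrow> t \<le> diameter (V i)" "\<And>i. i \<in> I \<Longrightarrow> diameter (V i) \<le> C * diameter (U i) powr \<alpha> + t"
      by metis
    have cover: "f ` A \<subseteq> (\<Union>i\<in>I. V i)" using U(1) V(1) by fastforce
    have small: "diameter (V i) \<le> d" if "i \<in> I" for i
    proof -
      have "diameter (U i) powr \<alpha> \<le> r powr \<alpha>"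
        using U(2,4)[OF that] \<alpha> by (intro powr_mono2 diameter_ge_0) auto
      then have "C * diameter (U i) powr \<alpha> \<le> C * (d / (2 * C))" unfolding r(2) using C by (intro mult_left_mono) auto
      also have "\<dots> = d / 2" using C by simp
      finally show ?thesis using V(4)[OF that] t_half by simp
    qed
    have "diameter (V i) powr (s / \<alpha>) \<le> B * diameter (U i) powr s" if "i \<in> I" for i
    proof -
      have "diameter (V i) \<le> (C + (2 * C) powr (1 / \<theta>)) * diameter (U i) powr \<alpha>"
        using V(4)[OF that] t_le[OF that] by (simp add: distrib_right)
      then have "diameter (V i) powr (s / \<alpha>) \<le> ((C + (2 * C) powr (1 / \<theta>)) * diameter (U i) powr \<alpha>) powr (s / \<alpha>)"
        using s \<alpha> V(2)[OF that] by (intro powr_mono2 diameter_ge_0) auto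
      also have "\<dots> = B * diameter (U i) powr s" using \<alpha> by (simp add: B_def powr_mult powr_powr)
      finally show ?thesis .
    qed
    then have "(\<Sum>\<^sub>\<infinity>i\<in>I. ennreal (diameter (V i) powr (s / \<alpha>))) \<le> ennreal B * (\<Sum>\<^sub>\<infinity>i\<in>I. ennreal (diameter (U i) powr s))"
      using B by (intro infsum_ennreal_le_cmult) auto
    also have "\<dots> \<le> ennreal B * ennreal (e / (2 * B))" by (rule mult_left_mono[OF less_imp_le[OF U(5)]]) simp
    also have "\<dots> = ennreal (e / 2)" using B \<open>e > 0\<close> by (simp flip: ennreal_mult)
    also have "\<dots> < ennreal e" using \<open>e > 0\<close> by (simp add: ennreal_less_iff)
    finally show "has_admissible_cover \<theta> (f ` A) (s / \<alpha>) d e"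
      unfolding has_admissible_cover_def using cover small V(2,3)
      by (intro exI[of _ I] exI[of _ V]) (auto simp: t_def)
  qed
qed

text \<open>Strict inequalities on both sides: the infimum need not be attained, but some admissible
  \<open>s < c\<close> exists and \<open>s / \<alpha>\<close> is admissible for the image.\<close>

lemma upper_intermediate_dim_hoelder_image_less:
  fixes f :: "'a::metric_space \<Rightarrow> 'b::euclidean_space"
  assumes "0 < \<theta>" "\<theta> < 1" "C > 0" and \<alpha>: "\<alpha> > 0"
    and "\<And>x y. x \<in> A \<Longrightarrow> y \<in> A \<Longrightarrow> dist (f x) (f y) \<le> C * dist x y powr \<alpha>"
    and less: "upper_intermediate_dim \<theta> A < ereal c"
  shows "upper_intermediate_dim \<theta> (f ` A) < ereal (c / \<alpha>)"
proof -
  obtain s where s: "s > 0" "intermediate_admissible \<theta> A s" "s < c"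
    using less assms(1) by (auto simp: upper_intermediate_dim_eq Inf_less_iff)
  have "intermediate_admissible \<theta> (f ` A) (s / \<alpha>)"
    by (rule intermediate_admissible_hoelder_image[OF assms(1-5) s(2,1)])
  then have "upper_intermediate_dim \<theta> (f ` A) \<le> ereal (s / \<alpha>)"
    using s \<alpha> assms(1) by (auto simp: upper_intermediate_dim_eq intro!: Inf_lower)
  also have "\<dots> < ereal (c / \<alpha>)" using s \<alpha> by (simp add: divide_strict_right_mono)
  finally show ?thesis .
qed

text \<open>With a real \<open>c\<close> above the slope of \<open>E\<close>, the dimension of
  \<open>E\<close> is eventually below \<open>\<theta> * c\<close>, hence that of the image below
  \<open>\<theta> * c / \<alpha>\<close>. An infinite slope of the image would eventually exceed
  \<open>c / \<alpha>\<close>.\<close>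

theorem right_derivative_hoelder_image_finite:
  fixes f :: "'a::metric_space \<Rightarrow> 'b::euclidean_space"
  assumes C: "C > 0" and \<alpha>: "\<alpha> > 0"
    and hoelder: "\<And>x y. x \<in> E \<Longrightarrow> y \<in> E \<Longrightarrow> dist (f x) (f y) \<le> C * dist x y powr \<alpha>"
    and qE: "quasi_hausdorff_dim E = 0" and qF: "quasi_hausdorff_dim (f ` E) = 0"
    and dE: "has_right_derivative_ereal (\<lambda>\<theta>. upper_intermediate_dim \<theta> E) a 0" and a: "a < \<infinity>"
    and dF: "has_right_derivative_ereal (\<lambda>\<theta>. upper_intermediate_dim \<theta> (f ` E)) b 0"
  shows "b < \<infinity>"
proof (rule ccontr)
  assume "\<not> b < \<infinity>"
  then have b: "b = \<infinity>" by simp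
  \<comment> \<open>The difference quotients subtract the value at 0, which is the Hausdorff
    dimension; it lies between 0 and the quasi-Hausdorff dimension.\<close>
  have zero: "upper_intermediate_dim 0 E = 0" "upper_intermediate_dim 0 (f ` E) = 0"
    using hausdorff_dim_nonneg[of E] hausdorff_dim_nonneg[of "f ` E"]
      hausdorff_dim_le_quasi_hausdorff_dim[of E] hausdorff_dim_le_quasi_hausdorff_dim[of "f ` E"] qE qF
    by (auto simp: upper_intermediate_dim_def)
  obtain c where c: "a < ereal c" using a less_PInf_Ex_of_nat[of a] by auto
  have "\<forall>\<^sub>F \<theta> in at_right 0. upper_intermediate_dim \<theta> E / ereal \<theta> < ereal c"
    using order_tendstoD(2)[OF dE[unfolded has_right_derivative_ereal_def] c] by (simp add: zero)
  moreover have "\<forall>\<^sub>F \<theta> in at_right 0. ereal (c / \<alpha>) < upper_intermediate_dim \<theta> (f ` E) / ereal \<theta>"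
    using order_tendstoD(1)[OF dF[unfolded has_right_derivative_ereal_def b], of "ereal (c / \<alpha>)"] by (simp add: zero)
  moreover have "\<forall>\<^sub>F \<theta> in at_right 0. \<theta> \<in> {0<..<1::real}"
    by (rule eventually_at_right_real) simp
  ultimately have "\<forall>\<^sub>F \<theta> in at_right (0::real). False"
  proof eventually_elim
    case (elim \<theta>)
    have "upper_intermediate_dim \<theta> E < ereal (\<theta> * c)"
      using elim by (simp add: ereal_divide_less_pos)
    then have "upper_intermediate_dim \<theta> (f ` E) < ereal (\<theta> * c / \<alpha>)"
      using elim by (intro upper_intermediate_dim_hoelder_image_less[OF _ _ C \<alpha> hoelder]) auto
    moreover have "ereal (\<theta> * (c / \<alpha>)) < upper_intermediate_dim \<theta> (f ` E)"
      using elim by (simp add: ereal_less_divide_pos)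
    ultimately show False by simp
  qed
  then show False by simp
qed

theorem proposition1p5:
  fixes E F :: "(real^'n) set" and a b :: ereal
  assumes "CARD('n) \<ge> 2"
    and "compact E" and "compact F"
    and "quasi_hausdorff_dim E = 0" and "quasi_hausdorff_dim F = 0"
    and "has_right_derivative_ereal (\<lambda>\<theta>. upper_intermediate_dim \<theta> E) a 0"
    and "has_right_derivative_ereal (\<lambda>\<theta>. upper_intermediate_dim \<theta> F) b 0"
    and "a < b" and "b = \<infinity>"
  shows "\<not> (\<exists>f :: real^'n \<Rightarrow> real^'n. quasiconformal UNIV UNIV f \<and> f ` E = F)"
proof
  assume "\<exists>f :: real^'n \<Rightarrow> real^'n. quasiconformal UNIV UNIV f \<and> f ` E = F"
  then obtain f :: "real^'n \<Rightarrow> real^'n" where qc: "quasiconformal UNIV UNIV f" and F: "F = f ` E" by blast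
  obtain G K where "quasiregular_W1n f G K"
    by (rule quasiregular_W1n_if_quasiconformal[OF assms(1) qc])
  then interpret quasiregular_W1n f G K .
  obtain C \<alpha> where C: "C > 0" "\<alpha> > 0" and
    hoelder: "\<And>x y. x \<in> E \<Longrightarrow> y \<in> E \<Longrightarrow> dist (f x) (f y) \<le> C * dist x y powr \<alpha>"
    using hoelder_on_compact[OF \<open>compact E\<close>] by blast
  have "b < \<infinity>"
    by (rule right_derivative_hoelder_image_finite[OF C hoelder]) (use assms F in auto)
  then show False using assms by simp
qed

end
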